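(* Let $\underline\omega_0$ be a limit state on the scaling algebra $\underline{\mathfrak A}$, with GNS objects $(\mathcal H_0,\pi_0,\Omega_0)$. Let $\mathcal Z$ be a compact Hausdorff space, $\nu$ a regular Borel probability measure on $\mathcal Z$, and $\underline\omega_z$ ($z\in\mathcal Z$) multiplicative limit states with GNS objects $(\mathcal H_z,\pi_z,\Omega_z)$ such that $\underline\omega_0(\underline A)=\int_{\mathcal Z}d\nu(z)\,\underline\omega_z(\underline A)$ for all $\underline A\in\underline{\mathfrak A}$ and such that $\underline C\mapsto(z\mapsto\underline\omega_z(\underline C))$ is a (well-defined) surjective map $\mathfrak Z(\underline{\mathfrak A})\to\mathcal C(\mathcal Z)$. Identify $\mathcal H_0$ with $\int_{\mathcal Z}^\Gamma d\nu(z)\,\mathcal H_z$, where $\Gamma=\{z\mapsto\pi_z(\underline A)\Omega_z\,|\,\underline A\in\underline{\mathfrak A}\}$, via the unitary $\pi_0(\underline A)\Omega_0\mapsto\int_{\mathcal Z}^\Gamma d\nu(z)\,\pi_z(\underline A)\Omega_z$. Then all operators $\pi_0(\underline A)$, $\underline A\in\underline{\mathfrak A}$, are decomposable, and $\pi_0=\int_{\mathcal Z}^\Gamma d\nu(z)\,\pi_z$. If $\underline A\in\mathfrak Z(\underline{\mathfrak A})$, then $\pi_0(\underline A)$ is diagonal, with $\pi_0(\underline A)=\int_{\mathcal Z}^\Gamma d\nu(z)\,\underline\omega_z(\underline A)\mathbf 1$.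
   Context: Nets. Minkowski space is $\mathbb R^{s+1}$. A net of algebras assigns to each open bounded region $\mathcal O\subset\mathbb R^{s+1}$ a C*-algebra $\mathfrak A(\mathcal O)$ with $\mathfrak A(\mathcal O_1)\subset\mathfrak A(\mathcal O_2)$ if $\mathcal O_1\subset\mathcal O_2$; $\mathfrak A$ also denotes the quasilocal algebra (C*-inductive limit). A local net with symmetry group $\mathcal G$ (a Lie group of point transformations of Minkowski space containing the translations) is a net with a representation $g\mapsto\alpha_g$ of $\mathcal G$ by automorphisms such that (i) $[A_1,A_2]=0$ if $A_i\in\mathfrak A(\mathcal O_i)$ with $\mathcal O_1,\mathcal O_2$ spacelike separated, (ii) $\alpha_g\mathfrak A(\mathcal O)=\mathfrak A(g.\mathcal O)$. It is in a positive energy representation if moreover the $\mathfrak A(\mathcal O)$ are W*-algebras on a common Hilbert space $\mathcal H$, $\alpha_g=\mathrm{ad}\,U(g)$ for a strongly continuous unitary representation $U$ of $\mathcal G$, the joint spectrum of the generators of the translations lies in the closed forward light cone, and there is a vector $\Omega\in\mathcal H$ invariant under all $U(g)$ and cyclic for $\mathfrak A$. It is in the vacuum sector if moreover $\Omega$ is unique up to scalars as a translation-invariant vector. Standing assumption: $\mathfrak A$ is a fixed local net in the vacuum sector with symmetry group the Poincaré group $\mathcal P_+^\uparrow$; $\omega=(\Omega|\,\cdot\,\Omega)$. Scaling algebra. $\underline{\mathfrak B}$ is the C*-algebra of bounded functions $\underline B:\mathbb R_+\to\mathcal B(\mathcal H)$, $\lambda\mapsto\underline B_\lambda$, with pointwise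 operations and norm $\sup_\lambda\|\underline B_\lambda\|$. $\underline{\mathcal G}$ is the group generated by Poincaré transformations and dilations, with elements $g=(\mu,x,\Lambda)$, $\mu\in\mathbb R_+$; it acts by $(\underline\alpha_g\underline B)_\lambda=\alpha_{\lambda\mu x,\Lambda}(\underline B_{\lambda\mu})$. Put $\underline{\mathfrak A}(\mathcal O)=\{\underline A\in\underline{\mathfrak B}\,|\,\underline A_\lambda\in\mathfrak A(\lambda\mathcal O)\ \forall\lambda>0,\ g\mapsto\underline\alpha_g(\underline A)\text{ norm continuous}\}$; $\underline{\mathfrak A}$ is the associated quasilocal C*-algebra. Its center $\mathfrak Z(\underline{\mathfrak A})$ consists of the functions $\lambda\mapsto f(\lambda)\mathbf 1$ with $f:\mathbb R_+\to\mathbb C$ bounded and uniformly continuous with respect to the multiplicative group structure. Limit states. A mean $\mathsf m$ is a state on $\mathfrak Z(\underline{\mathfrak A})$; it is asymptotic if $\mathsf m(f)=0$ whenever $f(\lambda)=0$ for small $\lambda$, and multiplicative if $\mathsf m(fg)=\mathsf m(f)\mathsf m(g)$. Let $\omega:\underline{\mathfrak A}\to\mathfrak Z(\underline{\mathfrak A})$, $(\omega(\underline A))_\lambda=\omega(\underline A_\lambda)\mathbf 1$. A limit state is a state $\underline\omega_0=\mathsf m\circ\omega$ on $\underline{\mathfrak A}$ with $\mathsf m$ an asymptotic mean; it is called multiplicative if $\mathsf m$ is. Direct integrals. Let $\mathcal Z$ be compact Hausdorff with finite regular Borel measure $\nu$ and $\mathcal H_z$, $z\in\mathcal Z$, Hilbert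 spaces (no separability assumed). A fundamental family is a linear subspace $\Gamma\subset\prod_z\mathcal H_z$ such that $z\mapsto\|\chi(z)\|^2$ is $\nu$-integrable for each $\chi\in\Gamma$. It extends to a unique minimal vector space $\bar\Gamma\supset\Gamma$ in $\prod_z\mathcal H_z$ such that: $z\mapsto\|\chi(z)\|^2$ is integrable for $\chi\in\bar\Gamma$; $\bar\Gamma$ is closed under a.e. modification and under multiplication by $L^\infty(\mathcal Z,\nu)$ functions; $\bar\Gamma$ is complete in the seminorm $(\int d\nu(z)\|\chi(z)\|^2)^{1/2}$. The direct integral $\int_{\mathcal Z}^\Gamma d\nu(z)\mathcal H_z$ is $\bar\Gamma$ modulo vectors of zero seminorm. (It is a fact that the set $\Gamma$ in the claim is a fundamental family and the indicated map extends to a unitary.) An operator $B$ on $\int^\Gamma_{\mathcal Z}d\nu(z)\mathcal H_z$ is decomposable, written $B=\int_{\mathcal Z}^\Gamma d\nu(z)B(z)$, if there are $B(z)\in\mathcal B(\mathcal H_z)$ with $\mathrm{ess\,sup}_z\|B(z)\|<\infty$ such that $z\mapsto B(z)\chi(z)$ lies in $\bar\Gamma$ for each $\chi\in\bar\Gamma$ and $(B\chi)(z)=B(z)\chi(z)$ a.e.; it is diagonal if $B(z)=f(z)\mathbf 1$ with $f\in L^\infty(\mathcal Z,\nu)$. For representations, $\pi=\int_{\mathcal Z}^\Gamma d\nu(z)\pi_z$ means $\pi(\underline A)=\int_{\mathcal Z}^\Gamma d\nu(z)\pi_z(\underline A)$ for all $\underline A$. *)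

theory Defs
  imports "HOL-Probability.Probability"
begin

section \<open>Complex Hilbert spaces as types, and operators on them\<close>

text \<open>
  The Hilbert space of the vacuum representation is a type. The real inner product inherited
  from \<^class>\<open>real_inner\<close> is the real part of the complex one, so norm, topology and completeness
  are those of the library. Inner products are linear in the second argument throughout.
\<close>

class complex_hilbert = real_inner + complete_space +
  fixes scaleC :: "complex \<Rightarrow> 'a \<Rightarrow> 'a" (infixr "*\<^sub>C" 75)
    and cinner :: "'a \<Rightarrow> 'a \<Rightarrow> complex"
  assumes scaleC_add_right: "c *\<^sub>C (x + y) = c *\<^sub>C x + c *\<^sub>C y"
    and scaleC_add_left: "(c + d) *\<^sub>C x = c *\<^sub>C x + d *\<^sub>C x"
    and scaleC_scaleC: "c *\<^sub>C (d *\<^sub>C x) = (c * d) *\<^sub>C x"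
    and scaleC_of_real: "complex_of_real r *\<^sub>C x = r *\<^sub>R x"
    and cinner_commute: "cinner x y = cnj (cinner y x)"
    and cinner_add_right: "cinner x (y + z) = cinner x y + cinner x z"
    and cinner_scaleC_right: "cinner x (c *\<^sub>C y) = c * cinner x y"
    and inner_eq_Re_cinner: "inner x y = Re (cinner x y)"

lemma cinner_self: "cinner x x = complex_of_real ((norm x)\<^sup>2)"
proof -
  have "Im (cinner x x) = 0"
    using cinner_commute[of x x] by (simp add: complex_eq_iff)
  moreover have "Re (cinner x x) = (norm x)\<^sup>2"
    by (simp add: inner_eq_Re_cinner[symmetric] power2_norm_eq_inner)
  ultimately show ?thesis
    by (simp add: complex_eq_iff)
qed

lemma norm_scaleC: "norm (c *\<^sub>C x) = cmod c * norm (x :: 'a :: complex_hilbert)"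
proof -
  have "cinner (c *\<^sub>C x) (c *\<^sub>C x) = c * cnj (c * cinner x x)"
    by (metis cinner_commute cinner_scaleC_right)
  also have "\<dots> = complex_of_real ((cmod c * norm x)\<^sup>2)"
    by (simp add: cinner_self power_mult_distrib mult.assoc[symmetric] flip: complex_norm_square)
  finally have "(norm (c *\<^sub>C x))\<^sup>2 = (cmod c * norm x)\<^sup>2"
    by (simp only: cinner_self of_real_eq_iff)
  then show ?thesis
    by simp
qed

text \<open>The operator \<open>c\<cdot>1\<close>; \<open>c\<cdot>T\<close> is written as \<open>scalar_op c o\<^sub>L T\<close>.\<close>

lift_definition scalar_op :: "complex \<Rightarrow> 'h::complex_hilbert \<Rightarrow>\<^sub>L 'h" is "\<lambda>c x. c *\<^sub>C x"
proof -
  fix c :: complex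
  show "bounded_linear (\<lambda>x::'h. c *\<^sub>C x)"
    by (rule bounded_linear_intro[where K = "cmod c"])
      (simp_all add: scaleC_add_right scaleC_scaleC norm_scaleC mult.commute
        flip: scaleC_of_real)
qed

text \<open>\<open>\<B>(\<H>)\<close>: the complex linear ones among the bounded real linear operators.\<close>

definition bounded_operators :: "('h::complex_hilbert \<Rightarrow>\<^sub>L 'h) set" where
  "bounded_operators = {T :: 'h \<Rightarrow>\<^sub>L 'h. \<forall>c x. T (c *\<^sub>C x) = c *\<^sub>C T x}"

definition op_adj :: "('h::complex_hilbert \<Rightarrow>\<^sub>L 'h) \<Rightarrow> 'h \<Rightarrow>\<^sub>L 'h" where
  "op_adj T = (THE S :: 'h \<Rightarrow>\<^sub>L 'h. \<forall>x y. cinner (S x) y = cinner x (T y))"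

definition unitary_op :: "('h::complex_hilbert \<Rightarrow>\<^sub>L 'h) \<Rightarrow> bool" where
  "unitary_op T \<longleftrightarrow> T \<in> bounded_operators \<and>
     op_adj T o\<^sub>L T = id_blinfun \<and> T o\<^sub>L op_adj T = id_blinfun"

definition projection_op :: "('h::complex_hilbert \<Rightarrow>\<^sub>L 'h) \<Rightarrow> bool" where
  "projection_op T \<longleftrightarrow> T \<in> bounded_operators \<and> op_adj T = T \<and> T o\<^sub>L T = T"

definition commutant :: "('h::complex_hilbert \<Rightarrow>\<^sub>L 'h) set \<Rightarrow> ('h \<Rightarrow>\<^sub>L 'h) set" where
  "commutant M = {T \<in> bounded_operators. \<forall>S\<in>M. T o\<^sub>L S = S o\<^sub>L T}"

definition von_neumann_algebra :: "('h::complex_hilbert \<Rightarrow>\<^sub>L 'h) set \<Rightarrow> bool" where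
  "von_neumann_algebra M \<longleftrightarrow>
     M \<subseteq> bounded_operators \<and> (\<forall>T\<in>M. op_adj T \<in> M) \<and> commutant (commutant M) = M"


section \<open>Minkowski space and the Poincare group\<close>

text \<open>
  Points of Minkowski space have the index \<^const>\<open>None\<close> for the time coordinate and \<open>Some i\<close> for
  the space coordinates, so that \<open>s\<close> is the cardinality of the index type.
\<close>

type_synonym 's mink = "real ^ 's option"
type_synonym 's mink_mat = "real ^ 's option ^ 's option"

definition mprod :: "'s::finite mink \<Rightarrow> 's mink \<Rightarrow> real" where
  "mprod x y = x $ None * y $ None - (\<Sum>i\<in>UNIV. x $ Some i * y $ Some i)"

definition spacelike_separated :: "'s::finite mink set \<Rightarrow> 's mink set \<Rightarrow> bool" where
  "spacelike_separated O1 O2 \<longleftrightarrow> (\<forall>x\<in>O1. \<forall>y\<in>O2. mprod (x - y) (x - y) < 0)"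

definition forward_cone :: "'s::finite mink set" where
  "forward_cone = {p. 0 \<le> p $ None \<and> 0 \<le> mprod p p}"

definition lorentz :: "'s::finite mink_mat set" where
  "lorentz = {L. (\<forall>x y. mprod (L *v x) (L *v y) = mprod x y) \<and> det L = 1 \<and> 0 < L $ None $ None}"

definition poincare :: "('s::finite mink \<times> 's mink_mat) set" where
  "poincare = UNIV \<times> lorentz"

fun poincare_mult :: "'s::finite mink \<times> 's mink_mat \<Rightarrow> 's mink \<times> 's mink_mat \<Rightarrow> 's mink \<times> 's mink_mat"
  where "poincare_mult (x, L) (y, M) = (x + L *v y, L ** M)"

fun poincare_act :: "'s::finite mink \<times> 's mink_mat \<Rightarrow> 's mink \<Rightarrow> 's mink" where
  "poincare_act (x, L) y = L *v y + x"

definition region :: "'s::finite mink set \<Rightarrow> bool" where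
  "region R \<longleftrightarrow> open R \<and> bounded R"


section \<open>Local nets in the vacuum sector\<close>

definition spectral_measure :: "('p::topological_space set \<Rightarrow> 'h::complex_hilbert \<Rightarrow>\<^sub>L 'h) \<Rightarrow> bool" where
  "spectral_measure E \<longleftrightarrow>
     (\<forall>S\<in>sets borel. projection_op (E S)) \<and>
     E UNIV = id_blinfun \<and>
     (\<forall>S\<in>sets borel. \<forall>T\<in>sets borel. E (S \<inter> T) = E S o\<^sub>L E T) \<and>
     (\<forall>F :: nat \<Rightarrow> 'p set. range F \<subseteq> sets borel \<and> disjoint_family F \<longrightarrow>
        (\<forall>\<psi>. (\<lambda>n. E (F n) \<psi>) sums E (\<Union>n. F n) \<psi>))"

definition spectral_distribution ::
    "('p::topological_space set \<Rightarrow> 'h::complex_hilbert \<Rightarrow>\<^sub>L 'h) \<Rightarrow> 'h \<Rightarrow> 'p measure" where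
  "spectral_distribution E \<psi> =
     measure_of UNIV (sets borel) (\<lambda>S. ennreal (Re (cinner \<psi> (E S \<psi>))))"

definition spectral_support :: "('p::topological_space set \<Rightarrow> 'h::complex_hilbert \<Rightarrow>\<^sub>L 'h) \<Rightarrow> 'p set" where
  "spectral_support E = {p. \<forall>S. open S \<and> p \<in> S \<longrightarrow> E S \<noteq> 0}"

text \<open>
  By the SNAG theorem the translations have a unique spectral measure with
  \<open>U(x) = \<integral> e\<^sup>i\<^sup>p\<^sup>x dE(p)\<close>, \<open>px\<close> being the Minkowski product; the joint spectrum of their
  generators is the support of \<open>E\<close>. The diagonal matrix elements of \<open>U(x)\<close> determine \<open>U(x)\<close>.
\<close>

definition spectrum_condition :: "('s::finite mink \<times> 's mink_mat \<Rightarrow> 'h::complex_hilbert \<Rightarrow>\<^sub>L 'h) \<Rightarrow> bool" where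
  "spectrum_condition U \<longleftrightarrow>
     (\<exists>E :: 's mink set \<Rightarrow> 'h \<Rightarrow>\<^sub>L 'h. spectral_measure E \<and>
        (\<forall>x \<psi>. cinner \<psi> (U (x, mat 1) \<psi>) =
           (LINT p|spectral_distribution E \<psi>. exp (\<i> * complex_of_real (mprod p x)))) \<and>
        spectral_support E \<subseteq> forward_cone)"

definition ad :: "('h::complex_hilbert \<Rightarrow>\<^sub>L 'h) \<Rightarrow> ('h \<Rightarrow>\<^sub>L 'h) \<Rightarrow> 'h \<Rightarrow>\<^sub>L 'h" where
  "ad V T = V o\<^sub>L T o\<^sub>L op_adj V"

definition quasilocal :: "('s::finite mink set \<Rightarrow> ('h::complex_hilbert \<Rightarrow>\<^sub>L 'h) set) \<Rightarrow> ('h \<Rightarrow>\<^sub>L 'h) set" where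
  "quasilocal \<AA> = closure (\<Union>R\<in>Collect region. \<AA> R)"

text \<open>The automorphisms are \<open>\<alpha>\<^sub>g = ad (U g)\<close>.\<close>

locale vacuum_net =
  fixes \<AA> :: "'s::finite mink set \<Rightarrow> ('h::complex_hilbert \<Rightarrow>\<^sub>L 'h) set"
    and U :: "'s mink \<times> 's mink_mat \<Rightarrow> 'h \<Rightarrow>\<^sub>L 'h"
    and \<Omega> :: 'h
  assumes local_algebra: "region R \<Longrightarrow> von_neumann_algebra (\<AA> R)"
    and isotony: "region R1 \<Longrightarrow> region R2 \<Longrightarrow> R1 \<subseteq> R2 \<Longrightarrow> \<AA> R1 \<subseteq> \<AA> R2"
    and locality: "region R1 \<Longrightarrow> region R2 \<Longrightarrow> spacelike_separated R1 R2 \<Longrightarrow>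
          A1 \<in> \<AA> R1 \<Longrightarrow> A2 \<in> \<AA> R2 \<Longrightarrow> A1 o\<^sub>L A2 = A2 o\<^sub>L A1"
    and unitary: "g \<in> poincare \<Longrightarrow> unitary_op (U g)"
    and mult: "g \<in> poincare \<Longrightarrow> h \<in> poincare \<Longrightarrow> U (poincare_mult g h) = U g o\<^sub>L U h"
    and strongly_continuous: "continuous_on poincare (\<lambda>g. U g \<psi>)"
    and covariance: "g \<in> poincare \<Longrightarrow> region R \<Longrightarrow> ad (U g) ` \<AA> R = \<AA> (poincare_act g ` R)"
    and spectrum: "spectrum_condition U"
    and normalized: "norm \<Omega> = 1"
    and invariant: "g \<in> poincare \<Longrightarrow> U g \<Omega> = \<Omega>"
    and cyclic: "closure ((\<lambda>A :: 'h \<Rightarrow>\<^sub>L 'h. A \<Omega>) ` quasilocal \<AA>) = UNIV"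
    and unique_vacuum: "(\<And>x. U (x, mat 1) \<psi> = \<psi>) \<Longrightarrow> \<exists>c. \<psi> = c *\<^sub>C \<Omega>"


section \<open>The scaling algebra\<close>

typedef posreal = "{r::real. 0 < r}" morphisms real_of_pos Pos
  by (rule exI[of _ 1]) simp

setup_lifting type_definition_posreal

instantiation posreal :: times
begin
lift_definition times_posreal :: "posreal \<Rightarrow> posreal \<Rightarrow> posreal" is "(*)"
  by simp
instance ..
end

instantiation posreal :: metric_space
begin
definition dist_posreal :: "posreal \<Rightarrow> posreal \<Rightarrow> real" where
  "dist_posreal a b = dist (real_of_pos a) (real_of_pos b)"
definition uniformity_posreal :: "(posreal \<times> posreal) filter" where
  "uniformity_posreal = (INF e\<in>{0<..}. principal {(x, y). dist x y < e})"
definition open_posreal :: "posreal set \<Rightarrow> bool" where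
  "open_posreal S \<longleftrightarrow> (\<forall>x\<in>S. \<forall>\<^sub>F (x', y) in uniformity. x' = x \<longrightarrow> y \<in> S)"
instance
proof
  fix x y z :: posreal
  show "dist x y = 0 \<longleftrightarrow> x = y"
    by (simp add: dist_posreal_def real_of_pos_inject)
  show "dist x y \<le> dist x z + dist y z"
    unfolding dist_posreal_def by (rule dist_triangle2)
qed (simp_all add: uniformity_posreal_def open_posreal_def)
end

type_synonym 'h scaling_fun = "posreal \<Rightarrow> 'h \<Rightarrow>\<^sub>L 'h"

definition bounded_scaling_funs :: "'h::complex_hilbert scaling_fun set" where
  "bounded_scaling_funs = {B. range B \<subseteq> bounded_operators \<and> bounded (range B)}"

definition sup_norm :: "'h::complex_hilbert scaling_fun \<Rightarrow> real" where
  "sup_norm B = (SUP l. norm (B l))"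

text \<open>\<open>(m, x, L)\<close> stands for the point transformation \<open>y \<mapsto> m (L y + x)\<close>.\<close>

definition scaling_group :: "(posreal \<times> 's::finite mink \<times> 's mink_mat) set" where
  "scaling_group = UNIV \<times> UNIV \<times> lorentz"

fun scaling_action :: "('s::finite mink \<times> 's mink_mat \<Rightarrow> 'h::complex_hilbert \<Rightarrow>\<^sub>L 'h) \<Rightarrow>
    posreal \<times> 's mink \<times> 's mink_mat \<Rightarrow> 'h scaling_fun \<Rightarrow> 'h scaling_fun" where
  "scaling_action U (m, x, L) B = (\<lambda>l. ad (U (real_of_pos (l * m) *\<^sub>R x, L)) (B (l * m)))"

definition scaling_local ::
    "('s::finite mink set \<Rightarrow> ('h::complex_hilbert \<Rightarrow>\<^sub>L 'h) set) \<Rightarrow>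
     ('s mink \<times> 's mink_mat \<Rightarrow> 'h \<Rightarrow>\<^sub>L 'h) \<Rightarrow> 's mink set \<Rightarrow> 'h scaling_fun set" where
  "scaling_local \<AA> U R = {A \<in> bounded_scaling_funs.
     (\<forall>l. A l \<in> \<AA> ((\<lambda>x. real_of_pos l *\<^sub>R x) ` R)) \<and>
     (\<forall>g\<in>scaling_group.
        ((\<lambda>h. sup_norm (\<lambda>l. scaling_action U h A l - scaling_action U g A l)) \<longlongrightarrow> 0)
          (at g within scaling_group))}"

definition scaling_algebra ::
    "('s::finite mink set \<Rightarrow> ('h::complex_hilbert \<Rightarrow>\<^sub>L 'h) set) \<Rightarrow>
     ('s mink \<times> 's mink_mat \<Rightarrow> 'h \<Rightarrow>\<^sub>L 'h) \<Rightarrow> 'h scaling_fun set" where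
  "scaling_algebra \<AA> U = {A \<in> bounded_scaling_funs.
     \<forall>e>0. \<exists>R. region R \<and> (\<exists>B\<in>scaling_local \<AA> U R. sup_norm (\<lambda>l. A l - B l) < e)}"

definition center :: "'h::complex_hilbert scaling_fun set \<Rightarrow> 'h scaling_fun set" where
  "center M = {C \<in> M. \<forall>A\<in>M. \<forall>l. C l o\<^sub>L A l = A l o\<^sub>L C l}"


section \<open>States, limit states and representations\<close>

definition state_on :: "'h::complex_hilbert scaling_fun set \<Rightarrow> ('h scaling_fun \<Rightarrow> complex) \<Rightarrow> bool" where
  "state_on M \<phi> \<longleftrightarrow>
     (\<forall>A\<in>M. \<forall>B\<in>M. \<phi> (\<lambda>l. A l + B l) = \<phi> A + \<phi> B) \<and>
     (\<forall>c. \<forall>A\<in>M. \<phi> (\<lambda>l. scalar_op c o\<^sub>L A l) = c * \<phi> A) \<and>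
     (\<forall>A\<in>M. \<phi> (\<lambda>l. op_adj (A l) o\<^sub>L A l) \<in> \<real> \<and> 0 \<le> Re (\<phi> (\<lambda>l. op_adj (A l) o\<^sub>L A l))) \<and>
     \<phi> (\<lambda>l. id_blinfun) = 1"

text \<open>In the following \<open>M\<close> stands for the scaling algebra, and means are states on its center.\<close>

definition asymptotic_mean :: "'h::complex_hilbert scaling_fun set \<Rightarrow> ('h scaling_fun \<Rightarrow> complex) \<Rightarrow> bool" where
  "asymptotic_mean M m \<longleftrightarrow> state_on (center M) m \<and>
     (\<forall>C\<in>center M. (\<exists>e>0. \<forall>l. real_of_pos l < e \<longrightarrow> C l = 0) \<longrightarrow> m C = 0)"

definition multiplicative_mean :: "'h::complex_hilbert scaling_fun set \<Rightarrow> ('h scaling_fun \<Rightarrow> complex) \<Rightarrow> bool" where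
  "multiplicative_mean M m \<longleftrightarrow>
     (\<forall>C\<in>center M. \<forall>D\<in>center M. m (\<lambda>l. C l o\<^sub>L D l) = m C * m D)"

definition vacuum_expectation :: "'h::complex_hilbert \<Rightarrow> 'h scaling_fun \<Rightarrow> 'h scaling_fun" where
  "vacuum_expectation \<Omega> A = (\<lambda>l. scalar_op (cinner \<Omega> (A l \<Omega>)))"

definition limit_state ::
    "'h::complex_hilbert scaling_fun set \<Rightarrow> 'h \<Rightarrow> ('h scaling_fun \<Rightarrow> complex) \<Rightarrow> bool" where
  "limit_state M \<Omega> \<phi> \<longleftrightarrow>
     (\<exists>m. asymptotic_mean M m \<and> (\<forall>A\<in>M. \<phi> A = m (vacuum_expectation \<Omega> A)))"

definition multiplicative_limit_state ::
    "'h::complex_hilbert scaling_fun set \<Rightarrow> 'h \<Rightarrow> ('h scaling_fun \<Rightarrow> complex) \<Rightarrow> bool" where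
  "multiplicative_limit_state M \<Omega> \<phi> \<longleftrightarrow>
     (\<exists>m. asymptotic_mean M m \<and> multiplicative_mean M m \<and>
        (\<forall>A\<in>M. \<phi> A = m (vacuum_expectation \<Omega> A)))"

text \<open>
  Hilbert spaces with explicit carrier: the fibers of a direct integral vary with the base point,
  and the direct integral itself is a space of classes of sections.
\<close>

record 'a hspace =
  hcarrier :: "'a set"
  hzero :: 'a
  hadd :: "'a \<Rightarrow> 'a \<Rightarrow> 'a"
  hscale :: "complex \<Rightarrow> 'a \<Rightarrow> 'a"
  hip :: "'a \<Rightarrow> 'a \<Rightarrow> complex"

definition hdiff :: "'a hspace \<Rightarrow> 'a \<Rightarrow> 'a \<Rightarrow> 'a" where
  "hdiff K x y = hadd K x (hscale K (-1) y)"

definition hnorm :: "'a hspace \<Rightarrow> 'a \<Rightarrow> real" where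
  "hnorm K x = sqrt (Re (hip K x x))"

locale hilbert_space =
  fixes K :: "'a hspace"
  assumes zero_closed: "hzero K \<in> hcarrier K"
    and add_closed: "x \<in> hcarrier K \<Longrightarrow> y \<in> hcarrier K \<Longrightarrow> hadd K x y \<in> hcarrier K"
    and scale_closed: "x \<in> hcarrier K \<Longrightarrow> hscale K c x \<in> hcarrier K"
    and add_assoc: "x \<in> hcarrier K \<Longrightarrow> y \<in> hcarrier K \<Longrightarrow> z \<in> hcarrier K \<Longrightarrow>
          hadd K (hadd K x y) z = hadd K x (hadd K y z)"
    and add_comm: "x \<in> hcarrier K \<Longrightarrow> y \<in> hcarrier K \<Longrightarrow> hadd K x y = hadd K y x"
    and add_zero: "x \<in> hcarrier K \<Longrightarrow> hadd K x (hzero K) = x"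
    and diff_self: "x \<in> hcarrier K \<Longrightarrow> hdiff K x x = hzero K"
    and scale_add_right: "x \<in> hcarrier K \<Longrightarrow> y \<in> hcarrier K \<Longrightarrow>
          hscale K c (hadd K x y) = hadd K (hscale K c x) (hscale K c y)"
    and scale_add_left: "x \<in> hcarrier K \<Longrightarrow>
          hscale K (c + d) x = hadd K (hscale K c x) (hscale K d x)"
    and scale_scale: "x \<in> hcarrier K \<Longrightarrow> hscale K c (hscale K d x) = hscale K (c * d) x"
    and scale_one: "x \<in> hcarrier K \<Longrightarrow> hscale K 1 x = x"
    and ip_commute: "x \<in> hcarrier K \<Longrightarrow> y \<in> hcarrier K \<Longrightarrow> hip K x y = cnj (hip K y x)"
    and ip_add_right: "x \<in> hcarrier K \<Longrightarrow> y \<in> hcarrier K \<Longrightarrow> z \<in> hcarrier K \<Longrightarrow>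
          hip K x (hadd K y z) = hip K x y + hip K x z"
    and ip_scale_right: "x \<in> hcarrier K \<Longrightarrow> y \<in> hcarrier K \<Longrightarrow>
          hip K x (hscale K c y) = c * hip K x y"
    and ip_nonneg: "x \<in> hcarrier K \<Longrightarrow> 0 \<le> Re (hip K x x)"
    and ip_eq_zero: "x \<in> hcarrier K \<Longrightarrow> hip K x x = 0 \<Longrightarrow> x = hzero K"
    and complete: "(\<And>n. X n \<in> hcarrier K) \<Longrightarrow>
          (\<And>e. e > 0 \<Longrightarrow> \<exists>N. \<forall>i\<ge>N. \<forall>j\<ge>N. hnorm K (hdiff K (X i) (X j)) < e) \<Longrightarrow>
          \<exists>x\<in>hcarrier K. (\<lambda>n. hnorm K (hdiff K (X n) x)) \<longlonglongrightarrow> 0"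

text \<open>Operators matter only through their values on the carrier.\<close>

definition hops :: "'a hspace \<Rightarrow> ('a \<Rightarrow> 'a) set" where
  "hops K = {T. (\<forall>x\<in>hcarrier K. T x \<in> hcarrier K) \<and>
     (\<forall>x\<in>hcarrier K. \<forall>y\<in>hcarrier K. T (hadd K x y) = hadd K (T x) (T y)) \<and>
     (\<forall>c. \<forall>x\<in>hcarrier K. T (hscale K c x) = hscale K c (T x)) \<and>
     (\<exists>c. \<forall>x\<in>hcarrier K. hnorm K (T x) \<le> c * hnorm K x)}"

definition hunitary :: "'a hspace \<Rightarrow> 'b hspace \<Rightarrow> ('a \<Rightarrow> 'b) \<Rightarrow> bool" where
  "hunitary K L V \<longleftrightarrow> bij_betw V (hcarrier K) (hcarrier L) \<and>
     (\<forall>x\<in>hcarrier K. \<forall>y\<in>hcarrier K. V (hadd K x y) = hadd L (V x) (V y)) \<and>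
     (\<forall>c. \<forall>x\<in>hcarrier K. V (hscale K c x) = hscale L c (V x)) \<and>
     (\<forall>x\<in>hcarrier K. \<forall>y\<in>hcarrier K. hip L (V x) (V y) = hip K x y)"

text \<open>The operator \<open>V T V\<^sup>-\<^sup>1\<close>.\<close>

definition transport :: "'a hspace \<Rightarrow> ('a \<Rightarrow> 'b) \<Rightarrow> ('a \<Rightarrow> 'a) \<Rightarrow> 'b \<Rightarrow> 'b" where
  "transport K V T = (\<lambda>y. V (T (inv_into (hcarrier K) V y)))"

definition representation ::
    "'h::complex_hilbert scaling_fun set \<Rightarrow> 'a hspace \<Rightarrow> ('h scaling_fun \<Rightarrow> 'a \<Rightarrow> 'a) \<Rightarrow> bool" where
  "representation M K \<pi> \<longleftrightarrow>
     (\<forall>A\<in>M. \<pi> A \<in> hops K) \<and>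
     (\<forall>A\<in>M. \<forall>B\<in>M. \<forall>x\<in>hcarrier K. \<pi> (\<lambda>l. A l + B l) x = hadd K (\<pi> A x) (\<pi> B x)) \<and>
     (\<forall>c. \<forall>A\<in>M. \<forall>x\<in>hcarrier K. \<pi> (\<lambda>l. scalar_op c o\<^sub>L A l) x = hscale K c (\<pi> A x)) \<and>
     (\<forall>A\<in>M. \<forall>B\<in>M. \<forall>x\<in>hcarrier K. \<pi> (\<lambda>l. A l o\<^sub>L B l) x = \<pi> A (\<pi> B x)) \<and>
     (\<forall>A\<in>M. \<forall>x\<in>hcarrier K. \<forall>y\<in>hcarrier K.
        hip K (\<pi> (\<lambda>l. op_adj (A l)) x) y = hip K x (\<pi> A y))"

definition gns_triple :: "'h::complex_hilbert scaling_fun set \<Rightarrow> ('h scaling_fun \<Rightarrow> complex) \<Rightarrow>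
    'a hspace \<Rightarrow> ('h scaling_fun \<Rightarrow> 'a \<Rightarrow> 'a) \<Rightarrow> 'a \<Rightarrow> bool" where
  "gns_triple M \<phi> K \<pi> w \<longleftrightarrow>
     hilbert_space K \<and> representation M K \<pi> \<and> w \<in> hcarrier K \<and>
     (\<forall>x\<in>hcarrier K. \<forall>e>0. \<exists>A\<in>M. hnorm K (hdiff K x (\<pi> A w)) < e) \<and>
     (\<forall>A\<in>M. \<phi> A = hip K w (\<pi> A w))"


section \<open>Direct integrals\<close>

definition regular_borel :: "'z::topological_space measure \<Rightarrow> bool" where
  "regular_borel \<nu> \<longleftrightarrow> sets \<nu> = sets borel \<and>
     (\<forall>S\<in>sets \<nu>.
        emeasure \<nu> S = (SUP C\<in>{C. C \<in> sets \<nu> \<and> compact C \<and> C \<subseteq> S}. emeasure \<nu> C) \<and>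
        emeasure \<nu> S = (INF G\<in>{G. open G \<and> S \<subseteq> G}. emeasure \<nu> G))"

text \<open>
  Spaces of sections are to be closed under modification on arbitrary subsets of null sets.
  Measurability and integrability of sections therefore refer to the completion of the measure.
\<close>

definition sections :: "('z \<Rightarrow> 'a hspace) \<Rightarrow> ('z \<Rightarrow> 'a) set" where
  "sections H = {\<xi>. \<forall>z. \<xi> z \<in> hcarrier (H z)}"

definition section_subspace :: "('z \<Rightarrow> 'a hspace) \<Rightarrow> ('z \<Rightarrow> 'a) set \<Rightarrow> bool" where
  "section_subspace H \<Delta> \<longleftrightarrow> \<Delta> \<subseteq> sections H \<and> (\<lambda>z. hzero (H z)) \<in> \<Delta> \<and>
     (\<forall>\<xi>\<in>\<Delta>. \<forall>\<psi>\<in>\<Delta>. (\<lambda>z. hadd (H z) (\<xi> z) (\<psi> z)) \<in> \<Delta>) \<and>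
     (\<forall>c. \<forall>\<xi>\<in>\<Delta>. (\<lambda>z. hscale (H z) c (\<xi> z)) \<in> \<Delta>)"

definition fundamental_family :: "'z measure \<Rightarrow> ('z \<Rightarrow> 'a hspace) \<Rightarrow> ('z \<Rightarrow> 'a) set \<Rightarrow> bool" where
  "fundamental_family \<nu> H \<Delta> \<longleftrightarrow> section_subspace H \<Delta> \<and>
     (\<forall>\<xi>\<in>\<Delta>. integrable (completion \<nu>) (\<lambda>z. (hnorm (H z) (\<xi> z))\<^sup>2))"

definition Linf :: "'z measure \<Rightarrow> ('z \<Rightarrow> complex) set" where
  "Linf \<nu> = {f \<in> borel_measurable (completion \<nu>). \<exists>c. AE z in \<nu>. cmod (f z) \<le> c}"

definition section_norm :: "'z measure \<Rightarrow> ('z \<Rightarrow> 'a hspace) \<Rightarrow> ('z \<Rightarrow> 'a) \<Rightarrow> real" where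
  "section_norm \<nu> H \<xi> = sqrt (LINT z|completion \<nu>. (hnorm (H z) (\<xi> z))\<^sup>2)"

definition section_dist :: "'z measure \<Rightarrow> ('z \<Rightarrow> 'a hspace) \<Rightarrow> ('z \<Rightarrow> 'a) \<Rightarrow> ('z \<Rightarrow> 'a) \<Rightarrow> real" where
  "section_dist \<nu> H \<xi> \<psi> = section_norm \<nu> H (\<lambda>z. hdiff (H z) (\<xi> z) (\<psi> z))"

definition complete_section_space :: "'z measure \<Rightarrow> ('z \<Rightarrow> 'a hspace) \<Rightarrow> ('z \<Rightarrow> 'a) set \<Rightarrow> bool" where
  "complete_section_space \<nu> H \<Delta> \<longleftrightarrow> fundamental_family \<nu> H \<Delta> \<and>
     (\<forall>\<xi>\<in>\<Delta>. \<forall>\<psi>\<in>sections H. (AE z in \<nu>. \<psi> z = \<xi> z) \<longrightarrow> \<psi> \<in> \<Delta>) \<and>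
     (\<forall>f\<in>Linf \<nu>. \<forall>\<xi>\<in>\<Delta>. (\<lambda>z. hscale (H z) (f z) (\<xi> z)) \<in> \<Delta>) \<and>
     (\<forall>X :: nat \<Rightarrow> 'z \<Rightarrow> 'a. range X \<subseteq> \<Delta> \<and>
        (\<forall>e>0. \<exists>N. \<forall>i\<ge>N. \<forall>j\<ge>N. section_dist \<nu> H (X i) (X j) < e) \<longrightarrow>
        (\<exists>\<xi>\<in>\<Delta>. (\<lambda>n. section_dist \<nu> H (X n) \<xi>) \<longlonglongrightarrow> 0))"

definition section_hull :: "'z measure \<Rightarrow> ('z \<Rightarrow> 'a hspace) \<Rightarrow> ('z \<Rightarrow> 'a) set \<Rightarrow> ('z \<Rightarrow> 'a) set" where
  "section_hull \<nu> H \<Gamma> = \<Inter>{\<Delta>. \<Gamma> \<subseteq> \<Delta> \<and> complete_section_space \<nu> H \<Delta>}"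

definition section_class ::
    "'z measure \<Rightarrow> ('z \<Rightarrow> 'a hspace) \<Rightarrow> ('z \<Rightarrow> 'a) set \<Rightarrow> ('z \<Rightarrow> 'a) \<Rightarrow> ('z \<Rightarrow> 'a) set" where
  "section_class \<nu> H \<Gamma> \<xi> = {\<psi> \<in> section_hull \<nu> H \<Gamma>. section_dist \<nu> H \<psi> \<xi> = 0}"

definition section_rep :: "('z \<Rightarrow> 'a) set \<Rightarrow> 'z \<Rightarrow> 'a" where
  "section_rep X = (SOME \<xi>. \<xi> \<in> X)"

definition direct_integral ::
    "'z measure \<Rightarrow> ('z \<Rightarrow> 'a hspace) \<Rightarrow> ('z \<Rightarrow> 'a) set \<Rightarrow> ('z \<Rightarrow> 'a) set hspace" where
  "direct_integral \<nu> H \<Gamma> =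
    \<lparr> hcarrier = section_class \<nu> H \<Gamma> ` section_hull \<nu> H \<Gamma>,
      hzero = section_class \<nu> H \<Gamma> (\<lambda>z. hzero (H z)),
      hadd = (\<lambda>X Y. section_class \<nu> H \<Gamma> (\<lambda>z. hadd (H z) (section_rep X z) (section_rep Y z))),
      hscale = (\<lambda>c X. section_class \<nu> H \<Gamma> (\<lambda>z. hscale (H z) c (section_rep X z))),
      hip = (\<lambda>X Y. LINT z|completion \<nu>. hip (H z) (section_rep X z) (section_rep Y z)) \<rparr>"

text \<open>\<open>B = \<integral> d\<nu>(z) b(z)\<close>:\<close>

definition decomposes_as :: "'z measure \<Rightarrow> ('z \<Rightarrow> 'a hspace) \<Rightarrow> ('z \<Rightarrow> 'a) set \<Rightarrow>
    (('z \<Rightarrow> 'a) set \<Rightarrow> ('z \<Rightarrow> 'a) set) \<Rightarrow> ('z \<Rightarrow> 'a \<Rightarrow> 'a) \<Rightarrow> bool" where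
  "decomposes_as \<nu> H \<Gamma> B b \<longleftrightarrow>
     B \<in> hops (direct_integral \<nu> H \<Gamma>) \<and>
     (\<forall>z. b z \<in> hops (H z)) \<and>
     (\<exists>c. AE z in \<nu>. \<forall>x\<in>hcarrier (H z). hnorm (H z) (b z x) \<le> c * hnorm (H z) x) \<and>
     (\<forall>\<xi>\<in>section_hull \<nu> H \<Gamma>. (\<lambda>z. b z (\<xi> z)) \<in> section_hull \<nu> H \<Gamma> \<and>
        B (section_class \<nu> H \<Gamma> \<xi>) = section_class \<nu> H \<Gamma> (\<lambda>z. b z (\<xi> z)))"

definition decomposable :: "'z measure \<Rightarrow> ('z \<Rightarrow> 'a hspace) \<Rightarrow> ('z \<Rightarrow> 'a) set \<Rightarrow>
    (('z \<Rightarrow> 'a) set \<Rightarrow> ('z \<Rightarrow> 'a) set) \<Rightarrow> bool" where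
  "decomposable \<nu> H \<Gamma> B \<longleftrightarrow> (\<exists>b. decomposes_as \<nu> H \<Gamma> B b)"

definition diagonal :: "'z measure \<Rightarrow> ('z \<Rightarrow> 'a hspace) \<Rightarrow> ('z \<Rightarrow> 'a) set \<Rightarrow>
    (('z \<Rightarrow> 'a) set \<Rightarrow> ('z \<Rightarrow> 'a) set) \<Rightarrow> bool" where
  "diagonal \<nu> H \<Gamma> B \<longleftrightarrow> (\<exists>f\<in>Linf \<nu>. decomposes_as \<nu> H \<Gamma> B (\<lambda>z. hscale (H z) (f z)))"

definition gns_sections :: "'h::complex_hilbert scaling_fun set \<Rightarrow>
    ('z \<Rightarrow> 'h scaling_fun \<Rightarrow> 'a \<Rightarrow> 'a) \<Rightarrow> ('z \<Rightarrow> 'a) \<Rightarrow> ('z \<Rightarrow> 'a) set" where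
  "gns_sections M \<pi> w = (\<lambda>A z. \<pi> z A (w z)) ` M"

end

(*
The vacuum vector turns everything into scalar functions of the scaling parameter. Since a mean is
positive on the scalar part of the center (nonnegative functions have square roots there), every
multiplicative limit state satisfies |pi_z(A)x| <= sup |A_l| |x|, uniformly in z. If C is central,
then C_l commutes with the translates of its adjoint, so the energy distributions of C_l Omega and
C_l^* Omega are reflections of each other; as both live on the positive half axis, the two vectors
are translation invariant and C_l Omega is a multiple of Omega. Multiplicativity of the mean then gives
omega_z(C^* C) = |omega_z(C)|^2, hence pi_z(C) = omega_z(C) 1. By surjectivity onto C(Z) the family
Gamma is therefore a module over C(Z), which is dense in L^infinity for the L^2 distance, so Gamma is
dense in the section space it generates. The isometry pi_0(A) Omega_0 |-> (pi_z(A) Omega_z)_z then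
extends to a unitary, and the decomposition of pi_0(A) holds on Gamma and follows by continuity.
*)
theory Submission
  imports Defs
begin

section \<open>Adjoints on a Hilbert space\<close>

text \<open>No separability is assumed, so the fibres have no measurable bases, and
  \<open>section_hull\<close> is merely an intersection over all complete section spaces containing
  \<Gamma>. It is made accessible through \<open>Hull\<close>, the sections approximable by \<Gamma>
  in mean square: this space is complete, and it lies in every competitor. The obstacle is that
  measurability of distances between sections is unknown while the closure properties of
  \<open>Hull\<close> are being established. Hence \<open>close_to\<close> speaks of upper
  integrals, and measurability is recovered afterwards from almost everywhere limits. Stability
  under multiplication by bounded measurable functions is the one closure property that the vector
  space \<Gamma> does not simply pass on to its closure; the analysis of the center supplies it. The
  definition of a representation gives each operator some bound in each fibre, whereas the extension
  from \<Gamma> to \<open>Hull\<close> takes one bound for all z. Central elements enter through the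
  eigenvalue of \<open>C l\<close> at \<Omega>: a limit state sees C^* C only through |C_l
  \<Omega>|^2.\<close>

instance complex_hilbert \<subseteq> banach ..

text \<open>The representing vector minimizes \<open>\<parallel>x\<parallel>\<^sup>2 - 2 f x\<close>; minimizing sequences are Cauchy by the
  parallelogram law.\<close>

lemma riesz_representation:
  fixes f :: "'a::{real_inner,complete_space} \<Rightarrow> real"
  assumes "bounded_linear f"
  shows "\<exists>y. \<forall>x. f x = inner y x"
proof -
  interpret f: bounded_linear f by fact
  obtain K where K: "\<And>x. norm (f x) \<le> norm x * K" using f.bounded by blast
  define J where "J x = inner x x - 2 * f x" for x
  have low: "- K\<^sup>2 \<le> J x" for x
  proof -
    have "f x \<le> norm x * K" using K[of x] by simp
    moreover have "0 \<le> (norm x - K)\<^sup>2" by simp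
    ultimately show ?thesis
      by (simp add: J_def power2_diff flip: power2_norm_eq_inner)
  qed
  define I where "I = Inf (range J)"
  have bdd: "bdd_below (range J)" using low by (meson bdd_belowI2)
  have ge: "I \<le> J x" for x unfolding I_def by (rule cInf_lower) (use bdd in auto)
  have "\<exists>x. J x < I + inverse (of_nat (Suc n))" for n
    using cInf_less_iff[OF _ bdd, of "I + inverse (of_nat (Suc n))"] unfolding I_def[symmetric]
    by (auto simp del: of_nat_Suc)
  then obtain X where X: "\<And>n. J (X n) < I + inverse (of_nat (Suc n))" by metis
  \<comment> \<open>The linear parts cancel, so the parallelogram law keeps its form with J in place
    of the squared norm; the value at the midpoint is at least I.\<close>
  have par: "inner (x - y) (x - y) = 2 * (J x + J y) - 4 * J ((1/2) *\<^sub>R (x + y))" for x y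
    by (simp add: J_def algebra_simps f.add f.scaleR inner_commute)
  have dist: "inner (X m - X n) (X m - X n) \<le> 2 * (inverse (of_nat (Suc m)) + inverse (of_nat (Suc n)))" for m n
    using X[of m] X[of n] ge[of "(1/2) *\<^sub>R (X m + X n)"] unfolding par by simp
  have "Cauchy X"
  proof (rule metric_CauchyI)
    fix e :: real assume e: "0 < e"
    obtain N where N: "inverse (real (Suc N)) < e\<^sup>2 / 4"
      using reals_Archimedean[of "e\<^sup>2/4"] e by auto
    have "dist (X m) (X n) < e" if "m \<ge> N" "n \<ge> N" for m n
    proof -
      have "inverse (real (Suc m)) \<le> inverse (real (Suc N))" "inverse (real (Suc n)) \<le> inverse (real (Suc N))"
        using that by (auto simp: field_simps)
      moreover have "2 * (a + b) < c" if "a \<le> d" "b \<le> d" "d < c / 4" for a b c d :: real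
        using that by argo
      ultimately have "2 * (inverse (real (Suc m)) + inverse (real (Suc n))) < e\<^sup>2"
        using N by blast
      with dist[of m n] have "(dist (X m) (X n))\<^sup>2 < e\<^sup>2"
        unfolding dist_norm power2_norm_eq_inner by (rule order.strict_trans1)
      then show ?thesis using e by (simp add: power2_less_imp_less)
    qed
    then show "\<exists>N. \<forall>m\<ge>N. \<forall>n\<ge>N. dist (X m) (X n) < e" by blast
  qed
  then obtain y where y: "X \<longlonglongrightarrow> y" by (meson Cauchy_convergent_iff convergent_def)
  have Jy: "(\<lambda>n. J (X n)) \<longlonglongrightarrow> J y"
    unfolding J_def by (intro tendsto_intros y f.tendsto)
  have "(\<lambda>n. I + inverse (of_nat (Suc n))) \<longlonglongrightarrow> I + 0"
    by (intro tendsto_intros LIMSEQ_inverse_real_of_nat)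
  then have "J y \<le> I + 0"
    by (rule LIMSEQ_le[OF Jy]) (use X less_imp_le in blast)
  then have min: "J y \<le> J x" for x using ge[of x] by simp
  have "f x = inner y x" for x
  proof -
    define a where "a = inner y x - f x"
    define b where "b = inner x x"
    have b: "b \<ge> 0" by (simp add: b_def)
    \<comment> \<open>Minimizing 2 t a + t^2 b over t suggests - a / b; the denominator b + 1 is
      safe for b = 0 and still makes the value negative unless a = 0.\<close>
    define t where "t = - a / (b + 1)"
    have "0 \<le> J (y + t *\<^sub>R x) - J y" using min[of "y + t *\<^sub>R x"] by simp
    also have "\<dots> = 2 * t * a + t\<^sup>2 * b"
      by (simp add: J_def a_def b_def algebra_simps f.add f.scaleR inner_commute power2_eq_square)
    finally have "0 \<le> (b + 1)\<^sup>2 * (2 * t * a + t\<^sup>2 * b)" by simp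
    also have "\<dots> = 2 * ((b + 1) * t) * a * (b + 1) + ((b + 1) * t)\<^sup>2 * b"
      by (simp add: algebra_simps power2_eq_square)
    also have "(b + 1) * t = - a" using b by (simp add: t_def)
    finally have "a\<^sup>2 * (b + 2) \<le> 0"
      by (simp add: algebra_simps power2_eq_square)
    then have "a = 0" using b
      by (smt (verit) mult_pos_pos zero_less_power2)
    then show ?thesis by (simp add: a_def)
  qed
  then show ?thesis by blast
qed

section \<open>Sesquilinear calculus for the complex inner product\<close>

context complex_hilbert begin

lemma cinner_add_left: "cinner (x + y) z = cinner x z + cinner y z"
  by (metis cinner_commute cinner_add_right complex_cnj_add)

lemma cinner_scaleC_left: "cinner (c *\<^sub>C x) y = cnj c * cinner x y"
  by (metis cinner_commute cinner_scaleC_right complex_cnj_mult)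

end

lemma cinner_eqI:
  fixes x y :: "'h::complex_hilbert"
  assumes "\<And>z. cinner x z = cinner y z"
  shows "x = y"
  using assms by (metis inner_eq_Re_cinner vector_eq_rdot inner_commute)

text \<open>Rotating the second argument by \<i> turns the imaginary part into a real part. This
  carries identities for \<open>inner\<close>, the setting of the Riesz theorem above, over to
  \<open>cinner\<close>.\<close>

lemma cinner_eq_inner: "cinner x y = Complex (inner x y) (- inner x (\<i> *\<^sub>C y))"
  by (simp add: inner_eq_Re_cinner cinner_scaleC_right complex_eq_iff)

lemma norm_eqI_cinner:
  fixes x :: "'a::complex_hilbert" and y :: "'b::complex_hilbert"
  assumes "cinner x x = cinner y y"
  shows "norm x = norm y"
proof -
  from assms have "(norm x)\<^sup>2 = (norm y)\<^sup>2" by (simp add: cinner_self flip: of_real_power)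
  then show ?thesis by simp
qed

lemma scaleC_zero_right [simp]: "c *\<^sub>C (0 :: 'h::complex_hilbert) = 0"
  using norm_scaleC[of c "0::'h"] by simp

lemma scaleC_zero_left [simp]: "0 *\<^sub>C (x :: 'h::complex_hilbert) = 0"
  using norm_scaleC[of 0 "x::'h"] by simp

lemma scaleC_one [simp]: "1 *\<^sub>C (x :: 'h::complex_hilbert) = x"
  using scaleC_of_real[of 1 x] by simp

lemma cinner_zero_right [simp]: "cinner (x :: 'h::complex_hilbert) 0 = 0"
  using cinner_scaleC_right[of x 0 x] by simp

lemma cinner_zero_left [simp]: "cinner 0 (x :: 'h::complex_hilbert) = 0"
  using cinner_scaleC_left[of 0 x x] by simp

lemma scaleC_minus_left: "(- c) *\<^sub>C x = - (c *\<^sub>C (x :: 'h::complex_hilbert))"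
  using scaleC_add_left[of "-c" c x] by (simp add: eq_neg_iff_add_eq_0)

lemma scaleC_minus_right: "c *\<^sub>C (- x) = - (c *\<^sub>C (x :: 'h::complex_hilbert))"
  using scaleC_add_right[of c "-x" x] by (simp add: eq_neg_iff_add_eq_0)

lemma scaleC_diff_left: "(c - d) *\<^sub>C x = c *\<^sub>C x - d *\<^sub>C (x :: 'h::complex_hilbert)"
  using scaleC_add_left[of c "-d" x] by (simp add: scaleC_minus_left)

lemma scaleC_diff_right: "c *\<^sub>C (x - y) = c *\<^sub>C x - c *\<^sub>C (y :: 'h::complex_hilbert)"
  using scaleC_add_right[of c x "-y"] by (simp add: scaleC_minus_right)

lemma cinner_minus_right: "cinner x (- y) = - cinner x (y :: 'h::complex_hilbert)"
  using cinner_add_right[of x "-y" y] by (simp add: eq_neg_iff_add_eq_0)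

lemma cinner_minus_left: "cinner (- x) y = - cinner x (y :: 'h::complex_hilbert)"
  using cinner_add_left[of "-x" x y] by (simp add: eq_neg_iff_add_eq_0)

lemma cinner_diff_right: "cinner x (y - z) = cinner x y - cinner x (z :: 'h::complex_hilbert)"
  using cinner_add_right[of x y "-z"] by (simp add: cinner_minus_right)

lemma cinner_diff_left: "cinner (x - y) z = cinner x z - cinner y (z :: 'h::complex_hilbert)"
  using cinner_add_left[of x "-y" z] by (simp add: cinner_minus_left)

lemma cmod_cinner_le: "cmod (cinner x y) \<le> norm x * norm (y :: 'h::complex_hilbert)"
proof (cases "cinner x y = 0")
  case False
  \<comment> \<open>The phase that rotates the inner product onto the positive half axis, where the
    real Cauchy-Schwarz inequality applies.\<close>
  define c where "c = cnj (cinner x y) / cmod (cinner x y)"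
  have c: "cmod c = 1" using False by (simp add: c_def norm_divide)
  have "c * cinner x y = cmod (cinner x y)"
    using False by (simp add: c_def mult.commute[of "cnj _"] complex_norm_square[symmetric] power2_eq_square)
  then have "cmod (cinner x y) = inner x (c *\<^sub>C y)"
    by (simp add: inner_eq_Re_cinner cinner_scaleC_right)
  also have "\<dots> \<le> norm x * norm (c *\<^sub>C y)" by (rule norm_cauchy_schwarz)
  finally show ?thesis by (simp add: norm_scaleC c)
qed simp

section \<open>Bounded operators, adjoints and conjugation by unitaries\<close>

lemma scalar_op_apply [simp]: "blinfun_apply (scalar_op c) x = c *\<^sub>C x"
  by (simp add: scalar_op.rep_eq)

lemma bounded_operatorsD: "T \<in> bounded_operators \<Longrightarrow> T (c *\<^sub>C x) = c *\<^sub>C T x"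
  by (simp add: bounded_operators_def)

lemma bounded_operators_closed [simp, intro]:
  "S \<in> bounded_operators \<Longrightarrow> T \<in> bounded_operators \<Longrightarrow> S o\<^sub>L T \<in> bounded_operators"
  "S \<in> bounded_operators \<Longrightarrow> T \<in> bounded_operators \<Longrightarrow> S + T \<in> bounded_operators"
  "S \<in> bounded_operators \<Longrightarrow> T \<in> bounded_operators \<Longrightarrow> S - T \<in> bounded_operators"
  "scalar_op c \<in> bounded_operators" "id_blinfun \<in> bounded_operators" "0 \<in> bounded_operators"
  by (auto simp: bounded_operators_def blinfun.add_left blinfun.diff_left scaleC_add_right
      scaleC_diff_right scaleC_scaleC mult.commute)

text \<open>Riesz is applied to the real functionals y \<mapsto> \<open>inner x (T y)\<close>.
  Complex linearity of T enters at the end, where the real identity is also used at \<i> y to obtain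
  the complex one.\<close>

lemma adjoint_exists:
  assumes T: "T \<in> bounded_operators"
  shows "\<exists>S::'h::complex_hilbert \<Rightarrow>\<^sub>L 'h. \<forall>x y. cinner (S x) y = cinner x (T y)"
proof -
  have "\<exists>s. \<forall>y. inner x (T y) = inner s y" for x
    by (rule riesz_representation) (auto intro!: bounded_linear_intros)
  then obtain s where s: "\<And>x y. inner x (T y) = inner (s x) y" by metis
  have eqI: "u = v" if "\<And>z. inner u z = inner v z" for u v :: 'h
    using that by (metis vector_eq_rdot inner_commute)
  have add: "s (x + y) = s x + s y" for x y
    by (rule eqI) (simp add: s[symmetric] inner_add_left)
  have scale: "s (r *\<^sub>R x) = r *\<^sub>R s x" for r x
    by (rule eqI) (simp add: s[symmetric])
  have "norm (s x) \<le> norm x * norm T" for x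
  proof -
    have "(norm (s x))\<^sup>2 = inner x (T (s x))" by (simp add: s power2_norm_eq_inner)
    also have "\<dots> \<le> norm x * norm (T (s x))" by (rule norm_cauchy_schwarz)
    also have "\<dots> \<le> norm x * (norm T * norm (s x))"
      by (intro mult_left_mono norm_blinfun) auto
    finally have "norm (s x) * norm (s x) \<le> (norm x * norm T) * norm (s x)"
      by (simp add: power2_eq_square mult_ac)
    then show ?thesis
      by (cases "s x = 0") (auto dest: mult_right_le_imp_le)
  qed
  then have bl: "bounded_linear s" using add scale by (intro bounded_linear_intro) auto
  have "cinner (Blinfun s x) y = cinner x (T y)" for x y
    by (simp add: bounded_linear_Blinfun_apply[OF bl] cinner_eq_inner s[symmetric]
        flip: bounded_operatorsD[OF T])
  then show ?thesis by blast
qed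

text \<open>\<open>op_adj\<close> is a definite description, and inner products separate vectors, so
  every candidate satisfying the adjoint relation is its value.\<close>

lemma op_adj_eqI:
  fixes S T :: "'h::complex_hilbert \<Rightarrow>\<^sub>L 'h"
  assumes "\<And>x y. cinner (S x) y = cinner x (T y)"
  shows "op_adj T = S"
  unfolding op_adj_def
proof (rule the_equality)
  fix S' :: "'h \<Rightarrow>\<^sub>L 'h" assume "\<forall>x y. cinner (S' x) y = cinner x (T y)"
  then show "S' = S"
    by (intro blinfun_eqI cinner_eqI) (simp add: assms)
qed (simp add: assms)

lemma cinner_op_adj:
  fixes T :: "'h::complex_hilbert \<Rightarrow>\<^sub>L 'h"
  assumes "T \<in> bounded_operators"
  shows "cinner (op_adj T x) y = cinner x (T y)"
proof -
  obtain S :: "'h \<Rightarrow>\<^sub>L 'h" where S: "\<And>x y. cinner (S x) y = cinner x (T y)"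
    using adjoint_exists[OF assms] by blast
  show ?thesis by (simp add: op_adj_eqI[OF S] S)
qed

lemma cinner_op_adj':
  assumes "T \<in> bounded_operators"
  shows "cinner (T x) y = cinner x (op_adj T y)"
  using arg_cong[OF cinner_op_adj[OF assms, of y x], of cnj] by (simp flip: cinner_commute)

lemma op_adj_bounded_operators [simp, intro]:
  assumes "T \<in> bounded_operators"
  shows "op_adj T \<in> bounded_operators"
proof -
  have "op_adj T (c *\<^sub>C x) = c *\<^sub>C op_adj T x" for c x
    by (rule cinner_eqI) (simp add: cinner_op_adj[OF assms] cinner_scaleC_left)
  then show ?thesis by (simp add: bounded_operators_def)
qed

lemma op_adj_op_adj [simp]: "T \<in> bounded_operators \<Longrightarrow> op_adj (op_adj T) = T"
  by (rule op_adj_eqI) (rule cinner_op_adj')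

lemma op_adj_comp:
  "S \<in> bounded_operators \<Longrightarrow> T \<in> bounded_operators \<Longrightarrow> op_adj (S o\<^sub>L T) = op_adj T o\<^sub>L op_adj S"
  by (rule op_adj_eqI) (simp add: cinner_op_adj)

lemma op_adj_diff:
  "S \<in> bounded_operators \<Longrightarrow> T \<in> bounded_operators \<Longrightarrow> op_adj (S - T) = op_adj S - op_adj T"
  by (rule op_adj_eqI) (simp add: cinner_op_adj blinfun.diff_left cinner_diff_left cinner_diff_right)

lemma op_adj_scalar [simp]: "op_adj (scalar_op c) = scalar_op (cnj c)"
  by (rule op_adj_eqI) (simp add: cinner_scaleC_left cinner_scaleC_right)

lemma norm_op_adj_le:
  assumes "T \<in> bounded_operators"
  shows "norm (op_adj T) \<le> norm T"
proof (rule norm_blinfun_bound)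
  fix x
  have "(norm (op_adj T x))\<^sup>2 = inner x (T (op_adj T x))"
    by (simp add: inner_eq_Re_cinner power2_norm_eq_inner cinner_op_adj[OF assms])
  also have "\<dots> \<le> norm x * norm (T (op_adj T x))" by (rule norm_cauchy_schwarz)
  also have "\<dots> \<le> norm x * (norm T * norm (op_adj T x))"
    by (intro mult_left_mono norm_blinfun) auto
  finally have "norm (op_adj T x) * norm (op_adj T x) \<le> (norm T * norm x) * norm (op_adj T x)"
    by (simp add: power2_eq_square mult_ac)
  then show "norm (op_adj T x) \<le> norm T * norm x"
    by (cases "op_adj T x = 0") (auto dest: mult_right_le_imp_le)
qed simp

lemma norm_scalar_op_le: "norm (scalar_op c :: 'h::complex_hilbert \<Rightarrow>\<^sub>L 'h) \<le> cmod c"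
  by (rule norm_blinfun_bound) (simp_all add: norm_scaleC)

lemma scalar_op_algebra:
  "scalar_op (c + d) = scalar_op c + scalar_op d"
  "scalar_op (c - d) = scalar_op c - scalar_op d"
  "scalar_op (c * d) = scalar_op c o\<^sub>L scalar_op d"
  "scalar_op 0 = 0" "scalar_op 1 = id_blinfun"
  by (auto intro!: blinfun_eqI simp: scaleC_add_left scaleC_diff_left scaleC_scaleC
      blinfun.add_left blinfun.diff_left)

lemma scalar_op_comp_commute:
  "T \<in> bounded_operators \<Longrightarrow> scalar_op c o\<^sub>L T = T o\<^sub>L scalar_op c"
  by (auto intro!: blinfun_eqI simp: bounded_operatorsD)

lemma unitary_opD:
  assumes "unitary_op V"
  shows "V \<in> bounded_operators" "op_adj V (V x) = x" "V (op_adj V x) = x"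
    "cinner (V x) (V y) = cinner x y" "norm (V x) = norm x" "norm (op_adj V x) = norm x"
proof -
  show V: "V \<in> bounded_operators" using assms by (simp add: unitary_op_def)
  have "(op_adj V o\<^sub>L V) x = x" "(V o\<^sub>L op_adj V) x = x" for x
    using assms by (simp_all add: unitary_op_def del: blinfun_apply_blinfun_compose)
  then have *: "op_adj V (V x) = x" "V (op_adj V x) = x" for x by simp_all
  then show "op_adj V (V x) = x" "V (op_adj V x) = x" by blast+
  show "cinner (V x) (V y) = cinner x y"
    by (simp add: cinner_op_adj'[OF V] *)
  show "norm (V x) = norm x" by (rule norm_eqI_cinner) (simp add: cinner_op_adj'[OF V] *)
  show "norm (op_adj V x) = norm x" by (rule norm_eqI_cinner) (simp add: cinner_op_adj[OF V] *)
qed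

lemma ad_bounded_operators [simp, intro]:
  "unitary_op V \<Longrightarrow> T \<in> bounded_operators \<Longrightarrow> ad V T \<in> bounded_operators"
  by (simp add: ad_def unitary_opD)

lemma ad_add: "ad V (S + T) = ad V S + ad V T"
  and ad_diff: "ad V (S - T) = ad V S - ad V T"
  by (auto intro!: blinfun_eqI simp: ad_def blinfun.add_left blinfun.add_right
      blinfun.diff_left blinfun.diff_right)

lemma ad_comp: "unitary_op V \<Longrightarrow> ad V (S o\<^sub>L T) = ad V S o\<^sub>L ad V T"
  by (auto intro!: blinfun_eqI simp: ad_def unitary_opD)

lemma ad_op_adj: "unitary_op V \<Longrightarrow> T \<in> bounded_operators \<Longrightarrow> ad V (op_adj T) = op_adj (ad V T)"
  by (auto intro!: blinfun_eqI simp: ad_def op_adj_comp unitary_opD)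

lemma ad_scalar: "unitary_op V \<Longrightarrow> ad V (scalar_op c) = scalar_op c"
  by (auto intro!: blinfun_eqI simp: ad_def unitary_opD bounded_operatorsD)

lemma ad_ad: "V \<in> bounded_operators \<Longrightarrow> W \<in> bounded_operators \<Longrightarrow> ad V (ad W T) = ad (V o\<^sub>L W) T"
  by (auto intro!: blinfun_eqI simp: ad_def op_adj_comp)

lemma norm_ad_le:
  assumes "unitary_op V"
  shows "norm (ad V T) \<le> norm T"
proof (rule norm_blinfun_bound)
  fix x
  show "norm (ad V T x) \<le> norm T * norm x"
    using norm_blinfun[of T "op_adj V x"] by (simp add: ad_def unitary_opD[OF assms])
qed simp

section \<open>Commutants and von Neumann algebras\<close>

lemma commutant_closed:
  assumes "S \<in> commutant N" "T \<in> commutant N"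
  shows "S + T \<in> commutant N" "S o\<^sub>L T \<in> commutant N"
proof -
  have *: "S (R x) = R (S x)" "T (R x) = R (T x)" if "R \<in> N" for R x
  proof -
    have "S o\<^sub>L R = R o\<^sub>L S" "T o\<^sub>L R = R o\<^sub>L T" using assms that by (auto simp: commutant_def)
    then show "S (R x) = R (S x)" "T (R x) = R (T x)"
      by (metis blinfun_apply_blinfun_compose)+
  qed
  show "S + T \<in> commutant N" "S o\<^sub>L T \<in> commutant N"
    using assms unfolding commutant_def
    by (auto intro!: blinfun_eqI simp: blinfun.add_left blinfun.add_right *)
qed

lemma scalar_op_commutant: "N \<subseteq> bounded_operators \<Longrightarrow> scalar_op c \<in> commutant N"
  unfolding commutant_def by (auto intro: scalar_op_comp_commute)

text \<open>The definition postulates the bicommutant property and stability under adjoints; sums,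
  products and scalars are obtained by viewing N as the commutant of its commutant.\<close>

lemma von_neumann_algebra_closed:
  assumes "von_neumann_algebra N"
  shows "S \<in> N \<Longrightarrow> T \<in> N \<Longrightarrow> S + T \<in> N" "S \<in> N \<Longrightarrow> T \<in> N \<Longrightarrow> S o\<^sub>L T \<in> N"
    "scalar_op c \<in> N" "S \<in> N \<Longrightarrow> op_adj S \<in> N" "S \<in> N \<Longrightarrow> S \<in> bounded_operators"
proof -
  have eq: "N = commutant (commutant N)" using assms by (simp add: von_neumann_algebra_def)
  show "S \<in> N \<Longrightarrow> T \<in> N \<Longrightarrow> S + T \<in> N" "S \<in> N \<Longrightarrow> T \<in> N \<Longrightarrow> S o\<^sub>L T \<in> N"
    using commutant_closed[of S "commutant N" T] by (simp_all flip: eq)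
  show "scalar_op c \<in> N"
  proof -
    have "commutant N \<subseteq> bounded_operators" by (auto simp: commutant_def)
    from scalar_op_commutant[OF this] show ?thesis by (simp flip: eq)
  qed
qed (use assms in \<open>auto simp: von_neumann_algebra_def\<close>)

section \<open>The scaling algebra is a *-algebra\<close>

lemma bounded_scaling_funs_iff:
  "B \<in> bounded_scaling_funs \<longleftrightarrow> (\<forall>l. B l \<in> bounded_operators) \<and> (\<exists>c. \<forall>l. norm (B l) \<le> c)"
  by (auto simp: bounded_scaling_funs_def bounded_iff)

lemma bounded_scaling_funsI:
  "(\<And>l. B l \<in> bounded_operators) \<Longrightarrow> (\<And>l. norm (B l) \<le> c) \<Longrightarrow> B \<in> bounded_scaling_funs"
  unfolding bounded_scaling_funs_iff by blast

lemma sup_norm_bound: "(\<And>l. norm (B l) \<le> c) \<Longrightarrow> sup_norm B \<le> c"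
  unfolding sup_norm_def by (rule cSUP_least) auto

lemma norm_le_sup_norm:
  assumes "\<And>l. norm (B l) \<le> c"
  shows "norm (B l) \<le> sup_norm B"
  unfolding sup_norm_def by (rule cSUP_upper) (use assms in \<open>auto intro!: bdd_aboveI\<close>)

lemma norm_le_sup_norm':
  assumes "B \<in> bounded_scaling_funs"
  shows "norm (B l) \<le> sup_norm B"
proof -
  obtain c where "\<And>l. norm (B l) \<le> c" using assms by (auto simp: bounded_scaling_funs_iff)
  then show ?thesis by (rule norm_le_sup_norm)
qed

lemma sup_norm_nonneg:
  assumes "B \<in> bounded_scaling_funs"
  shows "0 \<le> sup_norm B"
  by (rule order_trans[OF norm_ge_zero norm_le_sup_norm'[OF assms, of undefined]])

lemma norm_comp_diff_le:
  "norm ((a o\<^sub>L b) - (a' o\<^sub>L b')) \<le> norm (a - a') * norm b + norm a' * norm (b - b')"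
proof -
  have "(a o\<^sub>L b) - (a' o\<^sub>L b') = ((a - a') o\<^sub>L b) + (a' o\<^sub>L (b - b'))"
    by (auto intro!: blinfun_eqI simp: blinfun.diff_left blinfun.diff_right blinfun.add_left)
  then have "norm ((a o\<^sub>L b) - (a' o\<^sub>L b')) \<le> norm ((a - a') o\<^sub>L b) + norm (a' o\<^sub>L (b - b'))"
    using norm_triangle_ineq by simp
  also have "\<dots> \<le> norm (a - a') * norm b + norm a' * norm (b - b')"
    by (intro add_mono norm_blinfun_compose)
  finally show ?thesis .
qed

section \<open>Regions and the action of the scaling group\<close>

lemma region_scale: "region R \<Longrightarrow> region ((\<lambda>x. real_of_pos l *\<^sub>R x) ` R)"
  using real_of_pos[of l] by (auto simp: region_def intro: open_scaling bounded_scaling)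

lemma region_translate: "region R \<Longrightarrow> region ((\<lambda>y. y + x) ` R)"
  unfolding region_def using open_translation[of R x] bounded_translation[of R x]
  by (simp add: add.commute)

lemma region_Un: "region R \<Longrightarrow> region S \<Longrightarrow> region (R \<union> S)"
  by (auto simp: region_def)

lemma mat_1_lorentz: "mat 1 \<in> lorentz"
  by (simp add: lorentz_def) (simp add: mat_def)

lemma translation_poincare: "(x, mat 1) \<in> poincare"
  by (simp add: poincare_def mat_1_lorentz)

text \<open>The continuity condition of \<open>scaling_local\<close> with a quantifier over l in
  place of \<open>sup_norm\<close>, so that estimates can be made at each scale without attending to
  suprema. The bound is non-strict because that is what survives a supremum.\<close>

definition norm_continuous where
  "norm_continuous U A \<longleftrightarrow> (\<forall>g\<in>scaling_group. \<forall>e>0. \<forall>\<^sub>F h in at g within scaling_group.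
     \<forall>l. norm (scaling_action U h A l - scaling_action U g A l) \<le> e)"

lemma eventually_at_within_mem: "\<forall>\<^sub>F h in at g within S. h \<in> S"
  by (simp add: eventually_at_filter)

lemma norm_continuousD:
  assumes "norm_continuous U A" "g \<in> scaling_group" "0 < e"
  shows "\<forall>\<^sub>F h in at g within scaling_group. h \<in> scaling_group \<and>
    (\<forall>l. norm (scaling_action U h A l - scaling_action U g A l) \<le> e)"
  using assms eventually_at_within_mem by (auto simp: norm_continuous_def eventually_conj_iff)

abbreviation "scalar_fun F \<equiv> (\<lambda>l. scalar_op (F l))"

context vacuum_net begin

lemma unitary_scaling: "L \<in> lorentz \<Longrightarrow> unitary_op (U (x, L))"
  by (rule unitary) (simp add: poincare_def)

lemma norm_scaling_action_le:
  assumes "g \<in> scaling_group" "\<And>l. norm (A l) \<le> c"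
  shows "norm (scaling_action U g A l) \<le> c"
proof -
  obtain m x L where g: "g = (m, x, L)" "L \<in> lorentz"
    using assms(1) by (auto simp: scaling_group_def)
  show ?thesis
    using order_trans[OF norm_ad_le[OF unitary_scaling[OF g(2)]] assms(2)] by (simp add: g)
qed

text \<open>On scalar functions and on vacuum expectations only the dilation part
  \<open>fst g\<close> is left, since the Poincare part acts by unitaries that commute with scalars
  and fix \<Omega>.\<close>

lemma scaling_action_algebra:
  assumes "g \<in> scaling_group"
  shows "scaling_action U g (\<lambda>l. A l + B l) l = scaling_action U g A l + scaling_action U g B l"
    and "scaling_action U g (\<lambda>l. A l o\<^sub>L B l) l = scaling_action U g A l o\<^sub>L scaling_action U g B l"
    and "scaling_action U g (\<lambda>l. scalar_op c) l = scalar_op c"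
    and "(\<And>l. A l \<in> bounded_operators) \<Longrightarrow>
      scaling_action U g (\<lambda>l. op_adj (A l)) l = op_adj (scaling_action U g A l)"
    and "(\<And>l. A l \<in> bounded_operators) \<Longrightarrow> scaling_action U g A l \<in> bounded_operators"
    and "scaling_action U g (scalar_fun F) l = scalar_op (F (l * fst g))"
    and "cinner \<Omega> (scaling_action U g A l \<Omega>) = cinner \<Omega> (A (l * fst g) \<Omega>)"
proof -
  obtain m x L where g: "g = (m, x, L)" "L \<in> lorentz"
    using assms(1) by (auto simp: scaling_group_def)
  note u = unitary_scaling[OF g(2)]
  show "scaling_action U g (\<lambda>l. A l + B l) l = scaling_action U g A l + scaling_action U g B l"
    and "scaling_action U g (\<lambda>l. A l o\<^sub>L B l) l = scaling_action U g A l o\<^sub>L scaling_action U g B l"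
    and "scaling_action U g (\<lambda>l. scalar_op c) l = scalar_op c"
    and "(\<And>l. A l \<in> bounded_operators) \<Longrightarrow>
      scaling_action U g (\<lambda>l. op_adj (A l)) l = op_adj (scaling_action U g A l)"
    and "(\<And>l. A l \<in> bounded_operators) \<Longrightarrow> scaling_action U g A l \<in> bounded_operators"
    and "scaling_action U g (scalar_fun F) l = scalar_op (F (l * fst g))"
    using u by (simp_all add: g ad_add ad_comp ad_scalar ad_op_adj)
  define V where "V = U (real_of_pos (l * m) *\<^sub>R x, L)"
  have V: "unitary_op V" "V \<Omega> = \<Omega>"
    using u invariant g by (auto simp: V_def poincare_def)
  then have V': "op_adj V \<Omega> = \<Omega>" by (metis unitary_opD(2))
  have "cinner \<Omega> (ad V T \<Omega>) = cinner \<Omega> (T \<Omega>)" for T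
  proof -
    have "cinner \<Omega> (ad V T \<Omega>) = cinner (V \<Omega>) (V (T (op_adj V \<Omega>)))" by (simp add: ad_def V)
    also have "\<dots> = cinner \<Omega> (T \<Omega>)" unfolding unitary_opD(4)[OF V(1)] V' ..
    finally show ?thesis .
  qed
  then show "cinner \<Omega> (scaling_action U g A l \<Omega>) = cinner \<Omega> (A (l * fst g) \<Omega>)"
    by (simp add: g V_def)
qed

lemma norm_continuous_iff:
  assumes "A \<in> bounded_scaling_funs"
  shows "norm_continuous U A \<longleftrightarrow> (\<forall>g\<in>scaling_group.
    ((\<lambda>h. sup_norm (\<lambda>l. scaling_action U h A l - scaling_action U g A l)) \<longlongrightarrow> 0)
          (at g within scaling_group))" (is "_ \<longleftrightarrow> (\<forall>g\<in>_. ?P g)")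
proof -
  \<comment> \<open>A supremum of reals says something about its members only if they are bounded
    above; this is the bound.\<close>
  have bd: "norm (scaling_action U h A l - scaling_action U g A l) \<le> sup_norm A + sup_norm A"
    if "h \<in> scaling_group" "g \<in> scaling_group" for g h l
    using norm_scaling_action_le[OF that(1) norm_le_sup_norm'[OF assms]]
      norm_scaling_action_le[OF that(2) norm_le_sup_norm'[OF assms]]
    by (rule norm_triangle_le_diff[OF add_mono])
  have "?P g \<longleftrightarrow> (\<forall>e>0. \<forall>\<^sub>F h in at g within scaling_group.
     \<forall>l. norm (scaling_action U h A l - scaling_action U g A l) \<le> e)" (is "_ \<longleftrightarrow> ?Q")
    if g: "g \<in> scaling_group" for g
  proof
    assume P: "?P g"
    show ?Q
    proof (intro allI impI)
      fix e :: real assume "0 < e"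
      with P have "\<forall>\<^sub>F h in at g within scaling_group.
          dist (sup_norm (\<lambda>l. scaling_action U h A l - scaling_action U g A l)) 0 < e"
        by (rule tendstoD)
      then show "\<forall>\<^sub>F h in at g within scaling_group.
          \<forall>l. norm (scaling_action U h A l - scaling_action U g A l) \<le> e"
        using eventually_at_within_mem
      proof eventually_elim
        case (elim h)
        show ?case
        proof
          fix l
          have "norm (scaling_action U h A l - scaling_action U g A l)
              \<le> sup_norm (\<lambda>l. scaling_action U h A l - scaling_action U g A l)"
            by (rule norm_le_sup_norm[of "\<lambda>l. scaling_action U h A l - scaling_action U g A l"])
              (rule bd[OF elim(2) g])
          with elim(1) show "norm (scaling_action U h A l - scaling_action U g A l) \<le> e"
            by (simp add: dist_real_def)
        qed
      qed
    qed
  next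
    assume Q: ?Q
    show "?P g"
    proof (rule tendstoI)
      fix e :: real assume e: "0 < e"
      then have "\<forall>\<^sub>F h in at g within scaling_group.
         \<forall>l. norm (scaling_action U h A l - scaling_action U g A l) \<le> e / 2"
        using Q[rule_format, of "e / 2"] by simp
      then show "\<forall>\<^sub>F h in at g within scaling_group.
          dist (sup_norm (\<lambda>l. scaling_action U h A l - scaling_action U g A l)) 0 < e"
      proof eventually_elim
        case (elim h)
        have "sup_norm (\<lambda>l. scaling_action U h A l - scaling_action U g A l) \<le> e / 2"
          by (rule sup_norm_bound) (use elim in blast)
        moreover have "0 \<le> norm (scaling_action U h A undefined - scaling_action U g A undefined)" by simp
        moreover have "\<dots> \<le> sup_norm (\<lambda>l. scaling_action U h A l - scaling_action U g A l)"
          by (rule norm_le_sup_norm[of "\<lambda>l. scaling_action U h A l - scaling_action U g A l"])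
            (use elim in blast)
        ultimately show ?case using e unfolding dist_real_def by linarith
      qed
    qed
  qed
  then show ?thesis unfolding norm_continuous_def by auto
qed

section \<open>Operations that preserve local elements\<close>

lemma scaling_local_iff:
  "A \<in> scaling_local \<AA> U R \<longleftrightarrow> A \<in> bounded_scaling_funs \<and>
     (\<forall>l. A l \<in> \<AA> ((\<lambda>x. real_of_pos l *\<^sub>R x) ` R)) \<and> norm_continuous U A"
  using norm_continuous_iff by (auto simp: scaling_local_def)

lemma scaling_local_mono:
  assumes "region R" "region S" "R \<subseteq> S" "A \<in> scaling_local \<AA> U R"
  shows "A \<in> scaling_local \<AA> U S"
  using assms isotony[OF region_scale region_scale] unfolding scaling_local_iff
  by (meson image_mono subsetD)

lemma scaling_local_add:
  assumes R: "region R" and A: "A \<in> scaling_local \<AA> U R" and B: "B \<in> scaling_local \<AA> U R"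
  shows "(\<lambda>l. A l + B l) \<in> scaling_local \<AA> U R"
  unfolding scaling_local_iff
proof (intro conjI allI)
  note A = A[unfolded scaling_local_iff] and B = B[unfolded scaling_local_iff]
  show "(\<lambda>l. A l + B l) \<in> bounded_scaling_funs"
  proof (rule bounded_scaling_funsI)
    show "A l + B l \<in> bounded_operators" for l using A B by (auto simp: bounded_scaling_funs_iff)
    show "norm (A l + B l) \<le> sup_norm A + sup_norm B" for l
      using A B by (intro norm_triangle_mono norm_le_sup_norm') auto
  qed
  show "A l + B l \<in> \<AA> ((\<lambda>x. real_of_pos l *\<^sub>R x) ` R)" for l
    using A B von_neumann_algebra_closed(1)[OF local_algebra[OF region_scale[OF R]]] by blast
  show "norm_continuous U (\<lambda>l. A l + B l)"
    unfolding norm_continuous_def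
  proof (intro ballI allI impI)
    fix g :: "posreal \<times> 's mink \<times> 's mink_mat" and e :: real
    assume g: "g \<in> scaling_group" and e: "0 < e"
    have A': "norm_continuous U A" and B': "norm_continuous U B" using A B by auto
    have e2: "0 < e / 2" using e by simp
    from norm_continuousD[OF A' g e2] norm_continuousD[OF B' g e2]
    show "\<forall>\<^sub>F h in at g within scaling_group. \<forall>l.
      norm (scaling_action U h (\<lambda>l. A l + B l) l - scaling_action U g (\<lambda>l. A l + B l) l) \<le> e"
    proof eventually_elim
      case (elim h)
      have "norm ((a + b) - (a' + b')) \<le> e" if "norm (a - a') \<le> e/2" "norm (b - b') \<le> e/2"
        for a b a' b' :: "'h \<Rightarrow>\<^sub>L 'h"
        using norm_diff_triangle_ineq[of a b a' b'] that by linarith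
      with elim g show ?case by (simp add: scaling_action_algebra)
    qed
  qed
qed

lemma scaling_local_comp:
  assumes R: "region R" and A: "A \<in> scaling_local \<AA> U R" and B: "B \<in> scaling_local \<AA> U R"
  shows "(\<lambda>l. A l o\<^sub>L B l) \<in> scaling_local \<AA> U R"
  unfolding scaling_local_iff
proof (intro conjI allI)
  note A = A[unfolded scaling_local_iff] and B = B[unfolded scaling_local_iff]
  obtain a b where a: "\<And>l. norm (A l) \<le> a" and b: "\<And>l. norm (B l) \<le> b"
    using A B by (auto simp: bounded_scaling_funs_iff)
  have a0: "0 \<le> a" and b0: "0 \<le> b"
    using order_trans[OF norm_ge_zero a] order_trans[OF norm_ge_zero b] by auto
  have "norm (A l o\<^sub>L B l) \<le> a * b" for l
    by (rule order_trans[OF norm_blinfun_compose mult_mono[OF a b a0 norm_ge_zero]])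
  then show "(\<lambda>l. A l o\<^sub>L B l) \<in> bounded_scaling_funs"
    using A B unfolding bounded_scaling_funs_iff by auto
  show "A l o\<^sub>L B l \<in> \<AA> ((\<lambda>x. real_of_pos l *\<^sub>R x) ` R)" for l
    using A B von_neumann_algebra_closed(2)[OF local_algebra[OF region_scale[OF R]]] by blast
  show "norm_continuous U (\<lambda>l. A l o\<^sub>L B l)"
    unfolding norm_continuous_def
  proof (intro ballI allI impI)
    fix g :: "posreal \<times> 's mink \<times> 's mink_mat" and e :: real
    assume g: "g \<in> scaling_group" and e: "0 < e"
    \<comment> \<open>The product rule leaves an error d (a + b); the additional 1 keeps the
      denominator positive.\<close>
    define d where "d = e / (a + b + 1)"
    have d: "0 < d" using e a0 b0 by (simp add: d_def)
    have A': "norm_continuous U A" and B': "norm_continuous U B" using A B by auto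
    from norm_continuousD[OF A' g d] norm_continuousD[OF B' g d]
    show "\<forall>\<^sub>F h in at g within scaling_group. \<forall>l.
      norm (scaling_action U h (\<lambda>l. A l o\<^sub>L B l) l - scaling_action U g (\<lambda>l. A l o\<^sub>L B l) l) \<le> e"
    proof eventually_elim
      case (elim h)
      show ?case
      proof
        fix l
        have "norm ((scaling_action U h A l o\<^sub>L scaling_action U h B l) - (scaling_action U g A l o\<^sub>L scaling_action U g B l))
          \<le> norm (scaling_action U h A l - scaling_action U g A l) * norm (scaling_action U h B l)
            + norm (scaling_action U g A l) * norm (scaling_action U h B l - scaling_action U g B l)"
          by (rule norm_comp_diff_le)
        also have "\<dots> \<le> d * b + a * d"
          using elim g a b a0 b0 d by (intro add_mono mult_mono norm_scaling_action_le) auto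
        also have "\<dots> \<le> d * (a + b + 1)" using d by (simp add: algebra_simps)
        also have "\<dots> = e" using a0 b0 by (simp add: d_def)
        finally show "norm (scaling_action U h (\<lambda>l. A l o\<^sub>L B l) l - scaling_action U g (\<lambda>l. A l o\<^sub>L B l) l) \<le> e"
          using elim g by (simp add: scaling_action_algebra)
      qed
    qed
  qed
qed

lemma scaling_local_op_adj:
  assumes R: "region R" and A: "A \<in> scaling_local \<AA> U R"
  shows "(\<lambda>l. op_adj (A l)) \<in> scaling_local \<AA> U R"
  unfolding scaling_local_iff
proof (intro conjI allI)
  note A = A[unfolded scaling_local_iff]
  have bo: "A l \<in> bounded_operators" for l using A by (simp add: bounded_scaling_funs_iff)
  show "(\<lambda>l. op_adj (A l)) \<in> bounded_scaling_funs"
    by (rule bounded_scaling_funsI[OF op_adj_bounded_operators[OF bo] order_trans[OF norm_op_adj_le[OF bo] norm_le_sup_norm']])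
      (use A in blast)
  show "op_adj (A l) \<in> \<AA> ((\<lambda>x. real_of_pos l *\<^sub>R x) ` R)" for l
    using A von_neumann_algebra_closed(4)[OF local_algebra[OF region_scale[OF R]]] by blast
  show "norm_continuous U (\<lambda>l. op_adj (A l))"
    unfolding norm_continuous_def
  proof (intro ballI allI impI)
    fix g :: "posreal \<times> 's mink \<times> 's mink_mat" and e :: real
    assume g: "g \<in> scaling_group" and e: "0 < e"
    have A': "norm_continuous U A" using A by auto
    from norm_continuousD[OF A' g e]
    show "\<forall>\<^sub>F h in at g within scaling_group. \<forall>l.
      norm (scaling_action U h (\<lambda>l. op_adj (A l)) l - scaling_action U g (\<lambda>l. op_adj (A l)) l) \<le> e"
    proof eventually_elim
      case (elim h)
      show ?case
      proof
        fix l
        have "norm (op_adj (scaling_action U h A l - scaling_action U g A l)) \<le> e"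
          using elim g bo by (intro order_trans[OF norm_op_adj_le]) (auto simp: scaling_action_algebra(5))
        then show "norm (scaling_action U h (\<lambda>l. op_adj (A l)) l - scaling_action U g (\<lambda>l. op_adj (A l)) l) \<le> e"
          using elim g bo by (simp add: scaling_action_algebra op_adj_diff)
      qed
    qed
  qed
qed

lemma scaling_local_scalar:
  assumes R: "region R"
  shows "(\<lambda>l. scalar_op c) \<in> scaling_local \<AA> U R"
  unfolding scaling_local_iff
proof (intro conjI allI)
  show "(\<lambda>l. scalar_op c) \<in> bounded_scaling_funs"
    by (auto simp: bounded_scaling_funs_iff)
  show "scalar_op c \<in> \<AA> ((\<lambda>x. real_of_pos l *\<^sub>R x) ` R)" for l
    using von_neumann_algebra_closed(3)[OF local_algebra[OF region_scale[OF R]]] .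
  show "norm_continuous U (\<lambda>l. scalar_op c)"
    unfolding norm_continuous_def
  proof (intro ballI allI impI)
    fix g :: "posreal \<times> 's mink \<times> 's mink_mat" and e :: real
    assume g: "g \<in> scaling_group" and e: "0 < e"
    show "\<forall>\<^sub>F h in at g within scaling_group. \<forall>l.
      norm (scaling_action U h (\<lambda>l. scalar_op c) l - scaling_action U g (\<lambda>l. scalar_op c) l) \<le> e"
      using eventually_at_within_mem
      by eventually_elim (use g e in \<open>simp add: scaling_action_algebra\<close>)
  qed
qed

text \<open>Translations permute the scaling group, \<open>(m, y, L)(1, x, 1) = (m, y + L x, L)\<close>.\<close>

lemma scaling_local_translate:
  assumes R: "region R" and A: "A \<in> scaling_local \<AA> U R"
  shows "(\<lambda>l. ad (U (real_of_pos l *\<^sub>R x, mat 1)) (A l)) \<in> scaling_local \<AA> U ((\<lambda>y. y + x) ` R)"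
    (is "?B \<in> _")
  unfolding scaling_local_iff
proof (intro conjI allI)
  note A = A[unfolded scaling_local_iff]
  note u = unitary_scaling[OF mat_1_lorentz]
  have bo: "A l \<in> bounded_operators" for l using A by (simp add: bounded_scaling_funs_iff)
  show "?B \<in> bounded_scaling_funs"
    by (rule bounded_scaling_funsI[OF ad_bounded_operators[OF u bo] order_trans[OF norm_ad_le[OF u] norm_le_sup_norm']])
      (use A in blast)
  show "?B l \<in> \<AA> ((\<lambda>x. real_of_pos l *\<^sub>R x) ` (\<lambda>y. y + x) ` R)" for l
  proof -
    have "poincare_act (real_of_pos l *\<^sub>R x, mat 1) ` (\<lambda>x. real_of_pos l *\<^sub>R x) ` R
      = (\<lambda>x. real_of_pos l *\<^sub>R x) ` (\<lambda>y. y + x) ` R"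
      by (simp add: image_image scaleR_add_right)
    then show ?thesis
      using covariance[OF translation_poincare region_scale[OF R], of "real_of_pos l *\<^sub>R x" l] A by (metis imageI)
  qed
  define \<phi> :: "posreal \<times> 's mink \<times> 's mink_mat \<Rightarrow> _" where
    "\<phi> g = (fst g, fst (snd g) + snd (snd g) *v x, snd (snd g))" for g
  have act: "scaling_action U g ?B l = scaling_action U (\<phi> g) A l" "\<phi> g \<in> scaling_group"
    if g: "g \<in> scaling_group" for g l
  proof -
    obtain m y L where gm: "g = (m, y, L)" "L \<in> lorentz"
      using g by (auto simp: scaling_group_def)
    have p: "(r *\<^sub>R y, L) \<in> poincare" for r using gm by (simp add: poincare_def)
    have "U (r *\<^sub>R y + L *v (r *\<^sub>R x), L) = U (r *\<^sub>R y, L) o\<^sub>L U (r *\<^sub>R x, mat 1)" for r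
      using mult[OF p translation_poincare] by simp
    then show "scaling_action U g ?B l = scaling_action U (\<phi> g) A l"
      using unitary_opD(1)[OF u] unitary_opD(1)[OF unitary_scaling[OF gm(2)]]
      by (simp add: gm(1) \<phi>_def ad_ad scaleR_add_right matrix_vector_mult_scaleR)
    show "\<phi> g \<in> scaling_group" using gm by (simp add: \<phi>_def scaling_group_def)
  qed
  show "norm_continuous U ?B"
    unfolding norm_continuous_def
  proof (intro ballI allI impI)
    fix g :: "posreal \<times> 's mink \<times> 's mink_mat" and e :: real
    assume g: "g \<in> scaling_group" and e: "0 < e"
    let ?P = "\<lambda>h. \<forall>l. norm (scaling_action U h A l - scaling_action U (\<phi> g) A l) \<le> e"
    have "\<forall>\<^sub>F h in at (\<phi> g) within scaling_group. ?P h"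
      using A act(2)[OF g] e by (auto simp: norm_continuous_def)
    \<comment> \<open>The punctured filter is exchanged for \<open>nhds\<close>, so that
      \<open>\<phi> h\<close> may also take the value \<open>\<phi> g\<close>, where the difference
      vanishes.\<close>
    then have ev: "\<forall>\<^sub>F h in nhds (\<phi> g). h \<in> scaling_group \<longrightarrow> ?P h"
      unfolding eventually_at_filter
      by eventually_elim (use e in auto)
    have "((\<lambda>L. L *v x) \<longlongrightarrow> L0 *v x) (nhds L0)" for L0 :: "'s mink_mat"
      unfolding matrix_vector_mult_def
      by (intro tendsto_vec_lambda tendsto_sum tendsto_mult tendsto_vec_nth tendsto_const filterlim_ident)
    then have "((\<lambda>h. snd (snd h) *v x) \<longlongrightarrow> snd (snd g) *v x) (at g within scaling_group)"
      by (rule filterlim_compose) (intro tendsto_snd tendsto_ident_at)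
    then have "(\<phi> \<longlongrightarrow> \<phi> g) (at g within scaling_group)"
      unfolding \<phi>_def by (intro tendsto_intros)
    with ev have "\<forall>\<^sub>F h in at g within scaling_group. \<phi> h \<in> scaling_group \<longrightarrow> ?P (\<phi> h)"
      by (rule eventually_compose_filterlim)
    then show "\<forall>\<^sub>F h in at g within scaling_group. \<forall>l.
        norm (scaling_action U h ?B l - scaling_action U g ?B l) \<le> e"
      using eventually_at_within_mem
      by eventually_elim (use act g in auto)
  qed
qed

text \<open>Testing the operator on the unit vector \<Omega> recovers the scalar from it.\<close>

lemma cmod_scalar_op: "cmod c \<le> norm (scalar_op c :: 'h \<Rightarrow>\<^sub>L 'h)"
  using norm_blinfun[of "scalar_op c" \<Omega>] by (simp add: norm_scaleC normalized)

lemma cinner_Omega_Omega: "cinner \<Omega> \<Omega> = 1"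
  by (simp add: cinner_self normalized)

lemma norm_vacuum_expectation_le: "cmod (cinner \<Omega> (blinfun_apply T \<Omega>)) \<le> norm T"
  using cmod_cinner_le[of \<Omega> "T \<Omega>"] norm_blinfun[of T \<Omega>] by (simp add: normalized)

text \<open>The vacuum expectation commutes with the scaling action and decreases norms, so it
  inherits every modulus of continuity of A; scalars lie in every local algebra.\<close>

lemma scaling_local_vacuum_expectation:
  assumes R: "region R" and A: "A \<in> scaling_local \<AA> U R"
  shows "vacuum_expectation \<Omega> A \<in> scaling_local \<AA> U R"
  unfolding scaling_local_iff
proof (intro conjI allI)
  note A = A[unfolded scaling_local_iff]
  show "vacuum_expectation \<Omega> A \<in> bounded_scaling_funs"
    unfolding vacuum_expectation_def
    by (rule bounded_scaling_funsI[OF bounded_operators_closed(4) order_trans[OF norm_scalar_op_le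
        order_trans[OF norm_vacuum_expectation_le norm_le_sup_norm']]])
      (use A in blast)
  show "vacuum_expectation \<Omega> A l \<in> \<AA> ((\<lambda>x. real_of_pos l *\<^sub>R x) ` R)" for l
    unfolding vacuum_expectation_def
    using von_neumann_algebra_closed(3)[OF local_algebra[OF region_scale[OF R]]] .
  show "norm_continuous U (vacuum_expectation \<Omega> A)"
    unfolding norm_continuous_def
  proof (intro ballI allI impI)
    fix g :: "posreal \<times> 's mink \<times> 's mink_mat" and e :: real
    assume g: "g \<in> scaling_group" and e: "0 < e"
    have A': "norm_continuous U A" using A by auto
    from norm_continuousD[OF A' g e]
    show "\<forall>\<^sub>F h in at g within scaling_group. \<forall>l.
      norm (scaling_action U h (vacuum_expectation \<Omega> A) l - scaling_action U g (vacuum_expectation \<Omega> A) l) \<le> e"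
    proof eventually_elim
      case (elim h)
      have "norm (scaling_action U h (vacuum_expectation \<Omega> A) l - scaling_action U g (vacuum_expectation \<Omega> A) l)
        \<le> norm (scaling_action U h A l - scaling_action U g A l)" for l
      proof -
        have "scaling_action U k (vacuum_expectation \<Omega> A) l = scalar_op (cinner \<Omega> (scaling_action U k A l \<Omega>))"
          if "k \<in> scaling_group" for k
          unfolding vacuum_expectation_def scaling_action_algebra(6,7)[OF that] ..
        then have "scaling_action U h (vacuum_expectation \<Omega> A) l - scaling_action U g (vacuum_expectation \<Omega> A) l
          = scalar_op (cinner \<Omega> ((scaling_action U h A l - scaling_action U g A l) \<Omega>))"
          using elim g by (simp add: scalar_op_algebra(2) cinner_diff_right blinfun.diff_left)
        then show ?thesis
          by (simp add: order_trans[OF norm_scalar_op_le norm_vacuum_expectation_le])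
      qed
      from order_trans[OF this] elim show ?case by simp
    qed
  qed
qed

section \<open>Uniform limits of local elements\<close>

lemma scaling_algebra_iff:
  "A \<in> scaling_algebra \<AA> U \<longleftrightarrow> A \<in> bounded_scaling_funs \<and>
     (\<forall>e>0. \<exists>R. region R \<and> (\<exists>B\<in>scaling_local \<AA> U R. \<forall>l. norm (A l - B l) \<le> e))"
proof (cases "A \<in> bounded_scaling_funs")
  case A: True
  have "(\<forall>e>0. \<exists>R. region R \<and> (\<exists>B\<in>scaling_local \<AA> U R. sup_norm (\<lambda>l. A l - B l) < e))
    \<longleftrightarrow> (\<forall>e>0. \<exists>R. region R \<and> (\<exists>B\<in>scaling_local \<AA> U R. \<forall>l. norm (A l - B l) \<le> e))" (is "?P \<longleftrightarrow> ?Q")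
  proof
    assume ?P
    show ?Q
    proof (intro allI impI)
      fix e :: real assume "0 < e"
      then obtain R B where RB: "region R" "B \<in> scaling_local \<AA> U R" "sup_norm (\<lambda>l. A l - B l) < e"
        using \<open>?P\<close> by blast
      have B: "B \<in> bounded_scaling_funs" using RB by (simp add: scaling_local_iff)
      have "norm (A l - B l) \<le> sup_norm A + sup_norm B" for l
        by (rule norm_triangle_le_diff[OF add_mono[OF norm_le_sup_norm'[OF A] norm_le_sup_norm'[OF B]]])
      then have "norm (A l - B l) \<le> sup_norm (\<lambda>l. A l - B l)" for l
        by (rule norm_le_sup_norm[of "\<lambda>l. A l - B l"])
      then have "norm (A l - B l) \<le> e" for l using order_trans less_imp_le[OF RB(3)] by blast
      with RB show "\<exists>R. region R \<and> (\<exists>B\<in>scaling_local \<AA> U R. \<forall>l. norm (A l - B l) \<le> e)" by blast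
    qed
  next
    assume ?Q
    show ?P
    proof (intro allI impI)
      fix e :: real assume e: "0 < e"
      then have "0 < e / 2" by simp
      then obtain R B where RB: "region R" "B \<in> scaling_local \<AA> U R" "\<forall>l. norm (A l - B l) \<le> e / 2"
        using \<open>?Q\<close> by blast
      have "sup_norm (\<lambda>l. A l - B l) \<le> e / 2" by (rule sup_norm_bound) (use RB(3) in blast)
      then have "sup_norm (\<lambda>l. A l - B l) < e" using e by linarith
      with RB show "\<exists>R. region R \<and> (\<exists>B\<in>scaling_local \<AA> U R. sup_norm (\<lambda>l. A l - B l) < e)" by blast
    qed
  qed
  with A show ?thesis by (simp add: scaling_algebra_def)
qed (simp add: scaling_algebra_def)

lemma scaling_algebraD:
  assumes "A \<in> scaling_algebra \<AA> U"
  shows "A l \<in> bounded_operators" "norm (A l) \<le> sup_norm A" "0 \<le> sup_norm A"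
    "A \<in> bounded_scaling_funs"
    "0 < e \<Longrightarrow> \<exists>R B. region R \<and> B \<in> scaling_local \<AA> U R \<and> (\<forall>l. norm (A l - B l) \<le> e)"
proof -
  show A: "A \<in> bounded_scaling_funs" using assms by (simp add: scaling_algebra_iff)
  then show "A l \<in> bounded_operators" by (simp add: bounded_scaling_funs_iff)
  show "norm (A l) \<le> sup_norm A" "0 \<le> sup_norm A"
    by (rule norm_le_sup_norm'[OF A], rule sup_norm_nonneg[OF A])
  show "0 < e \<Longrightarrow> \<exists>R B. region R \<and> B \<in> scaling_local \<AA> U R \<and> (\<forall>l. norm (A l - B l) \<le> e)"
    using assms unfolding scaling_algebra_iff by blast
qed

text \<open>Sums and products of local elements are formed inside one region. By isotony the union
  of the two regions serves for both approximants.\<close>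

lemma scaling_local_approx2:
  assumes "A \<in> scaling_algebra \<AA> U" "B \<in> scaling_algebra \<AA> U" "0 < e"
  obtains R A' B' where "region R" "A' \<in> scaling_local \<AA> U R" "B' \<in> scaling_local \<AA> U R"
    "\<And>l. norm (A l - A' l) \<le> e" "\<And>l. norm (B l - B' l) \<le> e"
proof -
  obtain R A' where 1: "region R" "A' \<in> scaling_local \<AA> U R" "\<forall>l. norm (A l - A' l) \<le> e"
    using scaling_algebraD(5)[OF assms(1,3)] by blast
  obtain S B' where 2: "region S" "B' \<in> scaling_local \<AA> U S" "\<forall>l. norm (B l - B' l) \<le> e"
    using scaling_algebraD(5)[OF assms(2,3)] by blast
  have "A' \<in> scaling_local \<AA> U (R \<union> S)" "B' \<in> scaling_local \<AA> U (R \<union> S)"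
    using scaling_local_mono[OF 1(1) region_Un[OF 1(1) 2(1)] _ 1(2)]
      scaling_local_mono[OF 2(1) region_Un[OF 1(1) 2(1)] _ 2(2)] by auto
  with 1 2 region_Un[OF 1(1) 2(1)] show ?thesis using that by blast
qed

lemma scaling_algebra_add:
  assumes A: "A \<in> scaling_algebra \<AA> U" and B: "B \<in> scaling_algebra \<AA> U"
  shows "(\<lambda>l. A l + B l) \<in> scaling_algebra \<AA> U"
  unfolding scaling_algebra_iff
proof (intro conjI allI impI)
  have "norm (A l + B l) \<le> sup_norm A + sup_norm B" for l
    by (rule norm_triangle_mono[OF scaling_algebraD(2)[OF A] scaling_algebraD(2)[OF B]])
  then show "(\<lambda>l. A l + B l) \<in> bounded_scaling_funs"
    using scaling_algebraD(1)[OF A] scaling_algebraD(1)[OF B] by (auto simp: bounded_scaling_funs_iff)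
  fix e :: real assume "0 < e"
  then have "0 < e / 2" by simp
  from A B this obtain R A' B' where *: "region R" "A' \<in> scaling_local \<AA> U R" "B' \<in> scaling_local \<AA> U R"
    "\<And>l. norm (A l - A' l) \<le> e / 2" "\<And>l. norm (B l - B' l) \<le> e / 2"
    by (rule scaling_local_approx2) blast
  have "norm ((A l + B l) - (A' l + B' l)) \<le> e" for l
    using norm_diff_triangle_ineq[of "A l" "B l" "A' l" "B' l"] *(4)[of l] *(5)[of l] by linarith
  with scaling_local_add[OF *(1-3)] *(1)
  show "\<exists>R. region R \<and> (\<exists>C\<in>scaling_local \<AA> U R. \<forall>l. norm (A l + B l - C l) \<le> e)"
    by (intro exI[of _ R] conjI bexI[of _ "\<lambda>l. A' l + B' l"]) auto
qed

lemma scaling_algebra_comp: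
  assumes A: "A \<in> scaling_algebra \<AA> U" and B: "B \<in> scaling_algebra \<AA> U"
  shows "(\<lambda>l. A l o\<^sub>L B l) \<in> scaling_algebra \<AA> U"
  unfolding scaling_algebra_iff
proof (intro conjI allI impI)
  let ?a = "sup_norm A" and ?b = "sup_norm B"
  note a = scaling_algebraD(2,3)[OF A] and b = scaling_algebraD(2,3)[OF B]
  have "norm (A l o\<^sub>L B l) \<le> ?a * ?b" for l
    by (rule order_trans[OF norm_blinfun_compose mult_mono[OF a(1) b(1) a(2) norm_ge_zero]])
  then show "(\<lambda>l. A l o\<^sub>L B l) \<in> bounded_scaling_funs"
    using scaling_algebraD(1)[OF A] scaling_algebraD(1)[OF B] by (auto simp: bounded_scaling_funs_iff)
  fix e :: real assume e: "0 < e"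
  \<comment> \<open>The minimum with 1 bounds \<open>norm (A' l)\<close> by
    \<open>sup_norm A + 1\<close>; the other entry makes the product error at most e.\<close>
  define d where "d = min 1 (e / (?a + ?b + 1))"
  have pos: "0 < ?a + ?b + 1" using a(2) b(2) by linarith
  have d: "0 < d" "d \<le> 1" "d \<le> e / (?a + ?b + 1)" using e pos by (auto simp: d_def)
  then have d3: "d * (?a + ?b + 1) \<le> e" using pos by (simp add: pos_le_divide_eq)
  from A B d(1) obtain R A' B' where *: "region R" "A' \<in> scaling_local \<AA> U R" "B' \<in> scaling_local \<AA> U R"
    "\<And>l. norm (A l - A' l) \<le> d" "\<And>l. norm (B l - B' l) \<le> d"
    by (rule scaling_local_approx2) blast
  have "norm ((A l o\<^sub>L B l) - (A' l o\<^sub>L B' l)) \<le> e" for l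
  proof -
    have "norm (A' l) \<le> norm (A l) + norm (A l - A' l)"
      by (metis norm_minus_commute norm_triangle_sub)
    then have A': "norm (A' l) \<le> ?a + 1" using *(4)[of l] a(1)[of l] d(2) by linarith
    have "norm ((A l o\<^sub>L B l) - (A' l o\<^sub>L B' l))
      \<le> norm (A l - A' l) * norm (B l) + norm (A' l) * norm (B l - B' l)"
      by (rule norm_comp_diff_le)
    also have "\<dots> \<le> d * ?b + (?a + 1) * d"
      using *(4,5) a b d A' by (intro add_mono mult_mono) auto
    also have "\<dots> = d * (?a + ?b + 1)" by (simp add: algebra_simps)
    finally show ?thesis using d3 by linarith
  qed
  with scaling_local_comp[OF *(1-3)] *(1)
  show "\<exists>R. region R \<and> (\<exists>C\<in>scaling_local \<AA> U R. \<forall>l. norm ((A l o\<^sub>L B l) - C l) \<le> e)"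
    by (intro exI[of _ R] conjI bexI[of _ "\<lambda>l. A' l o\<^sub>L B' l"]) auto
qed

text \<open>The argument shared by adjoints, translates, vacuum expectations and square roots. F may
  be nonlinear; it has to be continuous at A uniformly in l, and it may send local elements to
  another region, as translations do.\<close>

lemma scaling_algebra_map:
  assumes A: "A \<in> scaling_algebra \<AA> U"
    and bo: "\<And>l. F A l \<in> bounded_operators" and bd: "\<And>l. norm (F A l) \<le> c"
    and loc: "\<And>R B. region R \<Longrightarrow> B \<in> scaling_local \<AA> U R \<Longrightarrow> \<exists>R'. region R' \<and> F B \<in> scaling_local \<AA> U R'"
    and cont: "\<And>e. 0 < e \<Longrightarrow> \<exists>d>0. \<forall>B\<in>bounded_scaling_funs. (\<forall>l. norm (A l - B l) \<le> d) \<longrightarrow>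
      (\<forall>l. norm (F A l - F B l) \<le> e)"
  shows "F A \<in> scaling_algebra \<AA> U"
  unfolding scaling_algebra_iff
proof (intro conjI allI impI)
  show "F A \<in> bounded_scaling_funs" using bo bd by (auto simp: bounded_scaling_funs_iff)
  fix e :: real assume "0 < e"
  then obtain d where d: "0 < d" "\<And>B l. B \<in> bounded_scaling_funs \<Longrightarrow> (\<And>l. norm (A l - B l) \<le> d) \<Longrightarrow>
      norm (F A l - F B l) \<le> e"
    using cont by blast
  obtain R B where B: "region R" "B \<in> scaling_local \<AA> U R" "\<And>l. norm (A l - B l) \<le> d"
    using scaling_algebraD(5)[OF A d(1)] by blast
  have "norm (F A l - F B l) \<le> e" for l
    by (rule d(2)) (use B in \<open>auto simp: scaling_local_iff\<close>)
  with loc[OF B(1,2)]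
  show "\<exists>R. region R \<and> (\<exists>B\<in>scaling_local \<AA> U R. \<forall>l. norm (F A l - B l) \<le> e)" by blast
qed

lemma scaling_algebra_op_adj:
  assumes A: "A \<in> scaling_algebra \<AA> U"
  shows "(\<lambda>l. op_adj (A l)) \<in> scaling_algebra \<AA> U"
proof (rule scaling_algebra_map[OF A, where F = "\<lambda>A l. op_adj (A l)"])
  show "norm (op_adj (A l)) \<le> sup_norm A" for l
    by (rule order_trans[OF norm_op_adj_le[OF scaling_algebraD(1)[OF A]] scaling_algebraD(2)[OF A]])
  fix e :: real assume e: "0 < e"
  have "norm (op_adj (A l) - op_adj (B l)) \<le> norm (A l - B l)" if "B \<in> bounded_scaling_funs" for B l
  proof -
    have "B l \<in> bounded_operators" using that by (simp add: bounded_scaling_funs_iff)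
    then show ?thesis
      using scaling_algebraD(1)[OF A, of l] norm_op_adj_le[of "A l - B l"] by (simp add: op_adj_diff)
  qed
  from order_trans[OF this] show "\<exists>d>0. \<forall>B\<in>bounded_scaling_funs. (\<forall>l. norm (A l - B l) \<le> d) \<longrightarrow>
      (\<forall>l. norm (op_adj (A l) - op_adj (B l)) \<le> e)"
    using e by (intro exI[of _ e]) auto
qed (use scaling_algebraD(1)[OF A] scaling_local_op_adj in blast)+

lemma scaling_algebra_scalar: "(\<lambda>l. scalar_op c) \<in> scaling_algebra \<AA> U"
  unfolding scaling_algebra_iff
proof (intro conjI allI impI)
  show "(\<lambda>l. scalar_op c) \<in> bounded_scaling_funs"
    by (auto simp: bounded_scaling_funs_iff)
  have "region ({} :: 's mink set)" by (simp add: region_def)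
  then show "\<exists>R. region R \<and> (\<exists>B\<in>scaling_local \<AA> U R. \<forall>l. norm (scalar_op c - B l) \<le> e)" if "0 < e" for e :: real
    using scaling_local_scalar that by (intro exI[of _ "{}"] conjI bexI[of _ "\<lambda>l. scalar_op c"]) auto
qed

lemma scaling_algebra_id: "(\<lambda>l. id_blinfun) \<in> scaling_algebra \<AA> U"
  using scaling_algebra_scalar[of 1] by (simp add: scalar_op_algebra)

lemma scaling_algebra_scale:
  "A \<in> scaling_algebra \<AA> U \<Longrightarrow> (\<lambda>l. scalar_op c o\<^sub>L A l) \<in> scaling_algebra \<AA> U"
  by (rule scaling_algebra_comp[OF scaling_algebra_scalar])

lemma scaling_algebra_translate:
  assumes A: "A \<in> scaling_algebra \<AA> U"
  shows "(\<lambda>l. ad (U (real_of_pos l *\<^sub>R x, mat 1)) (A l)) \<in> scaling_algebra \<AA> U"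
proof (rule scaling_algebra_map[OF A, where F = "\<lambda>A l. ad (U (real_of_pos l *\<^sub>R x, mat 1)) (A l)"])
  note u = unitary_scaling[OF mat_1_lorentz]
  show "ad (U (real_of_pos l *\<^sub>R x, mat 1)) (A l) \<in> bounded_operators" for l
    using u scaling_algebraD(1)[OF A] by blast
  show "norm (ad (U (real_of_pos l *\<^sub>R x, mat 1)) (A l)) \<le> sup_norm A" for l
    by (rule order_trans[OF norm_ad_le[OF u] scaling_algebraD(2)[OF A]])
  fix e :: real assume e: "0 < e"
  then show "\<exists>d>0. \<forall>B\<in>bounded_scaling_funs. (\<forall>l. norm (A l - B l) \<le> d) \<longrightarrow>
      (\<forall>l. norm (ad (U (real_of_pos l *\<^sub>R x, mat 1)) (A l) - ad (U (real_of_pos l *\<^sub>R x, mat 1)) (B l)) \<le> e)"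
    unfolding ad_diff[symmetric] by (intro exI[of _ e]) (auto intro: order_trans[OF norm_ad_le[OF u]])
qed (use scaling_local_translate region_translate in blast)

lemma scaling_algebra_vacuum_expectation:
  assumes A: "A \<in> scaling_algebra \<AA> U"
  shows "vacuum_expectation \<Omega> A \<in> scaling_algebra \<AA> U"
proof (rule scaling_algebra_map[OF A])
  show "norm (vacuum_expectation \<Omega> A l) \<le> sup_norm A" for l
    unfolding vacuum_expectation_def
    by (rule order_trans[OF norm_scalar_op_le order_trans[OF norm_vacuum_expectation_le scaling_algebraD(2)[OF A]]])
  have *: "norm (vacuum_expectation \<Omega> A l - vacuum_expectation \<Omega> B l) \<le> norm (A l - B l)" for B l
  proof -
    have "vacuum_expectation \<Omega> A l - vacuum_expectation \<Omega> B l = scalar_op (cinner \<Omega> ((A l - B l) \<Omega>))"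
      by (simp add: vacuum_expectation_def scalar_op_algebra(2) cinner_diff_right blinfun.diff_left)
    then show ?thesis
      by (simp add: order_trans[OF norm_scalar_op_le norm_vacuum_expectation_le])
  qed
  from order_trans[OF *] show "\<exists>d>0. \<forall>B\<in>bounded_scaling_funs. (\<forall>l. norm (A l - B l) \<le> d) \<longrightarrow>
      (\<forall>l. norm (vacuum_expectation \<Omega> A l - vacuum_expectation \<Omega> B l) \<le> e)" if "0 < e" for e
    using that by (intro exI[of _ e]) auto
qed (use scaling_local_vacuum_expectation in \<open>auto simp: vacuum_expectation_def\<close>)

text \<open>A modulus of continuity suffices for stability under composition; the case needed is
  the square root.\<close>

lemma scalar_fun_compose:
  assumes F: "scalar_fun F \<in> scaling_algebra \<AA> U"
    and \<phi>: "\<And>a b. cmod (\<phi> a - \<phi> b) \<le> sqrt (cmod (a - b))"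
  shows "scalar_fun (\<lambda>l. \<phi> (F l)) \<in> scaling_algebra \<AA> U"
proof -
  \<comment> \<open>Local approximants of a scalar function need not be scalar. Inserting the vacuum
    expectation before \<phi> gives a map on all of them that is composition with \<phi> on scalar
    functions.\<close>
  let ?\<Phi> = "\<lambda>A. (scalar_fun (\<lambda>l. \<phi> (cinner \<Omega> (A l \<Omega>))) :: 'h scaling_fun)"
  have \<phi>': "cmod (\<phi> a) \<le> cmod (\<phi> 0) + sqrt (cmod a)" for a
    using \<phi>[of a 0] norm_triangle_sub[of "\<phi> a" "\<phi> 0"] by simp
  have "?\<Phi> (scalar_fun F) \<in> scaling_algebra \<AA> U"
  proof (rule scaling_algebra_map[OF F, where F = ?\<Phi>])
    note bd = scaling_algebraD(2,3)[OF F]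
    show "norm (?\<Phi> (scalar_fun F) l) \<le> cmod (\<phi> 0) + sqrt (sup_norm (scalar_fun F :: 'h scaling_fun))" for l
    proof -
      have "norm (?\<Phi> (scalar_fun F) l) \<le> cmod (\<phi> 0) + sqrt (cmod (cinner \<Omega> (scalar_op (F l) \<Omega>)))"
        by (rule order_trans[OF norm_scalar_op_le \<phi>'])
      also have "\<dots> \<le> cmod (\<phi> 0) + sqrt (sup_norm (scalar_fun F :: 'h scaling_fun))"
        unfolding add_le_cancel_left real_sqrt_le_iff
        by (rule order_trans[OF norm_vacuum_expectation_le bd(1)])
      finally show ?thesis .
    qed
    show "\<exists>R'. region R' \<and> ?\<Phi> B \<in> scaling_local \<AA> U R'"
      if R: "region R" and B: "B \<in> scaling_local \<AA> U R" for R B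
    proof (intro exI conjI)
      have vB: "vacuum_expectation \<Omega> B \<in> scaling_local \<AA> U R"
        by (rule scaling_local_vacuum_expectation[OF R B])
      show "?\<Phi> B \<in> scaling_local \<AA> U R"
        unfolding scaling_local_iff
      proof (intro conjI allI)
        have "norm (?\<Phi> B l) \<le> cmod (\<phi> 0) + sqrt (sup_norm B)" for l
        proof -
          have "norm (?\<Phi> B l) \<le> cmod (\<phi> 0) + sqrt (cmod (cinner \<Omega> (B l \<Omega>)))"
            by (rule order_trans[OF norm_scalar_op_le \<phi>'])
          also have "\<dots> \<le> cmod (\<phi> 0) + sqrt (sup_norm B)"
            using order_trans[OF norm_vacuum_expectation_le[of "B l"] norm_le_sup_norm'[of B l]] B
            by (simp add: scaling_local_iff)
          finally show ?thesis .
        qed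
        then show "?\<Phi> B \<in> bounded_scaling_funs"
          unfolding bounded_scaling_funs_iff by auto
        show "?\<Phi> B l \<in> \<AA> ((\<lambda>x. real_of_pos l *\<^sub>R x) ` R)" for l
          using von_neumann_algebra_closed(3)[OF local_algebra[OF region_scale[OF R]]] .
        show "norm_continuous U (?\<Phi> B)"
          unfolding norm_continuous_def
        proof (intro ballI allI impI)
          fix g :: "posreal \<times> 's mink \<times> 's mink_mat" and e :: real
          assume g: "g \<in> scaling_group" and e: "0 < e"
          \<comment> \<open>The modulus of continuity of \<phi> is a square root, so accuracy e^2
            for the argument gives accuracy e for the value.\<close>
          have v: "norm_continuous U (vacuum_expectation \<Omega> B)" and e2: "0 < e\<^sup>2"
            using vB e by (auto simp: scaling_local_iff)
          from norm_continuousD[OF v g e2]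
          show "\<forall>\<^sub>F h in at g within scaling_group. \<forall>l.
            norm (scaling_action U h (?\<Phi> B) l - scaling_action U g (?\<Phi> B) l) \<le> e"
          proof eventually_elim
            case (elim h)
            show ?case
            proof
              fix l
              let ?a = "cinner \<Omega> (B (l * fst h) \<Omega>)" and ?b = "cinner \<Omega> (B (l * fst g) \<Omega>)"
              have "norm (scaling_action U h (vacuum_expectation \<Omega> B) l
                  - scaling_action U g (vacuum_expectation \<Omega> B) l) \<le> e\<^sup>2" using elim by blast
              then have "norm (scalar_op (?a - ?b) :: 'h \<Rightarrow>\<^sub>L 'h) \<le> e\<^sup>2"
                unfolding vacuum_expectation_def using elim g
                by (simp add: scaling_action_algebra(6) scalar_op_algebra(2))
              then have "cmod (?a - ?b) \<le> e\<^sup>2" by (rule order_trans[OF cmod_scalar_op])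
              then have "sqrt (cmod (?a - ?b)) \<le> e" using e by (simp add: real_le_lsqrt)
              then have "norm (scalar_op (\<phi> ?a - \<phi> ?b) :: 'h \<Rightarrow>\<^sub>L 'h) \<le> e"
                by (rule order_trans[OF norm_scalar_op_le order_trans[OF \<phi>]])
              then show "norm (scaling_action U h (?\<Phi> B) l - scaling_action U g (?\<Phi> B) l) \<le> e"
                using elim g by (simp add: scaling_action_algebra(6) scalar_op_algebra(2))
            qed
          qed
        qed
      qed
    qed (rule R)
    fix e :: real assume e: "0 < e"
    have "norm (?\<Phi> (scalar_fun F) l - ?\<Phi> B l) \<le> e" if "\<And>l. norm (scalar_fun F l - B l) \<le> e\<^sup>2" for B l
    proof -
      let ?a = "cinner \<Omega> (scalar_op (F l) \<Omega>)" and ?b = "cinner \<Omega> (B l \<Omega>)"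
      have "cmod (?a - ?b) \<le> norm (scalar_fun F l - B l)"
        using norm_vacuum_expectation_le[of "scalar_fun F l - B l"]
        by (simp add: blinfun.diff_left cinner_diff_right)
      also have "\<dots> \<le> e\<^sup>2" by (rule that)
      finally have "cmod (?a - ?b) \<le> e\<^sup>2" .
      then have "sqrt (cmod (?a - ?b)) \<le> e" using e by (simp add: real_le_lsqrt)
      then have "norm (scalar_op (\<phi> ?a - \<phi> ?b) :: 'h \<Rightarrow>\<^sub>L 'h) \<le> e"
        by (rule order_trans[OF norm_scalar_op_le order_trans[OF \<phi>]])
      then show ?thesis by (simp add: scalar_op_algebra(2))
    qed
    then show "\<exists>d>0. \<forall>B\<in>bounded_scaling_funs. (\<forall>l. norm (scalar_fun F l - B l) \<le> d) \<longrightarrow>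
      (\<forall>l. norm (?\<Phi> (scalar_fun F) l - ?\<Phi> B l) \<le> e)"
      using e by (intro exI[of _ "e\<^sup>2"]) auto
  qed auto
  then show ?thesis by (simp add: cinner_scaleC_right cinner_Omega_Omega)
qed

lemma scalar_fun_center:
  assumes "scalar_fun F \<in> scaling_algebra \<AA> U"
  shows "scalar_fun F \<in> center (scaling_algebra \<AA> U)"
  unfolding center_def using assms scalar_op_comp_commute[OF scaling_algebraD(1)] by simp

lemma vacuum_expectation_center:
  "A \<in> scaling_algebra \<AA> U \<Longrightarrow> vacuum_expectation \<Omega> A \<in> center (scaling_algebra \<AA> U)"
  using scalar_fun_center[of "\<lambda>l. cinner \<Omega> (A l \<Omega>)"] scaling_algebra_vacuum_expectation[of A]
  unfolding vacuum_expectation_def by simp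

end

section \<open>Spectral distributions and translation invariant vectors\<close>

lemma projection_expectation:
  assumes "projection_op P"
  shows "cinner \<psi> (P \<psi>) = complex_of_real ((norm (P \<psi>))\<^sup>2)"
proof -
  have P: "P \<in> bounded_operators" "op_adj P = P" "P o\<^sub>L P = P"
    using assms by (auto simp: projection_op_def)
  have "P \<psi> = P (P \<psi>)" by (subst (1) P(3)[symmetric]) simp
  then have "cinner \<psi> (P \<psi>) = cinner \<psi> (P (P \<psi>))" by simp
  also have "\<dots> = cinner (P \<psi>) (P \<psi>)" using cinner_op_adj[OF P(1), of \<psi> "P \<psi>"] by (simp add: P(2))
  finally show ?thesis by (simp add: cinner_self)
qed

lemma sets_spectral_distribution [simp, measurable_cong]:
  "sets (spectral_distribution E \<psi>) = sets borel"
  unfolding spectral_distribution_def by (metis sets.sigma_sets_eq sets_measure_of space_borel sets.space_closed)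

lemma space_spectral_distribution [simp]: "space (spectral_distribution E \<psi>) = UNIV"
  unfolding spectral_distribution_def by (simp add: space_measure_of_conv)

lemma emeasure_spectral_distribution:
  fixes E :: "'p::topological_space set \<Rightarrow> 'h::complex_hilbert \<Rightarrow>\<^sub>L 'h"
  assumes E: "spectral_measure E" and S: "S \<in> sets borel"
  shows "emeasure (spectral_distribution E \<psi>) S = ennreal ((norm (E S \<psi>))\<^sup>2)"
proof -
  have Re: "Re (cinner \<psi> (E S \<psi>)) = (norm (E S \<psi>))\<^sup>2" if "S \<in> sets borel" for S
    using E that projection_expectation[of "E S" \<psi>] by (simp add: spectral_measure_def)
  have sums: "(\<lambda>n. E (F n) \<psi>) sums E (\<Union>n. F n) \<psi>" if "range F \<subseteq> sets borel" "disjoint_family F"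
    for F :: "nat \<Rightarrow> 'p set"
    using E that by (simp add: spectral_measure_def)
  \<comment> \<open>A sequence of empty sets is disjoint, and a constant series converges only if
    its terms vanish; this yields \<open>E {} \<psi> = 0\<close>.\<close>
  have "(\<lambda>n::nat. E {} \<psi>) sums E {} \<psi>"
    using sums[of "\<lambda>_. {}"] by (simp add: disjoint_family_on_def)
  then have "(\<lambda>n::nat. E {} \<psi>) \<longlonglongrightarrow> 0"
    by (meson sums_summable summable_LIMSEQ_zero)
  then have E0: "E {} \<psi> = 0" using LIMSEQ_unique tendsto_const by blast
  have "emeasure (spectral_distribution E \<psi>) S = ennreal (Re (cinner \<psi> (E S \<psi>)))"
    unfolding spectral_distribution_def
  proof (rule emeasure_measure_of_sigma[OF _ _ _ S])
    show "sigma_algebra UNIV (sets borel)" by (metis sets.sigma_algebra_axioms space_borel)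
    show "positive (sets borel) (\<lambda>S. ennreal (Re (cinner \<psi> (E S \<psi>))))"
      by (simp add: positive_def E0)
    show "countably_additive (sets borel) (\<lambda>S. ennreal (Re (cinner \<psi> (E S \<psi>))))"
    proof (rule countably_additiveI)
      fix F :: "nat \<Rightarrow> 'p set" assume F: "range F \<subseteq> sets borel" "disjoint_family F" "(\<Union>i. F i) \<in> sets borel"
      have "(\<lambda>n. Re (cinner \<psi> (E (F n) \<psi>))) sums Re (cinner \<psi> (E (\<Union>n. F n) \<psi>))"
        unfolding inner_eq_Re_cinner[symmetric]
        by (rule bounded_linear.sums[OF bounded_linear_inner_right sums[OF F(1,2)]])
      then show "(\<Sum>i. ennreal (Re (cinner \<psi> (E (F i) \<psi>)))) = ennreal (Re (cinner \<psi> (E (\<Union>i. F i) \<psi>)))"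
        by (intro suminf_ennreal_eq) (use F(1) Re in auto)
    qed
  qed
  then show ?thesis by (simp add: Re[OF S])
qed

text \<open>The complement of the support is a union of open sets on which E vanishes. Second
  countability reduces it to a countable union, hence to a null set.\<close>

lemma AE_spectral_support:
  fixes E :: "'p::second_countable_topology set \<Rightarrow> 'h::complex_hilbert \<Rightarrow>\<^sub>L 'h"
  assumes E: "spectral_measure E"
  shows "AE p in spectral_distribution E \<psi>. p \<in> spectral_support E"
proof -
  obtain \<F> where \<F>: "\<F> \<subseteq> {S. open S \<and> E S = 0}" "countable \<F>" "\<Union>\<F> = \<Union>{S. open S \<and> E S = 0}"
    by (rule Lindelof[of "{S. open S \<and> E S = 0}"]) auto
  have "(\<Union>S\<in>\<F>. S) \<in> null_sets (spectral_distribution E \<psi>)"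
  proof (rule null_sets_UN'[OF \<F>(2)])
    fix S assume "S \<in> \<F>"
    then have "open S" "E S = 0" using \<F>(1) by auto
    then show "S \<in> null_sets (spectral_distribution E \<psi>)"
      by (auto intro!: null_setsI simp: emeasure_spectral_distribution[OF E])
  qed
  then show ?thesis
    by (rule AE_I') (use \<F>(3) in \<open>auto simp: spectral_support_def\<close>)
qed

lemma prob_space_spectral_distribution:
  assumes E: "spectral_measure E" and "norm \<psi> = 1"
  shows "prob_space (spectral_distribution E \<psi>)"
proof (rule prob_spaceI)
  have "E UNIV = id_blinfun" using E by (simp add: spectral_measure_def)
  then show "emeasure (spectral_distribution E \<psi>) (space (spectral_distribution E \<psi>)) = 1"
    using assms(2) by (simp add: emeasure_spectral_distribution[OF E])
qed

lemma forward_cone_eq_zero: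
  assumes "p \<in> forward_cone" "p $ None = 0"
  shows "p = 0"
proof -
  have "(\<Sum>i\<in>UNIV. p $ Some i * p $ Some i) = 0"
    using assms sum_nonneg[of UNIV "\<lambda>i. p $ Some i * p $ Some i"]
    by (simp add: forward_cone_def mprod_def)
  then have "p $ Some i = 0" for i
    by (subst (asm) sum_nonneg_eq_0_iff) auto
  then show ?thesis using assms(2) by (simp add: vec_eq_iff) (metis not_None_eq)
qed

lemma real_distribution_distr:
  assumes "prob_space M" "f \<in> borel_measurable M"
  shows "real_distribution (distr M borel f)"
  by (intro real_distribution.intro prob_space.prob_space_distr assms real_distribution_axioms.intro) auto

lemma energy_measurable [measurable]: "(\<lambda>p::'s::finite mink. p $ None) \<in> borel_measurable borel"
  by (intro borel_measurable_continuous_onI continuous_intros)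

lemma mprod_axis_None: "mprod p (t *\<^sub>R axis None 1) = t * p $ None"
  by (simp add: mprod_def axis_def)

section \<open>Positive energy and translation invariant vectors\<close>

context vacuum_net begin

text \<open>Multiplicativity makes this operator idempotent, and an invertible idempotent is the
  identity.\<close>

lemma translation_zero: "U (0, mat 1) = id_blinfun"
proof (rule blinfun_eqI)
  fix x
  note u = unitary_scaling[OF mat_1_lorentz, of 0]
  have "U (0, mat 1) (U (0, mat 1) x) = U (0, mat 1) x"
    using mult[OF translation_poincare translation_poincare, of 0 0] by (simp flip: blinfun_apply_blinfun_compose)
  then show "U (0, mat 1) x = id_blinfun x"
    by (metis unitary_opD(2)[OF u] blinfun_apply_id_blinfun id_apply)
qed

lemma op_adj_translation: "op_adj (U (x, mat 1)) y = U (- x, mat 1) y"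
proof -
  note u = unitary_scaling[OF mat_1_lorentz, of x]
  have "U (- x, mat 1) (U (x, mat 1) z) = z" for z
    using mult[OF translation_poincare translation_poincare, of "- x" x]
    by (simp add: translation_zero flip: blinfun_apply_blinfun_compose)
  then show ?thesis by (metis unitary_opD(3)[OF u])
qed

text \<open>The energy distribution of \<open>\<psi>\<^sub>1\<close> is the reflection of that of \<open>\<psi>\<^sub>2\<close>, while both are carried
  by the positive half axis. So both are concentrated at \<open>0\<close>, the only point of the light cone
  with zero energy.\<close>

lemma translation_invariant_normalized:
  assumes n1: "norm \<psi>1 = 1" and n2: "norm \<psi>2 = 1"
    and reflected: "\<And>x. cinner \<psi>1 (U (x, mat 1) \<psi>1) = cinner \<psi>2 (U (- x, mat 1) \<psi>2)"
  shows "U (x, mat 1) \<psi>1 = \<psi>1"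
proof -
  obtain E :: "'s mink set \<Rightarrow> 'h \<Rightarrow>\<^sub>L 'h" where E: "spectral_measure E"
    and U: "\<And>x \<psi>. cinner \<psi> (U (x, mat 1) \<psi>) =
           (LINT p|spectral_distribution E \<psi>. exp (\<i> * complex_of_real (mprod p x)))"
    and supp: "spectral_support E \<subseteq> forward_cone"
    using spectrum unfolding spectrum_condition_def by blast
  let ?\<mu> = "spectral_distribution E"
  interpret P1: prob_space "?\<mu> \<psi>1" by (rule prob_space_spectral_distribution[OF E n1])
  interpret P2: prob_space "?\<mu> \<psi>2" by (rule prob_space_spectral_distribution[OF E n2])
  have cone: "AE p in ?\<mu> \<psi>. p \<in> forward_cone" for \<psi>
    using AE_spectral_support[OF E, of \<psi>] by eventually_elim (use supp in auto)
  \<comment> \<open>The laws of the energy in the state \<psi>1 and of the negative energy in the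
    state \<psi>2. Their characteristic functions are the two sides of \<open>reflected\<close> at
    translations in the time direction.\<close>
  define N1 where "N1 = distr (?\<mu> \<psi>1) borel (\<lambda>p. p $ None)"
  define N2 where "N2 = distr (?\<mu> \<psi>2) borel (\<lambda>p. - (p $ None))"
  have "real_distribution N1" "real_distribution N2"
    unfolding N1_def N2_def
    by (rule real_distribution_distr; (rule P1.prob_space_axioms P2.prob_space_axioms)?; measurable)+
  moreover have "char N1 = char N2"
  proof
    fix t
    have "char N1 t = (LINT p|?\<mu> \<psi>1. exp (\<i> * complex_of_real (mprod p (t *\<^sub>R axis None 1))))"
      unfolding char_def N1_def by (subst integral_distr) (auto simp: mprod_axis_None)
    also have "\<dots> = cinner \<psi>1 (U (t *\<^sub>R axis None 1, mat 1) \<psi>1)" by (rule U[symmetric])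
    also have "\<dots> = cinner \<psi>2 (U ((- t) *\<^sub>R axis None 1, mat 1) \<psi>2)" by (simp add: reflected)
    also have "\<dots> = (LINT p|?\<mu> \<psi>2. exp (\<i> * complex_of_real (mprod p ((- t) *\<^sub>R axis None 1))))" by (rule U)
    also have "\<dots> = char N2 t"
      unfolding char_def N2_def mprod_axis_None by (subst integral_distr) auto
    finally show "char N1 t = char N2 t" .
  qed
  ultimately have N: "N1 = N2" by (rule Levy_uniqueness)
  have "AE t in N1. 0 \<le> t"
    unfolding N1_def by (subst AE_distr_iff) (use cone[of \<psi>1] in \<open>auto simp: forward_cone_def elim: eventually_mono\<close>)
  moreover have "AE t in N2. t \<le> 0"
    unfolding N2_def by (subst AE_distr_iff) (use cone[of \<psi>2] in \<open>auto simp: forward_cone_def elim: eventually_mono\<close>)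
  ultimately have "AE t in N1. t = 0" unfolding N by eventually_elim auto
  then have "AE p in ?\<mu> \<psi>1. p $ None = 0"
    unfolding N1_def by (subst (asm) AE_distr_iff) auto
  then have zero: "AE p in ?\<mu> \<psi>1. p = 0"
    using cone[of \<psi>1] by eventually_elim (rule forward_cone_eq_zero)
  have "cinner \<psi>1 (U (x, mat 1) \<psi>1) = (LINT p|?\<mu> \<psi>1. (1::complex))"
    unfolding U
  proof (rule integral_cong_AE)
    show "(\<lambda>p. exp (\<i> * complex_of_real (mprod p x))) \<in> borel_measurable (?\<mu> \<psi>1)"
      unfolding measurable_cong_sets[OF sets_spectral_distribution refl] mprod_def
      by (intro borel_measurable_continuous_onI continuous_intros)
    show "AE p in ?\<mu> \<psi>1. exp (\<i> * complex_of_real (mprod p x)) = 1"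
      using zero by eventually_elim (simp add: mprod_def)
  qed simp
  also have "\<dots> = 1" using P1.prob_space by simp
  \<comment> \<open>Equality in Cauchy-Schwarz: unit vectors with inner product 1 coincide.\<close>
  finally have "inner \<psi>1 (U (x, mat 1) \<psi>1) = 1" by (simp add: inner_eq_Re_cinner)
  moreover have "norm (U (x, mat 1) \<psi>1) = 1"
    using unitary_opD(5)[OF unitary_scaling[OF mat_1_lorentz]] n1 by simp
  ultimately have "(norm (U (x, mat 1) \<psi>1 - \<psi>1))\<^sup>2 = 0"
    using n1 by (simp add: power2_norm_eq_inner inner_diff_left inner_diff_right inner_commute norm_eq_1)
  then show ?thesis by simp
qed

text \<open>Reduction to unit vectors, for which the spectral distributions are probability
  measures. One scaling factor serves both vectors because the hypothesis at x = 0 makes their norms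
  equal.\<close>

lemma translation_invariant:
  assumes reflected: "\<And>x. cinner \<psi>1 (U (x, mat 1) \<psi>1) = cinner \<psi>2 (U (- x, mat 1) \<psi>2)"
  shows "U (x, mat 1) \<psi>1 = \<psi>1"
proof (cases "\<psi>1 = 0")
  case False
  have eq: "norm \<psi>1 = norm \<psi>2"
    using reflected[of 0] by (intro norm_eqI_cinner) (simp add: translation_zero)
  define r where "r = 1 / norm \<psi>1"
  have r: "r > 0" using False by (simp add: r_def)
  have cs: "cinner (r *\<^sub>R \<psi>) (V (r *\<^sub>R \<psi>)) = (complex_of_real r)\<^sup>2 * cinner \<psi> (V \<psi>)"
    for \<psi> and V :: "'h \<Rightarrow>\<^sub>L 'h"
    unfolding blinfun.scaleR_right
    by (simp add: cinner_scaleC_left cinner_scaleC_right power2_eq_square flip: scaleC_of_real)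
  have "U (x, mat 1) (r *\<^sub>R \<psi>1) = r *\<^sub>R \<psi>1"
  proof (rule translation_invariant_normalized[where ?\<psi>2.0 = "r *\<^sub>R \<psi>2"])
    show "norm (r *\<^sub>R \<psi>1) = 1" "norm (r *\<^sub>R \<psi>2) = 1"
      using False r by (auto simp: r_def simp flip: eq)
  qed (simp only: cs reflected)
  then show ?thesis using r by (simp add: blinfun.scaleR_right)
qed simp

text \<open>An element \<open>T\<close> commuting with the translates of its adjoint satisfies
  \<open>(T\<^sup>*\<Omega>|U(x)T\<^sup>*\<Omega>) = (T\<Omega>|U(-x)T\<Omega>)\<close>.\<close>

lemma commuting_translates_vacuum:
  assumes T: "T \<in> bounded_operators"
    and comm: "\<And>x. T o\<^sub>L ad (U (x, mat 1)) (op_adj T) = ad (U (x, mat 1)) (op_adj T) o\<^sub>L T"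
  shows "\<exists>c. op_adj T \<Omega> = c *\<^sub>C \<Omega>"
proof (rule unique_vacuum, rule translation_invariant[where ?\<psi>2.0 = "T \<Omega>"])
  fix x :: "'s mink"
  let ?V = "U (x, mat 1)"
  note u = unitary_scaling[OF mat_1_lorentz, of x]
  have V\<Omega>: "?V \<Omega> = \<Omega>" by (rule invariant[OF translation_poincare])
  then have V\<Omega>': "op_adj ?V \<Omega> = \<Omega>" by (metis unitary_opD(2)[OF u])
  have "T (ad ?V (op_adj T) \<Omega>) = ad ?V (op_adj T) (T \<Omega>)"
    using comm[of x] by (metis blinfun_apply_blinfun_compose)
  then have c: "T (?V (op_adj T \<Omega>)) = ?V (op_adj T (op_adj ?V (T \<Omega>)))"
    by (simp add: ad_def V\<Omega>')
  have "cinner (op_adj T \<Omega>) (?V (op_adj T \<Omega>)) = cinner \<Omega> (T (?V (op_adj T \<Omega>)))"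
    by (rule cinner_op_adj[OF T])
  also have "\<dots> = cinner (?V \<Omega>) (?V (op_adj T (op_adj ?V (T \<Omega>))))" by (simp add: c V\<Omega>)
  also have "\<dots> = cinner \<Omega> (op_adj T (op_adj ?V (T \<Omega>)))" by (rule unitary_opD(4)[OF u])
  also have "\<dots> = cinner (T \<Omega>) (op_adj ?V (T \<Omega>))" by (rule cinner_op_adj'[OF T, symmetric])
  finally show "cinner (op_adj T \<Omega>) (?V (op_adj T \<Omega>)) = cinner (T \<Omega>) (U (- x, mat 1) (T \<Omega>))"
    by (simp add: op_adj_translation)
qed

section \<open>Limit states\<close>

lemma centerD:
  assumes "C \<in> center (scaling_algebra \<AA> U)"
  shows "C \<in> scaling_algebra \<AA> U" "A \<in> scaling_algebra \<AA> U \<Longrightarrow> C l o\<^sub>L A l = A l o\<^sub>L C l"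
  using assms by (auto simp: center_def)

lemma center_op_adj:
  assumes C: "C \<in> center (scaling_algebra \<AA> U)"
  shows "(\<lambda>l. op_adj (C l)) \<in> center (scaling_algebra \<AA> U)"
  unfolding center_def
proof (intro CollectI conjI ballI allI)
  note CM = centerD(1)[OF C]
  show "(\<lambda>l. op_adj (C l)) \<in> scaling_algebra \<AA> U" by (rule scaling_algebra_op_adj[OF CM])
  fix A l assume A: "A \<in> scaling_algebra \<AA> U"
  have "op_adj (C l o\<^sub>L op_adj (A l)) = op_adj (op_adj (A l) o\<^sub>L C l)"
    using centerD(2)[OF C scaling_algebra_op_adj[OF A]] by simp
  then show "op_adj (C l) o\<^sub>L A l = A l o\<^sub>L op_adj (C l)"
    using scaling_algebraD(1)[OF A] scaling_algebraD(1)[OF CM] by (simp add: op_adj_comp)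
qed

lemma center_vacuum:
  assumes C: "C \<in> center (scaling_algebra \<AA> U)"
  shows "C l \<Omega> = cinner \<Omega> (C l \<Omega>) *\<^sub>C \<Omega>"
proof -
  have *: "\<exists>c. op_adj (C l) \<Omega> = c *\<^sub>C \<Omega>" if C: "C \<in> center (scaling_algebra \<AA> U)" for C
  proof (rule commuting_translates_vacuum)
    show "C l \<in> bounded_operators" by (rule scaling_algebraD(1)[OF centerD(1)[OF C]])
    fix x :: "'s mink"
    have "real_of_pos l \<noteq> 0" using real_of_pos[of l] by simp
    then show "C l o\<^sub>L ad (U (x, mat 1)) (op_adj (C l)) = ad (U (x, mat 1)) (op_adj (C l)) o\<^sub>L C l"
      \<comment> \<open>The scaling algebra is translated by l x at scale l, so the translation by x
        at the fixed scale l comes from the vector x / l.\<close>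
      using centerD(2)[OF C scaling_algebra_translate[OF scaling_algebra_op_adj[OF centerD(1)[OF C]],
            of "(1 / real_of_pos l) *\<^sub>R x"], of l]
      by simp
  qed
  \<comment> \<open>The preceding fact concerns the adjoint of its argument; applied to the adjoint
    of C it gives C back.\<close>
  from *[OF center_op_adj[OF C]] obtain c where c: "C l \<Omega> = c *\<^sub>C \<Omega>"
    using scaling_algebraD(1)[OF centerD(1)[OF C]] by auto
  then show ?thesis by (simp add: cinner_scaleC_right cinner_Omega_Omega)
qed

lemma vacuum_expectation_square:
  assumes "C \<in> scaling_algebra \<AA> U"
  shows "vacuum_expectation \<Omega> (\<lambda>l. op_adj (C l) o\<^sub>L C l)
    = scalar_fun (\<lambda>l. complex_of_real ((norm (C l \<Omega>))\<^sup>2))"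
proof -
  have "cinner \<Omega> (op_adj (C l) (C l \<Omega>)) = complex_of_real ((norm (C l \<Omega>))\<^sup>2)" for l
    using cinner_op_adj'[OF scaling_algebraD(1)[OF assms], of l \<Omega> "C l \<Omega>"] by (simp add: cinner_self)
  then show ?thesis by (simp add: vacuum_expectation_def)
qed

section \<open>Positivity of means and its consequences for limit states\<close>

lemma scaling_algebra_square:
  "C \<in> scaling_algebra \<AA> U \<Longrightarrow> (\<lambda>l. op_adj (C l) o\<^sub>L C l) \<in> scaling_algebra \<AA> U"
  by (intro scaling_algebra_comp scaling_algebra_op_adj)

text \<open>\<open>state_on\<close> grants positivity at elements of the form C^* C with C central,
  so a nonnegative function has to be written as such a square within the algebra.\<close>

lemma mean_nonneg:
  assumes m: "state_on (center (scaling_algebra \<AA> U)) m"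
    and f: "\<And>l. 0 \<le> f l" and F: "scalar_fun (\<lambda>l. complex_of_real (f l)) \<in> scaling_algebra \<AA> U"
  shows "0 \<le> Re (m (scalar_fun (\<lambda>l. complex_of_real (f l))))"
proof -
  \<comment> \<open>The square root is extended to all complex arguments, as
    \<open>scalar_fun_compose\<close> demands; truncating the real part at 0 does not increase
    distances.\<close>
  let ?\<phi> = "\<lambda>a. complex_of_real (sqrt (max 0 (Re a)))"
  have sq: "\<bar>sqrt x - sqrt y\<bar> \<le> sqrt \<bar>x - y\<bar>" if "0 \<le> x" "0 \<le> y" for x y :: real
  proof -
    have *: "sqrt x - sqrt y \<le> sqrt (x - y)" if "0 \<le> y" "y \<le> x" for x y :: real
      using sqrt_add_le_add_sqrt[of y "x - y"] that by simp
    show ?thesis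
    proof (cases "y \<le> x")
      case True
      then show ?thesis using *[OF that(2) True] by simp
    next
      case False
      then show ?thesis using *[OF that(1), of y] by simp
    qed
  qed
  have "cmod (?\<phi> a - ?\<phi> b) \<le> sqrt (cmod (a - b))" for a b
  proof -
    have "cmod (?\<phi> a - ?\<phi> b) = \<bar>sqrt (max 0 (Re a)) - sqrt (max 0 (Re b))\<bar>"
      by (simp flip: of_real_diff)
    also have "\<dots> \<le> sqrt \<bar>max 0 (Re a) - max 0 (Re b)\<bar>" by (rule sq) auto
    also have "\<bar>max 0 (Re a) - max 0 (Re b)\<bar> \<le> \<bar>Re (a - b)\<bar>" by (simp add: max_def)
    also have "\<bar>Re (a - b)\<bar> \<le> cmod (a - b)" by (rule abs_Re_le_cmod)
    finally show ?thesis by simp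
  qed
  from scalar_fun_compose[OF F this]
  have G: "scalar_fun (\<lambda>l. complex_of_real (sqrt (f l))) \<in> center (scaling_algebra \<AA> U)"
    using f by (intro scalar_fun_center) (simp add: max_def)
  have "(\<lambda>l. op_adj (scalar_op (complex_of_real (sqrt (f l)))) o\<^sub>L scalar_op (complex_of_real (sqrt (f l))))
      = (scalar_fun (\<lambda>l. complex_of_real (f l)) :: 'h scaling_fun)"
    using f by (simp flip: scalar_op_algebra of_real_mult)
  then show ?thesis using m G by (auto simp: state_on_def)
qed

text \<open>At each scale |A_l B_l \<Omega>| is at most \<open>sup_norm A\<close> times |B_l
  \<Omega>|, and means are monotone. In the GNS space this becomes the bound of \<pi>(A) on the
  vectors \<pi>(B) w.\<close>

lemma limit_functional_bound:
  assumes m: "asymptotic_mean (scaling_algebra \<AA> U) m"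
    and \<phi>: "\<And>A. A \<in> scaling_algebra \<AA> U \<Longrightarrow> \<phi> A = m (vacuum_expectation \<Omega> A)"
    and A: "A \<in> scaling_algebra \<AA> U" and B: "B \<in> scaling_algebra \<AA> U"
  shows "Re (\<phi> (\<lambda>l. op_adj (A l o\<^sub>L B l) o\<^sub>L (A l o\<^sub>L B l)))
    \<le> (sup_norm A)\<^sup>2 * Re (\<phi> (\<lambda>l. op_adj (B l) o\<^sub>L B l))"
proof -
  let ?M = "scaling_algebra \<AA> U" and ?k = "(sup_norm A)\<^sup>2"
  define X :: "'h scaling_fun" where "X = scalar_fun (\<lambda>l. complex_of_real ((norm (B l \<Omega>))\<^sup>2))"
  define Y :: "'h scaling_fun" where "Y = scalar_fun (\<lambda>l. complex_of_real ((norm ((A l o\<^sub>L B l) \<Omega>))\<^sup>2))"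
  note AB = scaling_algebra_comp[OF A B]
  have mst: "state_on (center ?M) m" using m by (simp add: asymptotic_mean_def)
  have X: "X \<in> center ?M" "\<phi> (\<lambda>l. op_adj (B l) o\<^sub>L B l) = m X"
    using vacuum_expectation_center[OF scaling_algebra_square[OF B]] \<phi>[OF scaling_algebra_square[OF B]]
    by (simp_all only: vacuum_expectation_square[OF B] X_def)
  have Y: "Y \<in> center ?M" "\<phi> (\<lambda>l. op_adj (A l o\<^sub>L B l) o\<^sub>L (A l o\<^sub>L B l)) = m Y"
    using vacuum_expectation_center[OF scaling_algebra_square[OF AB]] \<phi>[OF scaling_algebra_square[OF AB]]
    by (simp_all only: vacuum_expectation_square[OF AB] Y_def)
  define f where "f l = ?k * (norm (B l \<Omega>))\<^sup>2 - (norm (A l (B l \<Omega>)))\<^sup>2" for l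
  have f: "0 \<le> f l" for l
  proof -
    have "norm (A l (B l \<Omega>)) \<le> norm (A l) * norm (B l \<Omega>)" by (rule norm_blinfun)
    also have "\<dots> \<le> sup_norm A * norm (B l \<Omega>)"
      by (rule mult_right_mono[OF scaling_algebraD(2)[OF A]]) simp
    finally show ?thesis
      unfolding f_def by (metis diff_ge_0_iff_ge norm_ge_zero power_mono power_mult_distrib)
  qed
  \<comment> \<open>The difference is written as a sum with the factor -1, the form in which
    \<open>state_on\<close> provides linearity.\<close>
  have eq: "(\<lambda>l. (scalar_op (complex_of_real ?k) o\<^sub>L X l) + (scalar_op (- 1) o\<^sub>L Y l))
      = scalar_fun (\<lambda>l. complex_of_real (f l))"
    unfolding X_def Y_def f_def by (simp flip: scalar_op_algebra)
  have XM: "X \<in> ?M" "Y \<in> ?M" using X Y by (auto simp: center_def)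
  have kX: "(\<lambda>l. scalar_op (complex_of_real ?k) o\<^sub>L X l) \<in> center ?M" "(\<lambda>l. scalar_op (- 1) o\<^sub>L Y l) \<in> center ?M"
    using scaling_algebra_scale[OF XM(1), of "complex_of_real ?k"] scaling_algebra_scale[OF XM(2), of "-1"]
      scalar_fun_center
    unfolding X_def Y_def by (simp_all flip: scalar_op_algebra(3))
  have "scalar_fun (\<lambda>l. complex_of_real (f l)) \<in> ?M"
    unfolding eq[symmetric] by (intro scaling_algebra_add scaling_algebra_scale XM)
  from mean_nonneg[OF mst f this]
  have "0 \<le> Re (m (\<lambda>l. (scalar_op (complex_of_real ?k) o\<^sub>L X l) + (scalar_op (- 1) o\<^sub>L Y l)))"
    by (simp only: eq)
  also have "m (\<lambda>l. (scalar_op (complex_of_real ?k) o\<^sub>L X l) + (scalar_op (- 1) o\<^sub>L Y l))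
      = complex_of_real ?k * m X + (- 1) * m Y"
    using mst kX X(1) Y(1) unfolding state_on_def by simp
  finally show ?thesis by (simp add: X(2) Y(2))
qed

text \<open>The eigenvalue equation of \<open>center_vacuum\<close> makes the vacuum expectation of
  C^* C factor at every scale into those of C^* and C; the mean then factors as well.\<close>

lemma multiplicative_limit_state_center:
  assumes \<phi>: "multiplicative_limit_state (scaling_algebra \<AA> U) \<Omega> \<phi>"
    and C: "C \<in> center (scaling_algebra \<AA> U)"
  shows "\<phi> (\<lambda>l. op_adj (C l) o\<^sub>L C l) = \<phi> (\<lambda>l. op_adj (C l)) * \<phi> C"
proof -
  let ?M = "scaling_algebra \<AA> U"
  obtain m where m: "multiplicative_mean ?M m" and \<phi>: "\<And>A. A \<in> ?M \<Longrightarrow> \<phi> A = m (vacuum_expectation \<Omega> A)"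
    using \<phi> unfolding multiplicative_limit_state_def by blast
  note CM = centerD(1)[OF C]
  note CM' = scaling_algebra_op_adj[OF CM]
  have "cinner \<Omega> (op_adj (C l) \<Omega>) = cnj (cinner \<Omega> (C l \<Omega>))" for l
    using cinner_op_adj'[OF scaling_algebraD(1)[OF CM], of l \<Omega> \<Omega>] cinner_commute by metis
  moreover have "norm (C l \<Omega>) = cmod (cinner \<Omega> (C l \<Omega>))" for l
    by (subst center_vacuum[OF C]) (simp add: norm_scaleC normalized)
  ultimately have "vacuum_expectation \<Omega> (\<lambda>l. op_adj (C l) o\<^sub>L C l)
      = (\<lambda>l. vacuum_expectation \<Omega> (\<lambda>l. op_adj (C l)) l o\<^sub>L vacuum_expectation \<Omega> C l)"
    unfolding vacuum_expectation_square[OF CM]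
    by (simp add: vacuum_expectation_def complex_norm_square[symmetric] mult.commute[of "cnj _"]
        flip: scalar_op_algebra(3))
  then show ?thesis
    using m vacuum_expectation_center[OF CM] vacuum_expectation_center[OF CM']
    by (simp add: \<phi> scaling_algebra_square CM CM' multiplicative_mean_def)
qed

end

section \<open>Hilbert spaces with explicit carrier\<close>

context hilbert_space begin

abbreviation "C \<equiv> hcarrier K"
abbreviation hplus (infixl "\<^bold>+" 65) where "x \<^bold>+ y \<equiv> hadd K x y"
abbreviation htimes (infixr "\<^bold>\<cdot>" 75) where "c \<^bold>\<cdot> x \<equiv> hscale K c x"
abbreviation hminus (infixl "\<^bold>-" 65) where "x \<^bold>- y \<equiv> hdiff K x y"
abbreviation "nrm \<equiv> hnorm K"

lemma diff_closed: "x \<in> C \<Longrightarrow> y \<in> C \<Longrightarrow> x \<^bold>- y \<in> C"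
  by (simp add: hdiff_def add_closed scale_closed)

lemmas closed = zero_closed add_closed scale_closed diff_closed

lemma scale_zero: "x \<in> C \<Longrightarrow> 0 \<^bold>\<cdot> x = hzero K"
  using scale_add_left[of x 1 "-1"] by (simp add: scale_one hdiff_def flip: diff_self)

lemma scale_zero_right: "c \<^bold>\<cdot> hzero K = hzero K"
  using scale_scale[OF zero_closed, of c 0] scale_zero[OF zero_closed] by simp

lemma zero_add: "x \<in> C \<Longrightarrow> hzero K \<^bold>+ x = x"
  by (metis add_comm add_zero zero_closed)

lemma add_left_comm: "x \<in> C \<Longrightarrow> y \<in> C \<Longrightarrow> z \<in> C \<Longrightarrow> x \<^bold>+ (y \<^bold>+ z) = y \<^bold>+ (x \<^bold>+ z)"
  by (metis add_assoc add_comm)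

lemmas add_ac = add_assoc add_comm add_left_comm

lemma add_neg_cancel: "x \<in> C \<Longrightarrow> y \<in> C \<Longrightarrow> x \<^bold>+ ((-1) \<^bold>\<cdot> x \<^bold>+ y) = y"
  using diff_self[of x] by (simp add: hdiff_def zero_add closed flip: add_assoc)

lemma diff_add_diff: "x \<in> C \<Longrightarrow> y \<in> C \<Longrightarrow> z \<in> C \<Longrightarrow> (x \<^bold>- y) \<^bold>+ (y \<^bold>- z) = x \<^bold>- z"
  using add_neg_cancel[of y "x \<^bold>+ (-1) \<^bold>\<cdot> z"] by (simp add: hdiff_def closed add_ac)

lemma add_diff_add: "x \<in> C \<Longrightarrow> y \<in> C \<Longrightarrow> x' \<in> C \<Longrightarrow> y' \<in> C \<Longrightarrow>
    (x \<^bold>+ y) \<^bold>- (x' \<^bold>+ y') = (x \<^bold>- x') \<^bold>+ (y \<^bold>- y')"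
  by (simp add: hdiff_def closed scale_add_right add_ac)

lemma scale_diff: "x \<in> C \<Longrightarrow> y \<in> C \<Longrightarrow> c \<^bold>\<cdot> (x \<^bold>- y) = c \<^bold>\<cdot> x \<^bold>- c \<^bold>\<cdot> y"
  by (simp add: hdiff_def closed scale_add_right scale_scale mult.commute)

lemma diff_scale: "x \<in> C \<Longrightarrow> a \<^bold>\<cdot> x \<^bold>- b \<^bold>\<cdot> x = (a - b) \<^bold>\<cdot> x"
  using scale_add_left[of x a "-b"] by (simp add: hdiff_def scale_scale)

lemma diff_add_cancel: "x \<in> C \<Longrightarrow> y \<in> C \<Longrightarrow> (x \<^bold>- y) \<^bold>+ y = x"
  using add_neg_cancel[of y x] by (simp add: hdiff_def closed add_ac)

lemma diff_zero: "x \<in> C \<Longrightarrow> x \<^bold>- hzero K = x"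
  by (simp add: hdiff_def scale_zero_right add_zero)

lemma diff_eq_zeroD: "x \<in> C \<Longrightarrow> y \<in> C \<Longrightarrow> x \<^bold>- y = hzero K \<Longrightarrow> x = y"
  using diff_add_cancel zero_add by metis

lemma ip_add_left: "x \<in> C \<Longrightarrow> y \<in> C \<Longrightarrow> z \<in> C \<Longrightarrow> hip K (x \<^bold>+ y) z = hip K x z + hip K y z"
  using ip_commute[of "x \<^bold>+ y" z] ip_commute[of x z] ip_commute[of y z]
  by (simp add: ip_add_right closed)

lemma ip_scale_left: "x \<in> C \<Longrightarrow> y \<in> C \<Longrightarrow> hip K (c \<^bold>\<cdot> x) y = cnj c * hip K x y"
  using ip_commute[of "c \<^bold>\<cdot> x" y] ip_commute[of x y] by (simp add: ip_scale_right closed)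

lemma ip_diff_right: "x \<in> C \<Longrightarrow> y \<in> C \<Longrightarrow> z \<in> C \<Longrightarrow> hip K x (y \<^bold>- z) = hip K x y - hip K x z"
  by (simp add: hdiff_def ip_add_right ip_scale_right closed)

lemma ip_diff_left: "x \<in> C \<Longrightarrow> y \<in> C \<Longrightarrow> z \<in> C \<Longrightarrow> hip K (x \<^bold>- y) z = hip K x z - hip K y z"
  by (simp add: hdiff_def ip_add_left ip_scale_left closed)

lemma norm_nonneg: "x \<in> C \<Longrightarrow> 0 \<le> nrm x"
  by (simp add: hnorm_def ip_nonneg)

lemma norm_sq: "x \<in> C \<Longrightarrow> (nrm x)\<^sup>2 = Re (hip K x x)"
  by (simp add: hnorm_def ip_nonneg)

lemma ip_self: "x \<in> C \<Longrightarrow> hip K x x = complex_of_real ((nrm x)\<^sup>2)"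
  using ip_commute[of x x] by (simp add: norm_sq complex_eq_iff)

lemma norm_zero_iff: "x \<in> C \<Longrightarrow> nrm x = 0 \<longleftrightarrow> x = hzero K"
  using ip_self[of x] ip_eq_zero[of x] ip_scale_right[OF zero_closed zero_closed, of 0]
  by (auto simp: hnorm_def scale_zero_right)

lemma norm_zero: "nrm (hzero K) = 0"
  by (simp add: norm_zero_iff zero_closed)

lemma norm_scale: "x \<in> C \<Longrightarrow> nrm (c \<^bold>\<cdot> x) = cmod c * nrm x"
proof -
  assume x: "x \<in> C"
  have "hip K (c \<^bold>\<cdot> x) (c \<^bold>\<cdot> x) = (c * cnj c) * hip K x x"
    using x by (simp add: ip_scale_left ip_scale_right closed)
  also have "\<dots> = complex_of_real ((cmod c * nrm x)\<^sup>2)"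
    using x by (simp add: ip_self power_mult_distrib flip: complex_norm_square)
  finally have "Re (hip K (c \<^bold>\<cdot> x) (c \<^bold>\<cdot> x)) = (cmod c * nrm x)\<^sup>2" by (simp only: Re_complex_of_real)
  then have "(nrm (c \<^bold>\<cdot> x))\<^sup>2 = (cmod c * nrm x)\<^sup>2" using x by (simp only: norm_sq closed)
  then show ?thesis using x by (simp add: norm_nonneg closed)
qed

lemma cauchy_schwarz:
  assumes x: "x \<in> C" and y: "y \<in> C"
  shows "cmod (hip K x y) \<le> nrm x * nrm y"
proof (cases "nrm y = 0")
  case True
  then have "y = hzero K" using y by (simp add: norm_zero_iff)
  then show ?thesis
    using ip_scale_right[OF x zero_closed, of 0] True by (simp add: scale_zero_right)
next
  case False
  define n where "n = (nrm y)\<^sup>2"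
  have n: "n > 0" using False by (simp add: n_def)
  define h where "h = hip K y x"
  define c where "c = - (h / complex_of_real n)"
  have h': "hip K x y = cnj h" using ip_commute[OF x y] by (simp add: h_def)
  have "hip K (x \<^bold>+ c \<^bold>\<cdot> y) (x \<^bold>+ c \<^bold>\<cdot> y)
      = hip K x x + c * cnj h + cnj c * h + cnj c * c * hip K y y"
    using x y by (simp add: ip_add_left ip_add_right ip_scale_left ip_scale_right closed h'
        algebra_simps flip: h_def)
  also have "\<dots> = complex_of_real ((nrm x)\<^sup>2) + c * cnj h + cnj c * h + cnj c * c * complex_of_real n"
    using x y by (simp add: ip_self n_def)
  also have "\<dots> = complex_of_real ((nrm x)\<^sup>2) - h * cnj h / complex_of_real n"
    using n by (simp add: c_def field_simps)
  also have "\<dots> = complex_of_real ((nrm x)\<^sup>2 - (cmod h)\<^sup>2 / n)"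
    by (simp flip: complex_norm_square)
  finally have "0 \<le> (nrm x)\<^sup>2 - (cmod h)\<^sup>2 / n"
    using ip_nonneg[of "x \<^bold>+ c \<^bold>\<cdot> y"] x y by (simp add: closed)
  then have "(cmod h)\<^sup>2 \<le> (nrm x * nrm y)\<^sup>2"
    using n by (simp add: pos_divide_le_eq n_def power_mult_distrib)
  then have "cmod h \<le> nrm x * nrm y"
    by (rule power2_le_imp_le) (use x y in \<open>simp add: norm_nonneg\<close>)
  then show ?thesis by (simp add: h')
qed

lemma norm_triangle:
  assumes x: "x \<in> C" and y: "y \<in> C"
  shows "nrm (x \<^bold>+ y) \<le> nrm x + nrm y"
proof (rule power2_le_imp_le)
  have "hip K y x = cnj (hip K x y)" by (rule ip_commute[OF y x])
  then have "(nrm (x \<^bold>+ y))\<^sup>2 = (nrm x)\<^sup>2 + (nrm y)\<^sup>2 + 2 * Re (hip K x y)"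
    using x y by (simp add: norm_sq closed ip_add_left ip_add_right)
  also have "\<dots> \<le> (nrm x)\<^sup>2 + (nrm y)\<^sup>2 + 2 * (nrm x * nrm y)"
    using cauchy_schwarz[OF x y] complex_Re_le_cmod[of "hip K x y"] by simp
  finally show "(nrm (x \<^bold>+ y))\<^sup>2 \<le> (nrm x + nrm y)\<^sup>2" by (simp add: power2_sum)
qed (use x y in \<open>simp add: norm_nonneg\<close>)

lemma dist_triangle:
  "x \<in> C \<Longrightarrow> y \<in> C \<Longrightarrow> z \<in> C \<Longrightarrow> nrm (x \<^bold>- z) \<le> nrm (x \<^bold>- y) + nrm (y \<^bold>- z)"
  using norm_triangle[of "x \<^bold>- y" "y \<^bold>- z"] by (simp add: diff_add_diff closed)

lemma dist_commute: "x \<in> C \<Longrightarrow> y \<in> C \<Longrightarrow> nrm (x \<^bold>- y) = nrm (y \<^bold>- x)"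
proof -
  assume *: "x \<in> C" "y \<in> C"
  then have "y \<^bold>- x = (-1) \<^bold>\<cdot> (x \<^bold>- y)"
    by (simp add: hdiff_def scale_add_right scale_scale scale_one closed add_ac)
  with * show ?thesis by (simp add: norm_scale closed)
qed

lemma norm_diff_norm:
  assumes "x \<in> C" "y \<in> C"
  shows "\<bar>nrm x - nrm y\<bar> \<le> nrm (x \<^bold>- y)"
  using norm_triangle[of "x \<^bold>- y" y] norm_triangle[of "y \<^bold>- x" x] dist_commute[of x y] assms
  by (simp add: closed diff_add_cancel)

text \<open>Squared distances are what gets integrated, and they obey the triangle inequality up to
  a factor 2. This is the origin of the factors 2 in \<open>close_to_trans\<close> and
  \<open>close_to_add\<close>.\<close>

lemma square_triangle:
  assumes "x \<in> C" "y \<in> C"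
  shows "(nrm (x \<^bold>+ y))\<^sup>2 \<le> 2 * (nrm x)\<^sup>2 + 2 * (nrm y)\<^sup>2"
proof -
  have "(nrm (x \<^bold>+ y))\<^sup>2 \<le> (nrm x + nrm y)\<^sup>2"
    by (intro power_mono norm_triangle norm_nonneg closed assms)
  also have "\<dots> \<le> 2 * (nrm x)\<^sup>2 + 2 * (nrm y)\<^sup>2"
    using sum_squares_bound[of "nrm x" "nrm y"] by (simp add: power2_sum)
  finally show ?thesis .
qed

text \<open>It serves twice: measurability of inner products of sections follows from that of norms,
  and a linear map that preserves norms preserves inner products.\<close>

lemma polarization:
  assumes x: "x \<in> C" and y: "y \<in> C"
  shows "4 * hip K x y = complex_of_real ((nrm (x \<^bold>+ y))\<^sup>2 - (nrm (x \<^bold>- y))\<^sup>2)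
    + \<i> * complex_of_real ((nrm (x \<^bold>- \<i> \<^bold>\<cdot> y))\<^sup>2 - (nrm (x \<^bold>+ \<i> \<^bold>\<cdot> y))\<^sup>2)"
proof -
  have "hip K y x = cnj (hip K x y)" by (rule ip_commute[OF y x])
  then show ?thesis
    using x y by (simp add: norm_sq closed ip_add_left ip_add_right ip_diff_left ip_diff_right
        ip_scale_left ip_scale_right complex_eq_iff)
qed

lemma hops_diff:
  assumes "T \<in> hops K" "x \<in> C" "y \<in> C"
  shows "T (x \<^bold>- y) = T x \<^bold>- T y"
  using assms by (simp add: hops_def hdiff_def closed)

lemma approx_eq:
  assumes "x \<in> C" "y \<in> C" "\<And>e. 0 < e \<Longrightarrow> nrm (x \<^bold>- y) \<le> e"
  shows "x = y"
proof (rule diff_eq_zeroD[OF assms(1,2)])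
  have "nrm (x \<^bold>- y) \<le> 0" by (rule field_le_epsilon) (use assms(3) in simp)
  then show "x \<^bold>- y = hzero K"
    using norm_nonneg[of "x \<^bold>- y"] assms by (simp add: closed flip: norm_zero_iff)
qed

lemma limit_norm:
  assumes "\<And>n. X n \<in> C" "x \<in> C" "y \<in> C" "(\<lambda>n. nrm (X n \<^bold>- x)) \<longlonglongrightarrow> 0"
  shows "(\<lambda>n. nrm (X n \<^bold>- y)) \<longlonglongrightarrow> nrm (x \<^bold>- y)"
proof -
  have "\<bar>nrm (X n \<^bold>- y) - nrm (x \<^bold>- y)\<bar> \<le> nrm (X n \<^bold>- x)" for n
    using dist_triangle[of "X n" x y] dist_triangle[of x "X n" y] dist_commute[of x "X n"] assms(1-3)
    by (simp add: abs_le_iff)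
  then have "(\<lambda>n. nrm (X n \<^bold>- y) - nrm (x \<^bold>- y)) \<longlonglongrightarrow> 0"
    by (intro Lim_null_comparison[OF _ assms(4)] always_eventually allI) simp
  then show ?thesis by (simp add: LIM_zero_iff)
qed

lemma geometric_Cauchy:
  assumes X: "\<And>n. X n \<in> C" and ev: "\<forall>\<^sub>F n in sequentially. nrm (X n \<^bold>- X (Suc n)) \<le> (1/2) ^ n"
  shows "\<exists>x\<in>C. (\<lambda>n. nrm (X n \<^bold>- x)) \<longlonglongrightarrow> 0"
proof (rule complete[OF X])
  obtain N0 where N0: "\<And>n. n \<ge> N0 \<Longrightarrow> nrm (X n \<^bold>- X (Suc n)) \<le> (1/2) ^ n"
    using ev by (auto simp: eventually_sequentially)
  have step: "nrm (X n \<^bold>- X (n + k)) \<le> 2 * (1/2) ^ n" if "n \<ge> N0" for n k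
  proof -
    \<comment> \<open>Keeping the remaining tail of the geometric series on the right lets the
      induction close.\<close>
    have "nrm (X n \<^bold>- X (n + k)) \<le> 2 * (1/2) ^ n - 2 * (1/2) ^ (n + k)"
    proof (induction k)
      case 0
      then show ?case using X by (simp add: diff_self norm_zero)
    next
      case (Suc k)
      have "nrm (X n \<^bold>- X (n + Suc k)) \<le> nrm (X n \<^bold>- X (n + k)) + nrm (X (n + k) \<^bold>- X (Suc (n + k)))"
        using dist_triangle X by simp
      then show ?case using Suc N0[of "n + k"] that by simp
    qed
    moreover have "0 \<le> 2 * (1/2::real) ^ (n + k)" by simp
    ultimately show ?thesis by linarith
  qed
  fix e :: real assume "e > 0"
  then obtain m where m: "(1/2) ^ m < e / 4"
    using real_arch_pow_inv[of "e/4" "1/2"] by auto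
  let ?N = "max N0 m"
  have "nrm (X i \<^bold>- X j) < e" if ij: "i \<ge> ?N" "j \<ge> ?N" for i j
  proof -
    have *: "nrm (X ?N \<^bold>- X i) \<le> 2 * (1/2) ^ ?N" if "i \<ge> ?N" for i
      using step[of ?N "i - ?N"] that by simp
    have "(1/2::real) ^ ?N \<le> (1/2) ^ m" by (rule power_decreasing) auto
    moreover have "nrm (X i \<^bold>- X j) \<le> nrm (X ?N \<^bold>- X i) + nrm (X ?N \<^bold>- X j)"
      using dist_triangle[of "X i" "X ?N" "X j"] dist_commute[of "X i" "X ?N"] X by simp
    ultimately show ?thesis using *[OF ij(1)] *[OF ij(2)] m by linarith
  qed
  then show "\<exists>N. \<forall>i\<ge>N. \<forall>j\<ge>N. nrm (X i \<^bold>- X j) < e" by blast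
qed

end

section \<open>The complete section space generated by a fundamental family\<close>

text \<open>In the completion every subset of a null set is measurable, so the values of f on the
  exceptional set are harmless.\<close>

lemma borel_measurable_completion_AE:
  fixes f g :: "'z \<Rightarrow> 'b::topological_space"
  assumes g: "g \<in> borel_measurable (completion M)" and eq: "AE x in M. f x = g x"
  shows "f \<in> borel_measurable (completion M)"
proof (rule measurableI)
  fix S :: "'b set" assume S: "S \<in> sets borel"
  show "f -` S \<inter> space (completion M) \<in> sets (completion M)"
  proof (rule completion.in_sets_AE[OF _ measurable_sets[OF g S]])
    show "AE x in completion M. (x \<in> g -` S \<inter> space (completion M)) = (x \<in> f -` S \<inter> space (completion M))"
      using AE_completion[OF eq] by eventually_elim auto
  qed auto
qed simp

lemma borel_measurable_completion_AE_LIMSEQ: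
  fixes f :: "'z \<Rightarrow> real"
  assumes u: "\<And>n. u n \<in> borel_measurable (completion M)"
    and lim: "AE x in M. (\<lambda>n. u n x) \<longlonglongrightarrow> f x"
  shows "f \<in> borel_measurable (completion M)"
proof (rule borel_measurable_completion_AE)
  show "(\<lambda>x. lim (\<lambda>n. u n x)) \<in> borel_measurable (completion M)"
    using u by (rule borel_measurable_lim_metric)
  show "AE x in M. f x = lim (\<lambda>n. u n x)"
    using lim by eventually_elim (simp add: limI)
qed

locale hilbert_family = prob_space \<nu> for \<nu> :: "'z measure" +
  fixes H :: "'z \<Rightarrow> 'a hspace"
  assumes fibre: "hilbert_space (H z)"
begin

sublocale hilbert_space "H z" for z by (rule fibre)

sublocale compl: prob_space "completion \<nu>" by (rule prob_space_completion)

section \<open>Upper integrals of squared distances between sections\<close>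

abbreviation "sdist2 \<xi> \<psi> z \<equiv> (hnorm (H z) (hdiff (H z) (\<xi> z) (\<psi> z)))\<^sup>2"

text \<open>\<open>close_to e \<xi> \<psi>\<close> says that the upper integral of \<open>\<parallel>\<xi>(z) - \<psi>(z)\<parallel>\<^sup>2\<close> is at most \<open>e\<close>. Unlike the
  integral it behaves well before measurability of sums of sections is known.\<close>

definition close_to :: "real \<Rightarrow> ('z \<Rightarrow> 'a) \<Rightarrow> ('z \<Rightarrow> 'a) \<Rightarrow> bool" where
  "close_to e \<xi> \<psi> \<longleftrightarrow> (\<exists>g. integrable (completion \<nu>) g \<and> (AE z in \<nu>. sdist2 \<xi> \<psi> z \<le> g z) \<and>
     integral\<^sup>L (completion \<nu>) g \<le> e)"

lemma sectionsD: "\<xi> \<in> sections H \<Longrightarrow> \<xi> z \<in> hcarrier (H z)"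
  by (simp add: sections_def)

lemma sections_closed:
  "(\<lambda>z. hzero (H z)) \<in> sections H"
  "\<xi> \<in> sections H \<Longrightarrow> \<psi> \<in> sections H \<Longrightarrow> (\<lambda>z. hadd (H z) (\<xi> z) (\<psi> z)) \<in> sections H"
  "\<xi> \<in> sections H \<Longrightarrow> \<psi> \<in> sections H \<Longrightarrow> (\<lambda>z. hdiff (H z) (\<xi> z) (\<psi> z)) \<in> sections H"
  "\<xi> \<in> sections H \<Longrightarrow> (\<lambda>z. hscale (H z) (f z) (\<xi> z)) \<in> sections H"
  by (simp_all add: sections_def closed)

lemma close_to_refl: "\<xi> \<in> sections H \<Longrightarrow> close_to 0 \<xi> \<xi>"
  unfolding close_to_def by (rule exI[of _ "\<lambda>_. 0"]) (simp add: diff_self norm_zero sectionsD)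

lemma close_to_mono: "close_to e \<xi> \<psi> \<Longrightarrow> e \<le> e' \<Longrightarrow> close_to e' \<xi> \<psi>"
  unfolding close_to_def by (meson order_trans)

lemma close_to_commute: "\<xi> \<in> sections H \<Longrightarrow> \<psi> \<in> sections H \<Longrightarrow> close_to e \<xi> \<psi> \<Longrightarrow> close_to e \<psi> \<xi>"
  unfolding close_to_def by (simp add: dist_commute[of "\<xi> _" _ "\<psi> _"] sectionsD)

lemma close_to_bound2:
  assumes "close_to e \<xi> \<xi>'" "close_to e' \<psi> \<psi>'"
    and "\<And>z. sdist2 \<zeta> \<zeta>' z \<le> 2 * sdist2 \<xi> \<xi>' z + 2 * sdist2 \<psi> \<psi>' z"
  shows "close_to (2 * e + 2 * e') \<zeta> \<zeta>'"
proof -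
  obtain g g' where g: "integrable (completion \<nu>) g" "AE z in \<nu>. sdist2 \<xi> \<xi>' z \<le> g z" "integral\<^sup>L (completion \<nu>) g \<le> e"
    and g': "integrable (completion \<nu>) g'" "AE z in \<nu>. sdist2 \<psi> \<psi>' z \<le> g' z" "integral\<^sup>L (completion \<nu>) g' \<le> e'"
    using assms(1,2) unfolding close_to_def by auto
  have "AE z in \<nu>. sdist2 \<zeta> \<zeta>' z \<le> 2 * g z + 2 * g' z"
    using g(2) g'(2)
  proof eventually_elim
    case (elim z)
    then show ?case using assms(3)[of z] by linarith
  qed
  then show ?thesis
    unfolding close_to_def using g g' by (intro exI[of _ "\<lambda>z. 2 * g z + 2 * g' z"]) simp
qed

lemma close_to_trans:
  assumes "\<xi> \<in> sections H" "\<psi> \<in> sections H" "\<zeta> \<in> sections H" "close_to e \<xi> \<psi>" "close_to e' \<psi> \<zeta>"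
  shows "close_to (2 * e + 2 * e') \<xi> \<zeta>"
proof (rule close_to_bound2[OF assms(4,5)])
  show "sdist2 \<xi> \<zeta> z \<le> 2 * sdist2 \<xi> \<psi> z + 2 * sdist2 \<psi> \<zeta> z" for z
    using square_triangle[of "hdiff (H z) (\<xi> z) (\<psi> z)" z "hdiff (H z) (\<psi> z) (\<zeta> z)"] assms(1-3)
    by (simp add: diff_add_diff closed sectionsD)
qed

lemma close_to_add:
  assumes "\<xi> \<in> sections H" "\<psi> \<in> sections H" "\<xi>' \<in> sections H" "\<psi>' \<in> sections H"
    "close_to e \<xi> \<xi>'" "close_to e' \<psi> \<psi>'"
  shows "close_to (2 * e + 2 * e') (\<lambda>z. hadd (H z) (\<xi> z) (\<psi> z)) (\<lambda>z. hadd (H z) (\<xi>' z) (\<psi>' z))"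
proof (rule close_to_bound2[OF assms(5,6)])
  show "sdist2 (\<lambda>z. hadd (H z) (\<xi> z) (\<psi> z)) (\<lambda>z. hadd (H z) (\<xi>' z) (\<psi>' z)) z
      \<le> 2 * sdist2 \<xi> \<xi>' z + 2 * sdist2 \<psi> \<psi>' z" for z
    using square_triangle[of "hdiff (H z) (\<xi> z) (\<xi>' z)" z "hdiff (H z) (\<psi> z) (\<psi>' z)"] assms(1-4)
    by (simp add: add_diff_add closed sectionsD)
qed

lemma close_to_lipschitz:
  assumes c: "0 \<le> c" and close: "close_to e \<xi> \<xi>'"
    and le: "AE z in \<nu>. hnorm (H z) (hdiff (H z) (\<psi> z) (\<psi>' z)) \<le> c * hnorm (H z) (hdiff (H z) (\<xi> z) (\<xi>' z))"
    and sec: "\<psi> \<in> sections H" "\<psi>' \<in> sections H"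
  shows "close_to (c\<^sup>2 * e) \<psi> \<psi>'"
proof -
  obtain g where g: "integrable (completion \<nu>) g" "AE z in \<nu>. sdist2 \<xi> \<xi>' z \<le> g z" "integral\<^sup>L (completion \<nu>) g \<le> e"
    using close unfolding close_to_def by auto
  have "AE z in \<nu>. sdist2 \<psi> \<psi>' z \<le> c\<^sup>2 * g z"
    using g(2) le
  proof eventually_elim
    case (elim z)
    have "sdist2 \<psi> \<psi>' z \<le> (c * hnorm (H z) (hdiff (H z) (\<xi> z) (\<xi>' z)))\<^sup>2"
      by (rule power_mono[OF elim(2)]) (use sec in \<open>simp add: norm_nonneg closed sectionsD\<close>)
    also have "\<dots> \<le> c\<^sup>2 * g z"
      unfolding power_mult_distrib by (rule mult_left_mono[OF elim(1)]) simp
    finally show ?case .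
  qed
  then show ?thesis
    unfolding close_to_def using g c by (intro exI[of _ "\<lambda>z. c\<^sup>2 * g z"]) (simp add: mult_left_mono)
qed

lemma close_to_scale:
  assumes f: "AE z in \<nu>. cmod (f z) \<le> c" and sec: "\<xi> \<in> sections H" "\<xi>' \<in> sections H"
    and close: "close_to e \<xi> \<xi>'"
  shows "close_to (c\<^sup>2 * e) (\<lambda>z. hscale (H z) (f z) (\<xi> z)) (\<lambda>z. hscale (H z) (f z) (\<xi>' z))"
proof (rule close_to_lipschitz[OF _ close])
  \<comment> \<open>Since \<nu> has mass 1, a statement that holds almost everywhere and does not
    mention z is true.\<close>
  show "0 \<le> c"
  proof -
    have "AE z in \<nu>. 0 \<le> c" using f by eventually_elim (rule order_trans[OF norm_ge_zero])
    then show ?thesis by simp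
  qed
  show "AE z in \<nu>. hnorm (H z) (hdiff (H z) (hscale (H z) (f z) (\<xi> z)) (hscale (H z) (f z) (\<xi>' z)))
      \<le> c * hnorm (H z) (hdiff (H z) (\<xi> z) (\<xi>' z))"
    using f
  proof eventually_elim
    case (elim z)
    have "hdiff (H z) (hscale (H z) (f z) (\<xi> z)) (hscale (H z) (f z) (\<xi>' z))
        = hscale (H z) (f z) (hdiff (H z) (\<xi> z) (\<xi>' z))"
      using sec by (simp add: scale_diff sectionsD)
    then show ?case
      using sec elim by (simp add: norm_scale closed sectionsD mult_right_mono norm_nonneg)
  qed
qed (use sec in \<open>auto intro: sections_closed\<close>)

text \<open>Borel--Cantelli for the events \<open>g\<^sub>n(z) \<ge> 4\<^sup>-\<^sup>n\<close>, \<open>g\<^sub>n\<close> being the dominating functions.\<close>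

lemma close_to_fast:
  assumes close: "\<And>n. close_to ((1/8) ^ n) (X n) (Y n)"
    and sec: "\<And>n. X n \<in> sections H" "\<And>n. Y n \<in> sections H"
  shows "AE z in \<nu>. \<forall>\<^sub>F n in sequentially. hnorm (H z) (hdiff (H z) (X n z) (Y n z)) \<le> (1/2) ^ n"
proof -
  have "\<exists>g. \<forall>n. integrable (completion \<nu>) (g n) \<and> (AE z in \<nu>. sdist2 (X n) (Y n) z \<le> g n z) \<and>
      integral\<^sup>L (completion \<nu>) (g n) \<le> (1/8) ^ n"
    by (intro choice allI close[unfolded close_to_def])
  then obtain g where g: "\<And>n. integrable (completion \<nu>) (g n)"
    "\<And>n. AE z in \<nu>. sdist2 (X n) (Y n) z \<le> g n z" "\<And>n. integral\<^sup>L (completion \<nu>) (g n) \<le> (1/8) ^ n"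
    by blast
  let ?A = "\<lambda>n. {z \<in> space (completion \<nu>). (1/4) ^ n \<le> g n z}"
  have [measurable]: "g n \<in> borel_measurable (completion \<nu>)" for n using g(1) by auto
  \<comment> \<open>Markov's inequality at level 4^-n turns the integral bound 8^-n into the
    summable measure 2^-n, while below that level the distance itself is at most 2^-n.\<close>
  have meas: "measure (completion \<nu>) (?A n) \<le> (1/2) ^ n" for n
  proof -
    have "AE z in completion \<nu>. 0 \<le> g n z"
      using AE_completion[OF g(2)[of n]] by eventually_elim (rule order_trans[OF zero_le_power2])
    then have "measure (completion \<nu>) (?A n) \<le> integral\<^sup>L (completion \<nu>) (g n) / (1/4) ^ n"
      by (intro integral_Markov_inequality_measure[OF g(1) sets.top]) auto
    also have "\<dots> \<le> (1/8) ^ n / (1/4) ^ n" by (intro divide_right_mono g(3)) auto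
    also have "\<dots> = (1/2) ^ n" by (simp flip: power_divide)
    finally show ?thesis .
  qed
  have "AE z in completion \<nu>. \<forall>\<^sub>F n in sequentially. z \<in> space (completion \<nu>) - ?A n"
  proof (rule borel_cantelli_AE1)
    show "summable (\<lambda>n. measure (completion \<nu>) (?A n))"
      by (rule summable_comparison_test'[of "\<lambda>n. (1/2::real) ^ n" 0]) (use meas in auto)
    show "?A n \<in> sets (completion \<nu>)" for n by measurable
  qed (auto simp: compl.emeasure_eq_measure simp del: emeasure_completion)
  then have bc: "AE z in \<nu>. \<forall>\<^sub>F n in sequentially. z \<in> space (completion \<nu>) - ?A n"
    by (simp only: AE_completion_iff)
  have "AE z in \<nu>. \<forall>n. sdist2 (X n) (Y n) z \<le> g n z" using g(2) by (simp add: AE_all_countable)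
  with bc show ?thesis
  proof eventually_elim
    case (elim z)
    from elim(1) show ?case
    proof eventually_elim
      case (elim n)
      then have "g n z \<le> (1/4) ^ n" by auto
      then have "sdist2 (X n) (Y n) z \<le> ((1/2) ^ n)\<^sup>2"
        using \<open>\<forall>n. sdist2 (X n) (Y n) z \<le> g n z\<close>[rule_format, of n]
        by (simp add: power2_eq_square flip: power_mult_distrib)
      then show ?case by (rule power2_le_imp_le) simp
    qed
  qed
qed

lemma close_to_fast_tendsto:
  assumes "\<And>n. close_to ((1/8) ^ n) (X n) (Y n)" "\<And>n. X n \<in> sections H" "\<And>n. Y n \<in> sections H"
  shows "AE z in \<nu>. (\<lambda>n. hnorm (H z) (hdiff (H z) (X n z) (Y n z))) \<longlonglongrightarrow> 0"
  using close_to_fast[OF assms]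
proof eventually_elim
  case (elim z)
  have "(\<lambda>n. (1/2::real) ^ n) \<longlonglongrightarrow> 0" by (rule LIMSEQ_realpow_zero) auto
  moreover have "\<forall>\<^sub>F n in sequentially. norm (hnorm (H z) (hdiff (H z) (X n z) (Y n z))) \<le> (1/2) ^ n"
    using elim by eventually_elim (use assms(2,3) in \<open>simp add: norm_nonneg closed sectionsD\<close>)
  ultimately show ?case by (rule Lim_null_comparison[rotated])
qed

lemma close_to_section_dist:
  assumes "integrable (completion \<nu>) (sdist2 \<xi> \<psi>)"
  shows "close_to ((section_dist \<nu> H \<xi> \<psi>)\<^sup>2) \<xi> \<psi>"
proof -
  have "(section_dist \<nu> H \<xi> \<psi>)\<^sup>2 = integral\<^sup>L (completion \<nu>) (sdist2 \<xi> \<psi>)"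
    by (simp add: section_dist_def section_norm_def integral_nonneg_AE)
  then show ?thesis using assms by (auto simp: close_to_def)
qed

text \<open>Once the squared distance is measurable, domination makes it integrable, and the bound
  on the upper integral becomes one on \<open>section_dist\<close>.\<close>

lemma section_dist_le:
  assumes "sdist2 \<xi> \<psi> \<in> borel_measurable (completion \<nu>)" "close_to e \<xi> \<psi>"
  shows "integrable (completion \<nu>) (sdist2 \<xi> \<psi>)" "(section_dist \<nu> H \<xi> \<psi>)\<^sup>2 \<le> e"
proof -
  obtain g where g: "integrable (completion \<nu>) g" "AE z in \<nu>. sdist2 \<xi> \<psi> z \<le> g z" "integral\<^sup>L (completion \<nu>) g \<le> e"
    using assms(2) unfolding close_to_def by auto
  have ae: "AE z in completion \<nu>. sdist2 \<xi> \<psi> z \<le> g z" by (rule AE_completion[OF g(2)])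
  show int: "integrable (completion \<nu>) (sdist2 \<xi> \<psi>)"
    by (rule Bochner_Integration.integrable_bound[OF g(1) assms(1)])
      (use ae in eventually_elim, simp)
  have "(section_dist \<nu> H \<xi> \<psi>)\<^sup>2 = integral\<^sup>L (completion \<nu>) (sdist2 \<xi> \<psi>)"
    by (simp add: section_dist_def section_norm_def integral_nonneg_AE)
  also have "\<dots> \<le> integral\<^sup>L (completion \<nu>) g" by (rule integral_mono_AE[OF int g(1) ae])
  finally show "(section_dist \<nu> H \<xi> \<psi>)\<^sup>2 \<le> e" using g(3) by linarith
qed

lemma section_dist_nonneg: "0 \<le> section_dist \<nu> H \<xi> \<psi>"
  by (simp add: section_dist_def section_norm_def)

text \<open>A subsequence converges almost everywhere both to \<open>\<xi>\<close> and to the limit in the seminorm.\<close>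

lemma complete_section_space_limit:
  assumes \<Delta>: "complete_section_space \<nu> H \<Delta>"
    and X: "\<And>n. X n \<in> \<Delta>" and \<xi>: "\<xi> \<in> sections H"
    and close: "\<And>n. close_to ((1/8) ^ n) (X n) \<xi>"
  shows "\<xi> \<in> \<Delta>"
proof -
  have fam: "fundamental_family \<nu> H \<Delta>" and sub: "section_subspace H \<Delta>"
    using \<Delta> by (auto simp: complete_section_space_def fundamental_family_def)
  have sec: "\<psi> \<in> sections H" if "\<psi> \<in> \<Delta>" for \<psi> using sub that by (auto simp: section_subspace_def)
  have diff: "(\<lambda>z. hdiff (H z) (\<psi> z) (\<zeta> z)) \<in> \<Delta>" if "\<psi> \<in> \<Delta>" "\<zeta> \<in> \<Delta>" for \<psi> \<zeta>
    using sub that by (simp add: section_subspace_def hdiff_def)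
  have int: "integrable (completion \<nu>) (sdist2 \<psi> \<zeta>)" if "\<psi> \<in> \<Delta>" "\<zeta> \<in> \<Delta>" for \<psi> \<zeta>
  proof -
    have "\<forall>\<xi>\<in>\<Delta>. integrable (completion \<nu>) (\<lambda>z. (hnorm (H z) (\<xi> z))\<^sup>2)"
      using fam by (simp add: fundamental_family_def)
    from bspec[OF this diff[OF that]] show ?thesis .
  qed
  have le: "(section_dist \<nu> H \<psi> \<zeta>)\<^sup>2 \<le> e" if "\<psi> \<in> \<Delta>" "\<zeta> \<in> \<Delta>" "close_to e \<psi> \<zeta>" for \<psi> \<zeta> e
    by (rule section_dist_le(2)[OF borel_measurable_integrable[OF int[OF that(1,2)]] that(3)])
  have *: "\<exists>N. \<forall>i\<ge>N. \<forall>j\<ge>N. section_dist \<nu> H (X i) (X j) < e" if e: "0 < e" for e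
  proof -
    obtain N where N: "(1/8) ^ N < e\<^sup>2 / 8"
      using real_arch_pow_inv[of "e\<^sup>2 / 8" "1/8"] e by auto
    have "section_dist \<nu> H (X i) (X j) < e" if "i \<ge> N" "j \<ge> N" for i j
    proof -
      have pw: "(1/8::real) ^ i \<le> (1/8) ^ N" "(1/8::real) ^ j \<le> (1/8) ^ N"
        using that by (auto intro: power_decreasing)
      have "close_to (2 * (1/8) ^ i + 2 * (1/8) ^ j) (X i) (X j)"
        by (rule close_to_trans[OF sec[OF X] \<xi> sec[OF X] close close_to_commute[OF sec[OF X] \<xi> close]])
      then have "(section_dist \<nu> H (X i) (X j))\<^sup>2 \<le> 2 * (1/8) ^ i + 2 * (1/8) ^ j"
        by (rule le[OF X X])
      also have "\<dots> < e\<^sup>2" using pw N zero_less_power[OF e, of 2] by linarith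
      finally show ?thesis using e by (simp add: power2_less_imp_less)
    qed
    then show ?thesis by blast
  qed
  obtain \<psi> where \<psi>: "\<psi> \<in> \<Delta>" "(\<lambda>n. section_dist \<nu> H (X n) \<psi>) \<longlonglongrightarrow> 0"
  proof -
    have "\<forall>X. range X \<subseteq> \<Delta> \<and> (\<forall>e>0. \<exists>N. \<forall>i\<ge>N. \<forall>j\<ge>N. section_dist \<nu> H (X i) (X j) < e) \<longrightarrow>
        (\<exists>\<xi>\<in>\<Delta>. (\<lambda>n. section_dist \<nu> H (X n) \<xi>) \<longlonglongrightarrow> 0)"
      using \<Delta> by (simp add: complete_section_space_def)
    from spec[OF this, of X] show ?thesis using that * X by auto
  qed
  have "\<exists>k\<ge>n. section_dist \<nu> H (X k) \<psi> < sqrt ((1/8) ^ n)" for n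
  proof -
    have "\<forall>\<^sub>F k in sequentially. section_dist \<nu> H (X k) \<psi> < sqrt ((1/8) ^ n)"
      by (rule order_tendstoD(2)[OF \<psi>(2)]) simp
    then have "\<forall>\<^sub>F k in sequentially. k \<ge> n \<and> section_dist \<nu> H (X k) \<psi> < sqrt ((1/8) ^ n)"
      using eventually_ge_at_top by eventually_elim auto
    from eventually_happens'[OF sequentially_bot this] show ?thesis .
  qed
  then have "\<exists>r. \<forall>n. r n \<ge> n \<and> section_dist \<nu> H (X (r n)) \<psi> < sqrt ((1/8) ^ n)"
    by (intro choice allI)
  then obtain r where r: "\<And>n. r n \<ge> n" "\<And>n. section_dist \<nu> H (X (r n)) \<psi> < sqrt ((1/8) ^ n)"
    by blast
  have 1: "close_to ((1/8) ^ n) (X (r n)) \<psi>" for n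
  proof (rule close_to_mono[OF close_to_section_dist[OF int[OF X \<psi>(1)]]])
    have "(section_dist \<nu> H (X (r n)) \<psi>)\<^sup>2 \<le> (sqrt ((1/8) ^ n))\<^sup>2"
      by (rule power_mono[OF less_imp_le[OF r(2)] section_dist_nonneg])
    then show "(section_dist \<nu> H (X (r n)) \<psi>)\<^sup>2 \<le> (1/8) ^ n" by simp
  qed
  have 2: "close_to ((1/8) ^ n) (X (r n)) \<xi>" for n
    by (rule close_to_mono[OF close]) (use r(1) in \<open>simp add: power_decreasing\<close>)
  have "AE z in \<nu>. \<xi> z = \<psi> z"
    using close_to_fast_tendsto[of "\<lambda>n. X (r n)" "\<lambda>n. \<psi>", OF 1 sec[OF X] sec[OF \<psi>(1)]]
      close_to_fast_tendsto[of "\<lambda>n. X (r n)" "\<lambda>n. \<xi>", OF 2 sec[OF X] \<xi>]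
  proof eventually_elim
    case (elim z)
    have "(\<lambda>n. hnorm (H z) (hdiff (H z) (X (r n) z) (\<psi> z))) \<longlonglongrightarrow> hnorm (H z) (hdiff (H z) (\<xi> z) (\<psi> z))"
      by (rule limit_norm[OF sectionsD[OF sec[OF X]] sectionsD[OF \<xi>] sectionsD[OF sec[OF \<psi>(1)]] elim(2)])
    then have "hnorm (H z) (hdiff (H z) (\<xi> z) (\<psi> z)) = 0"
      using elim(1) by (rule LIMSEQ_unique)
    then show ?case
      using sec[OF \<psi>(1)] \<xi> diff_eq_zeroD[of "\<xi> z" z "\<psi> z"] by (simp add: norm_zero_iff closed sectionsD)
  qed
  moreover have "\<forall>\<xi>\<in>\<Delta>. \<forall>\<psi>\<in>sections H. (AE z in \<nu>. \<psi> z = \<xi> z) \<longrightarrow> \<psi> \<in> \<Delta>"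
    using \<Delta> by (simp add: complete_section_space_def)
  ultimately show ?thesis using \<psi>(1) \<xi> by blast
qed

end

text \<open>\<open>Linf_approx\<close> is a module property up to approximation. In the application
  \<Gamma> is a module over the continuous functions, and a product with a general bounded function
  may leave it.\<close>

locale module_family = hilbert_family \<nu> H for \<nu> :: "'z measure" and H :: "'z \<Rightarrow> 'a hspace" +
  fixes \<Gamma> :: "('z \<Rightarrow> 'a) set"
  assumes family: "fundamental_family \<nu> H \<Gamma>"
    and Linf_approx: "f \<in> Linf \<nu> \<Longrightarrow> \<gamma> \<in> \<Gamma> \<Longrightarrow> 0 < e \<Longrightarrow>
      \<exists>\<delta>\<in>\<Gamma>. close_to e (\<lambda>z. hscale (H z) (f z) (\<gamma> z)) \<delta>"
begin

text \<open>The mean square closure of \<Gamma> among all sections, with no measurability built in;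
  \<open>section_hull_eq\<close> identifies it with the intersection that defines the direct
  integral.\<close>

definition Hull :: "('z \<Rightarrow> 'a) set" where
  "Hull = {\<xi> \<in> sections H. \<forall>e>0. \<exists>\<gamma>\<in>\<Gamma>. close_to e \<xi> \<gamma>}"

lemma \<Gamma>_sections: "\<gamma> \<in> \<Gamma> \<Longrightarrow> \<gamma> \<in> sections H"
  using family by (auto simp: fundamental_family_def section_subspace_def)

lemma \<Gamma>_closed:
  "(\<lambda>z. hzero (H z)) \<in> \<Gamma>"
  "\<gamma> \<in> \<Gamma> \<Longrightarrow> \<delta> \<in> \<Gamma> \<Longrightarrow> (\<lambda>z. hadd (H z) (\<gamma> z) (\<delta> z)) \<in> \<Gamma>"
  "\<gamma> \<in> \<Gamma> \<Longrightarrow> (\<lambda>z. hscale (H z) c (\<gamma> z)) \<in> \<Gamma>"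
  using family by (auto simp: fundamental_family_def section_subspace_def)

lemma \<Gamma>_Hull: "\<gamma> \<in> \<Gamma> \<Longrightarrow> \<gamma> \<in> Hull"
  unfolding Hull_def
  by (auto intro!: bexI[of _ \<gamma>] close_to_mono[OF close_to_refl] \<Gamma>_sections)

lemma HullD:
  assumes "\<xi> \<in> Hull" "0 < e"
  obtains \<gamma> where "\<gamma> \<in> \<Gamma>" "close_to e \<xi> \<gamma>"
  using assms by (auto simp: Hull_def)

lemma Hull_sections: "\<xi> \<in> Hull \<Longrightarrow> \<xi> \<in> sections H"
  by (simp add: Hull_def)

lemma Hull_closed:
  "(\<lambda>z. hzero (H z)) \<in> Hull"
  "\<xi> \<in> Hull \<Longrightarrow> \<psi> \<in> Hull \<Longrightarrow> (\<lambda>z. hadd (H z) (\<xi> z) (\<psi> z)) \<in> Hull"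
  "f \<in> Linf \<nu> \<Longrightarrow> \<xi> \<in> Hull \<Longrightarrow> (\<lambda>z. hscale (H z) (f z) (\<xi> z)) \<in> Hull"
proof -
  show "(\<lambda>z. hzero (H z)) \<in> Hull" by (rule \<Gamma>_Hull[OF \<Gamma>_closed(1)])
  show "(\<lambda>z. hadd (H z) (\<xi> z) (\<psi> z)) \<in> Hull" if \<xi>: "\<xi> \<in> Hull" and \<psi>: "\<psi> \<in> Hull"
    unfolding Hull_def
  proof (intro CollectI conjI allI impI)
    fix e :: real assume "0 < e"
    then have "0 < e / 4" by simp
    then obtain \<gamma> \<delta> where *: "\<gamma> \<in> \<Gamma>" "close_to (e / 4) \<xi> \<gamma>" "\<delta> \<in> \<Gamma>" "close_to (e / 4) \<psi> \<delta>"
      by (metis HullD[OF \<xi>] HullD[OF \<psi>])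
    have "close_to (2 * (e / 4) + 2 * (e / 4)) (\<lambda>z. hadd (H z) (\<xi> z) (\<psi> z)) (\<lambda>z. hadd (H z) (\<gamma> z) (\<delta> z))"
      by (rule close_to_add) (use * Hull_sections \<xi> \<psi> \<Gamma>_sections in auto)
    then show "\<exists>\<gamma>\<in>\<Gamma>. close_to e (\<lambda>z. hadd (H z) (\<xi> z) (\<psi> z)) \<gamma>"
      using \<Gamma>_closed(2)[OF *(1,3)] by (intro bexI) auto
  qed (use \<xi> \<psi> in \<open>auto intro: sections_closed Hull_sections\<close>)
  show "(\<lambda>z. hscale (H z) (f z) (\<xi> z)) \<in> Hull" if f: "f \<in> Linf \<nu>" and \<xi>: "\<xi> \<in> Hull"
    unfolding Hull_def
  proof (intro CollectI conjI allI impI)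
    obtain c where c: "AE z in \<nu>. cmod (f z) \<le> c" using f by (auto simp: Linf_def)
    fix e :: real assume e: "0 < e"
    \<comment> \<open>Chosen so that c^2 d is at most e / 4; the two steps through f \<gamma> then
      add up to e after the factors 2.\<close>
    define d where "d = e / (4 * (c\<^sup>2 + 1))"
    have pos: "0 < c\<^sup>2 + 1" by (rule add_nonneg_pos) auto
    have d: "0 < d" "c\<^sup>2 * d \<le> e / 4"
      using e pos by (auto simp: d_def field_simps)
    from HullD[OF \<xi> d(1)] obtain \<gamma> where \<gamma>: "\<gamma> \<in> \<Gamma>" "close_to d \<xi> \<gamma>" .
    obtain \<delta> where \<delta>: "\<delta> \<in> \<Gamma>" "close_to (e / 4) (\<lambda>z. hscale (H z) (f z) (\<gamma> z)) \<delta>"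
      using Linf_approx[OF f \<gamma>(1), of "e / 4"] e by auto
    have "close_to (2 * (c\<^sup>2 * d) + 2 * (e / 4)) (\<lambda>z. hscale (H z) (f z) (\<xi> z)) \<delta>"
      by (rule close_to_trans[OF _ _ _ close_to_scale[OF c _ _ \<gamma>(2)] \<delta>(2)])
        (use \<xi> \<gamma> \<delta> in \<open>auto intro: sections_closed Hull_sections \<Gamma>_sections\<close>)
    then have "close_to e (\<lambda>z. hscale (H z) (f z) (\<xi> z)) \<delta>"
      by (rule close_to_mono) (use d(2) in linarith)
    with \<delta>(1) show "\<exists>\<gamma>\<in>\<Gamma>. close_to e (\<lambda>z. hscale (H z) (f z) (\<xi> z)) \<gamma>" by blast
  qed (use \<xi> in \<open>auto intro: sections_closed Hull_sections\<close>)
qed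

lemma const_Linf: "(\<lambda>z. c) \<in> Linf \<nu>"
  by (auto simp: Linf_def)

lemma Hull_diff: "\<xi> \<in> Hull \<Longrightarrow> \<psi> \<in> Hull \<Longrightarrow> (\<lambda>z. hdiff (H z) (\<xi> z) (\<psi> z)) \<in> Hull"
  unfolding hdiff_def by (intro Hull_closed const_Linf)

lemma Hull_fast_approx:
  assumes "\<xi> \<in> Hull"
  obtains \<gamma> where "\<And>n. \<gamma> n \<in> \<Gamma>" "\<And>n. close_to ((1/8) ^ n) (\<gamma> n) \<xi>"
proof -
  have "\<exists>\<gamma>. \<forall>n. \<gamma> n \<in> \<Gamma> \<and> close_to ((1/8) ^ n) (\<gamma> n) \<xi>"
  proof (intro choice allI)
    fix n :: nat
    have "0 < (1/8::real) ^ n" by simp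
    from HullD[OF assms this] obtain \<gamma> where \<gamma>: "\<gamma> \<in> \<Gamma>" "close_to ((1/8) ^ n) \<xi> \<gamma>" .
    from close_to_commute[OF Hull_sections[OF assms] \<Gamma>_sections[OF \<gamma>(1)] \<gamma>(2)] \<gamma>(1)
    show "\<exists>\<gamma>. \<gamma> \<in> \<Gamma> \<and> close_to ((1/8) ^ n) \<gamma> \<xi>" by blast
  qed
  then show ?thesis using that by blast
qed

text \<open>Members of \<Gamma> have measurable norms, being square roots of integrable functions.
  Approximants at rate 8^-n converge almost everywhere, and measurability passes to the
  limit.\<close>

lemma Hull_norm_measurable:
  assumes \<xi>: "\<xi> \<in> Hull"
  shows "(\<lambda>z. hnorm (H z) (\<xi> z)) \<in> borel_measurable (completion \<nu>)"
proof -
  obtain \<gamma> where \<gamma>: "\<And>n. \<gamma> n \<in> \<Gamma>" "\<And>n. close_to ((1/8) ^ n) (\<gamma> n) \<xi>"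
    using Hull_fast_approx[OF \<xi>] by blast
  have sec: "\<gamma> n \<in> sections H" "\<xi> \<in> sections H" for n using \<Gamma>_sections \<gamma>(1) Hull_sections[OF \<xi>] by auto
  show ?thesis
  proof (rule borel_measurable_completion_AE_LIMSEQ)
    show "(\<lambda>z. hnorm (H z) (\<gamma> n z)) \<in> borel_measurable (completion \<nu>)" for n
    proof -
      have "(\<lambda>z. (hnorm (H z) (\<gamma> n z))\<^sup>2) \<in> borel_measurable (completion \<nu>)"
        using family \<gamma>(1) by (auto simp: fundamental_family_def)
      then have "(\<lambda>z. sqrt ((hnorm (H z) (\<gamma> n z))\<^sup>2)) \<in> borel_measurable (completion \<nu>)"
        by measurable
      then show ?thesis using sec by (simp add: norm_nonneg sectionsD)
    qed
    show "AE z in \<nu>. (\<lambda>n. hnorm (H z) (\<gamma> n z)) \<longlonglongrightarrow> hnorm (H z) (\<xi> z)"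
      using close_to_fast_tendsto[OF \<gamma>(2) sec]
    proof eventually_elim
      case (elim z)
      from limit_norm[OF _ _ zero_closed elim] show ?case using sec by (simp add: sectionsD diff_zero)
    qed
  qed
qed

text \<open>The difference lies in \<open>Hull\<close>, which settles measurability. The chain from
  \<xi> through \<gamma> and \<delta> to \<psi> gives a finite upper integral, because \<gamma> -
  \<delta> belongs to \<Gamma>.\<close>

lemma Hull_integrable_diff:
  assumes \<xi>: "\<xi> \<in> Hull" and \<psi>: "\<psi> \<in> Hull"
  shows "integrable (completion \<nu>) (sdist2 \<xi> \<psi>)"
proof -
  have m: "sdist2 \<zeta> \<zeta>' \<in> borel_measurable (completion \<nu>)" if "\<zeta> \<in> Hull" "\<zeta>' \<in> Hull" for \<zeta> \<zeta>'
    by (rule borel_measurable_power[OF Hull_norm_measurable[OF Hull_diff[OF that]]])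
  from HullD[OF \<xi> zero_less_one] obtain \<gamma> where \<gamma>: "\<gamma> \<in> \<Gamma>" "close_to 1 \<xi> \<gamma>" .
  from HullD[OF \<psi> zero_less_one] obtain \<delta> where \<delta>: "\<delta> \<in> \<Gamma>" "close_to 1 \<psi> \<delta>" .
  note sec = \<Gamma>_sections[OF \<gamma>(1)] \<Gamma>_sections[OF \<delta>(1)] Hull_sections[OF \<xi>] Hull_sections[OF \<psi>]
  have "(\<lambda>z. hdiff (H z) (\<gamma> z) (\<delta> z)) \<in> \<Gamma>"
    unfolding hdiff_def by (intro \<Gamma>_closed \<gamma>(1) \<delta>(1))
  then have "integrable (completion \<nu>) (sdist2 \<gamma> \<delta>)"
    using family by (auto simp: fundamental_family_def)
  note close_to_trans[OF sec(1,2,4) close_to_section_dist[OF this] close_to_commute[OF sec(4,2) \<delta>(2)]]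
  from close_to_trans[OF sec(3,1,4) \<gamma>(2) this]
  show ?thesis by (rule section_dist_le(1)[OF m[OF \<xi> \<psi>]])
qed

lemma Hull_integrable:
  assumes "\<xi> \<in> Hull"
  shows "integrable (completion \<nu>) (\<lambda>z. (hnorm (H z) (\<xi> z))\<^sup>2)"
  using Hull_integrable_diff[OF assms Hull_closed(1)] Hull_sections[OF assms]
  by (simp add: diff_zero sectionsD)

text \<open>Within \<open>Hull\<close> upper integrals are integrals, so \<open>close_to\<close> and
  the seminorm can be exchanged freely from here on.\<close>

lemma close_to_Hull_iff:
  assumes "\<xi> \<in> Hull" "\<psi> \<in> Hull"
  shows "close_to e \<xi> \<psi> \<longleftrightarrow> (section_dist \<nu> H \<xi> \<psi>)\<^sup>2 \<le> e"
proof
  show "close_to e \<xi> \<psi> \<Longrightarrow> (section_dist \<nu> H \<xi> \<psi>)\<^sup>2 \<le> e"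
    by (rule section_dist_le(2)[OF borel_measurable_integrable[OF Hull_integrable_diff[OF assms]]])
  show "(section_dist \<nu> H \<xi> \<psi>)\<^sup>2 \<le> e \<Longrightarrow> close_to e \<xi> \<psi>"
    by (rule close_to_mono[OF close_to_section_dist[OF Hull_integrable_diff[OF assms]]])
qed

lemma Hull_AE:
  assumes \<xi>: "\<xi> \<in> Hull" and \<psi>: "\<psi> \<in> sections H" and eq: "AE z in \<nu>. \<psi> z = \<xi> z"
  shows "\<psi> \<in> Hull"
proof -
  have "close_to e \<psi> \<gamma>" if "close_to e \<xi> \<gamma>" for e \<gamma>
  proof -
    obtain g where g: "integrable (completion \<nu>) g" "AE z in \<nu>. sdist2 \<xi> \<gamma> z \<le> g z" "integral\<^sup>L (completion \<nu>) g \<le> e"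
      using \<open>close_to e \<xi> \<gamma>\<close> unfolding close_to_def by auto
    have "AE z in \<nu>. sdist2 \<psi> \<gamma> z \<le> g z" using g(2) eq by eventually_elim simp
    with g show ?thesis by (auto simp: close_to_def)
  qed
  then show ?thesis using \<xi> \<psi> unfolding Hull_def by blast
qed

text \<open>The Riesz-Fischer argument: a rapidly converging subsequence converges in almost every
  fibre, and Fatou's lemma bounds the distance to the fibrewise limit.\<close>

lemma Hull_complete:
  assumes X: "\<And>n. X n \<in> Hull"
    and Cauchy: "\<And>e. 0 < e \<Longrightarrow> \<exists>N. \<forall>i\<ge>N. \<forall>j\<ge>N. section_dist \<nu> H (X i) (X j) < e"
  shows "\<exists>\<xi>\<in>Hull. (\<lambda>n. section_dist \<nu> H (X n) \<xi>) \<longlonglongrightarrow> 0"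
proof -
  have sec: "X n \<in> sections H" for n using X Hull_sections by blast
  have "\<exists>N. \<forall>i\<ge>N. \<forall>j\<ge>N. close_to ((1/8) ^ n) (X i) (X j)" for n
  proof -
    obtain N where N: "\<And>i j. i \<ge> N \<Longrightarrow> j \<ge> N \<Longrightarrow> section_dist \<nu> H (X i) (X j) < sqrt ((1/8) ^ n)"
      using Cauchy[of "sqrt ((1/8) ^ n)"] by auto
    have "close_to ((1/8) ^ n) (X i) (X j)" if "i \<ge> N" "j \<ge> N" for i j
    proof -
      have "(section_dist \<nu> H (X i) (X j))\<^sup>2 \<le> (sqrt ((1/8) ^ n))\<^sup>2"
        by (rule power_mono[OF less_imp_le[OF N[OF that]] section_dist_nonneg])
      then show ?thesis by (simp add: close_to_Hull_iff[OF X X])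
    qed
    then show ?thesis by blast
  qed
  then have "\<exists>N. \<forall>n. \<forall>i\<ge>N n. \<forall>j\<ge>N n. close_to ((1/8) ^ n) (X i) (X j)"
    by (intro choice allI)
  then obtain N where N: "\<And>n i j. i \<ge> N n \<Longrightarrow> j \<ge> N n \<Longrightarrow> close_to ((1/8) ^ n) (X i) (X j)" by blast
  \<comment> \<open>The maximum over the initial segment ensures r n \<ge> N m for all m \<le> n, so
    one sequence of indices serves every accuracy 8^-m.\<close>
  define r where "r n = Max (N ` {..n})" for n
  have r: "r n \<ge> N m" if "m \<le> n" for m n unfolding r_def by (rule Max_ge) (use that in auto)
  have fast: "AE z in \<nu>. \<forall>\<^sub>F n in sequentially. hnorm (H z) (hdiff (H z) (X (r n) z) (X (r (Suc n)) z)) \<le> (1/2) ^ n"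
    by (rule close_to_fast[where X = "\<lambda>n. X (r n)" and Y = "\<lambda>n. X (r (Suc n))", OF N sec sec]) (auto intro: r)
  let ?lim = "\<lambda>z x. x \<in> hcarrier (H z) \<and> (\<lambda>n. hnorm (H z) (hdiff (H z) (X (r n) z) x)) \<longlonglongrightarrow> 0"
  \<comment> \<open>The fibrewise limit, with the zero vector on the null set where there is none. A
    choice without regard to measurability is harmless, since membership in \<open>Hull\<close> is
    decided by approximation.\<close>
  define \<xi> where "\<xi> z = (if \<exists>x. ?lim z x then SOME x. ?lim z x else hzero (H z))" for z
  have \<xi>: "\<xi> \<in> sections H"
    unfolding sections_def \<xi>_def using someI_ex[of "?lim _"] by (auto simp: zero_closed)
  have lim: "AE z in \<nu>. (\<lambda>n. hnorm (H z) (hdiff (H z) (X (r n) z) (\<xi> z))) \<longlonglongrightarrow> 0"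
    using fast
  proof eventually_elim
    case (elim z)
    have "\<exists>x. ?lim z x"
      using geometric_Cauchy[of "\<lambda>n. X (r n) z", OF _ elim] sec by (auto simp: sectionsD)
    from someI_ex[OF this] this show ?case by (simp add: \<xi>_def)
  qed
  have close: "close_to ((1/8) ^ n) (X (r n)) \<xi>" for n
  proof -
    have lim2: "AE z in \<nu>. (\<lambda>m. sdist2 (X (r n)) (X (r m)) z) \<longlonglongrightarrow> sdist2 (X (r n)) \<xi> z"
      using lim
    proof eventually_elim
      case (elim z)
      have "(\<lambda>m. hnorm (H z) (hdiff (H z) (X (r m) z) (X (r n) z)))
          \<longlonglongrightarrow> hnorm (H z) (hdiff (H z) (\<xi> z) (X (r n) z))"
        by (rule limit_norm[OF _ _ _ elim]) (use sec \<xi> in \<open>auto simp: sectionsD\<close>)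
      then have "(\<lambda>m. hnorm (H z) (hdiff (H z) (X (r n) z) (X (r m) z)))
          \<longlonglongrightarrow> hnorm (H z) (hdiff (H z) (X (r n) z) (\<xi> z))"
        using sec \<xi> by (simp add: dist_commute[of "X (r n) z"] sectionsD)
      then show ?case by (intro tendsto_power)
    qed
    have int: "integrable (completion \<nu>) (sdist2 (X (r n)) (X (r m)))" for m
      by (rule Hull_integrable_diff[OF X X])
    have meas: "sdist2 (X (r n)) \<xi> \<in> borel_measurable (completion \<nu>)"
      by (rule borel_measurable_completion_AE_LIMSEQ[OF borel_measurable_integrable[OF int] lim2])
    have bound: "integral\<^sup>L (completion \<nu>) (sdist2 (X (r n)) (X (r m))) \<le> (1/8) ^ n" if "m \<ge> n" for m
    proof -
      have "close_to ((1/8) ^ n) (X (r n)) (X (r m))" by (rule N) (use that in \<open>auto intro: r\<close>)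
      then have "(section_dist \<nu> H (X (r n)) (X (r m)))\<^sup>2 \<le> (1/8) ^ n"
        by (simp add: close_to_Hull_iff[OF X X])
      then show ?thesis by (simp add: section_dist_def section_norm_def integral_nonneg_AE)
    qed
    have nn: "(\<integral>\<^sup>+z. ennreal (sdist2 (X (r n)) \<xi> z) \<partial>completion \<nu>) \<le> ennreal ((1/8) ^ n)"
    proof -
      have "(\<integral>\<^sup>+z. ennreal (sdist2 (X (r n)) \<xi> z) \<partial>completion \<nu>)
          = (\<integral>\<^sup>+z. liminf (\<lambda>m. ennreal (sdist2 (X (r n)) (X (r m)) z)) \<partial>completion \<nu>)"
      proof (rule nn_integral_cong_AE)
        show "AE z in completion \<nu>. ennreal (sdist2 (X (r n)) \<xi> z)
            = liminf (\<lambda>m. ennreal (sdist2 (X (r n)) (X (r m)) z))"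
          using AE_completion[OF lim2]
          by eventually_elim (rule lim_imp_Liminf[OF _ tendsto_ennrealI, symmetric], simp)
      qed
      \<comment> \<open>Fatou's lemma; the integrals on the right are at most 8^-n for every m \<ge>
        n.\<close>
      also have "\<dots> \<le> liminf (\<lambda>m. \<integral>\<^sup>+z. ennreal (sdist2 (X (r n)) (X (r m)) z) \<partial>completion \<nu>)"
        by (rule nn_integral_liminf) (use int in \<open>auto intro: borel_measurable_integrable\<close>)
      also have "\<dots> \<le> liminf (\<lambda>m. ennreal ((1/8) ^ n))"
      proof (rule Liminf_mono)
        show "\<forall>\<^sub>F m in sequentially. (\<integral>\<^sup>+z. ennreal (sdist2 (X (r n)) (X (r m)) z) \<partial>completion \<nu>)
            \<le> ennreal ((1/8) ^ n)"
          using eventually_ge_at_top[of n]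
          by eventually_elim (subst nn_integral_eq_integral[OF int], auto intro: bound ennreal_leI)
      qed
      also have "\<dots> = ennreal ((1/8) ^ n)" by (rule Liminf_const) simp
      finally show ?thesis .
    qed
    have int\<xi>: "integrable (completion \<nu>) (sdist2 (X (r n)) \<xi>)"
      by (rule integrableI_nonneg[OF meas]) (use le_less_trans[OF nn ennreal_less_top] in auto)
    have "integral\<^sup>L (completion \<nu>) (sdist2 (X (r n)) \<xi>) \<le> (1/8) ^ n"
      using nn nn_integral_eq_integral[OF int\<xi>] by simp
    with int\<xi> show ?thesis by (auto simp: close_to_def)
  qed
  have \<xi>Hull: "\<xi> \<in> Hull"
    unfolding Hull_def
  proof (intro CollectI conjI \<xi> allI impI)
    fix e :: real assume e: "0 < e"
    then obtain n where n: "(1/8) ^ n < e / 4" using real_arch_pow_inv[of "e/4" "1/8"] by auto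
    have "0 < e / 4" using e by simp
    from HullD[OF X this] obtain \<gamma> where \<gamma>: "\<gamma> \<in> \<Gamma>" "close_to (e / 4) (X (r n)) \<gamma>" .
    have "close_to (2 * (1/8) ^ n + 2 * (e / 4)) \<xi> \<gamma>"
      by (rule close_to_trans[OF \<xi> sec \<Gamma>_sections[OF \<gamma>(1)] close_to_commute[OF sec \<xi> close] \<gamma>(2)])
    then have "close_to e \<xi> \<gamma>" by (rule close_to_mono) (use n in linarith)
    with \<gamma>(1) show "\<exists>\<gamma>\<in>\<Gamma>. close_to e \<xi> \<gamma>" by blast
  qed
  have "(\<lambda>n. section_dist \<nu> H (X n) \<xi>) \<longlonglongrightarrow> 0"
  proof (rule LIMSEQ_I)
    fix e :: real assume e: "0 < e"
    obtain n where n: "(1/8) ^ n < e\<^sup>2 / 8" using real_arch_pow_inv[of "e\<^sup>2/8" "1/8"] e by auto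
    have "norm (section_dist \<nu> H (X k) \<xi> - 0) < e" if "k \<ge> N n" for k
    proof -
      have "close_to (2 * (1/8) ^ n + 2 * (1/8) ^ n) (X k) \<xi>"
        by (rule close_to_trans[OF sec sec \<xi> N[OF that r[OF order_refl]] close])
      then have "(section_dist \<nu> H (X k) \<xi>)\<^sup>2 \<le> 2 * (1/8) ^ n + 2 * (1/8) ^ n"
        by (simp add: close_to_Hull_iff[OF X \<xi>Hull])
      also have "\<dots> < e\<^sup>2" using n zero_less_power[OF e, of 2] by linarith
      finally show ?thesis using e section_dist_nonneg by (simp add: power2_less_imp_less)
    qed
    then show "\<exists>n. \<forall>k\<ge>n. norm (section_dist \<nu> H (X k) \<xi> - 0) < e" by blast
  qed
  with \<xi>Hull show ?thesis by blast
qed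

lemma complete_section_space_Hull: "complete_section_space \<nu> H Hull"
  unfolding complete_section_space_def
proof (intro conjI allI ballI impI)
  show "fundamental_family \<nu> H Hull"
    unfolding fundamental_family_def section_subspace_def
    by (intro conjI allI ballI subsetI Hull_sections Hull_closed const_Linf Hull_integrable)
next
  fix X :: "nat \<Rightarrow> 'z \<Rightarrow> 'a"
  assume *: "range X \<subseteq> Hull \<and> (\<forall>e>0. \<exists>N. \<forall>i\<ge>N. \<forall>j\<ge>N. section_dist \<nu> H (X i) (X j) < e)"
  show "\<exists>\<xi>\<in>Hull. (\<lambda>n. section_dist \<nu> H (X n) \<xi>) \<longlonglongrightarrow> 0"
    by (rule Hull_complete) (use * in auto)
qed (auto intro: Hull_AE Hull_closed)

theorem section_hull_eq: "section_hull \<nu> H \<Gamma> = Hull"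
proof
  show "section_hull \<nu> H \<Gamma> \<subseteq> Hull"
    unfolding section_hull_def using complete_section_space_Hull \<Gamma>_Hull by blast
  show "Hull \<subseteq> section_hull \<nu> H \<Gamma>"
    unfolding section_hull_def
  proof (intro Inter_greatest subsetI)
    fix \<Delta> \<xi> assume \<Delta>: "\<Delta> \<in> {\<Delta>. \<Gamma> \<subseteq> \<Delta> \<and> complete_section_space \<nu> H \<Delta>}" and \<xi>: "\<xi> \<in> Hull"
    obtain \<gamma> where \<gamma>: "\<And>n. \<gamma> n \<in> \<Gamma>" "\<And>n. close_to ((1/8) ^ n) (\<gamma> n) \<xi>"
      using Hull_fast_approx[OF \<xi>] by blast
    show "\<xi> \<in> \<Delta>"
      by (rule complete_section_space_limit[OF _ _ Hull_sections[OF \<xi>] \<gamma>(2)]) (use \<Delta> \<gamma>(1) in auto)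
  qed
qed

end

section \<open>Density of the continuous functions\<close>

text \<open>A compact Hausdorff space is normal, and Urysohn's lemma separates K from the complement
  of G.\<close>

lemma Urysohn_compact:
  fixes K G :: "'z::t2_space set"
  assumes "compact (UNIV :: 'z set)" "closed K" "open G" "K \<subseteq> G"
  shows "\<exists>h :: 'z \<Rightarrow> real. continuous_on UNIV h \<and> (\<forall>z. 0 \<le> h z \<and> h z \<le> 1) \<and>
    (\<forall>z\<in>K. h z = 1) \<and> (\<forall>z. z \<notin> G \<longrightarrow> h z = 0)"
proof -
  have "Hausdorff_space (euclidean :: 'z topology)"
    unfolding Hausdorff_space_def using hausdorff by (auto simp: disjnt_def)
  then have norm: "normal_space (euclidean :: 'z topology)"
    using assms(1) by (intro compact_Hausdorff_or_regular_imp_normal_space) (auto simp: compact_space_def)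
  have "disjnt (- G) K" using assms(4) by (auto simp: disjnt_def)
  then obtain h where h: "continuous_map euclidean (top_of_set {0..1::real}) h" "h ` (- G) \<subseteq> {0}" "h ` K \<subseteq> {1}"
    using Urysohn_lemma[OF norm, of "- G" K 0 1] assms(2,3) by auto
  have "continuous_on UNIV h" "\<forall>z. 0 \<le> h z \<and> h z \<le> 1"
    using h(1) by (auto simp: continuous_map_in_subtopology image_subset_iff)
  with h(2,3) show ?thesis by (intro exI[of _ h]) auto
qed

lemma continuous_on_compact_integrable:
  fixes h :: "'z::topological_space \<Rightarrow> complex"
  assumes "finite_measure M" "sets M = sets borel" "compact (UNIV :: 'z set)" "continuous_on UNIV h"
  shows "integrable (completion M) h"
proof -
  interpret finite_measure M by fact
  have m: "h \<in> borel_measurable M"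
    unfolding measurable_cong_sets[OF assms(2) refl] by (rule borel_measurable_continuous_onI[OF assms(4)])
  have "bounded (range h)"
    by (rule compact_imp_bounded[OF compact_continuous_image[OF assms(4,3)]])
  then obtain B where "\<And>z. norm (h z) \<le> B" by (auto simp: bounded_iff)
  then have "integrable M h" by (intro integrable_const_bound[where B = B] m) auto
  then show ?thesis using integrable_completion[OF m] by simp
qed

text \<open>Induction over integrable functions. For indicators, regularity encloses the set between
  a compact and an open one, and a Urysohn function between them is close in mean.\<close>

lemma continuous_dense_integrable:
  fixes \<nu> :: "'z::t2_space measure" and f :: "'z \<Rightarrow> complex"
  assumes compact: "compact (UNIV :: 'z set)" and fin: "finite_measure \<nu>" and regular: "regular_borel \<nu>"
    and f: "integrable (completion \<nu>) f" and e: "0 < e"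
  shows "\<exists>h. continuous_on UNIV h \<and> (LINT z|completion \<nu>. norm (f z - h z)) < e"
  using f e
proof (induction f arbitrary: e)
  interpret finite_measure \<nu> by fact
  have sets: "sets \<nu> = sets borel" using regular by (simp add: regular_borel_def)
  have cint: "integrable (completion \<nu>) h" if "continuous_on UNIV h" for h :: "'z \<Rightarrow> complex"
    by (rule continuous_on_compact_integrable[OF fin sets compact that])
  {
    case (base A c)
    \<comment> \<open>Regularity speaks of sets measurable for \<nu>, while A is measurable for the
      completion; its main part differs from it by a null set.\<close>
    define S where "S = main_part \<nu> A"
    have S: "S \<in> sets \<nu>" using base(1) by (simp add: S_def)
    have AS: "AE z in completion \<nu>. z \<in> S \<longleftrightarrow> z \<in> A"
      unfolding S_def by (rule AE_completion[OF AE_in_main_part[OF base(1)]])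
    \<comment> \<open>Inner and outer approximation cost d each, so G - K has measure below 2 d and
      the error is at most 2 d |c|, which is below e.\<close>
    define d where "d = e / (2 * (cmod c + 1))"
    have d: "0 < d" using base(3) by (simp add: d_def add_nonneg_pos)
    have S_fin: "emeasure \<nu> S \<noteq> \<infinity>" by simp
    have "\<forall>S\<in>sets \<nu>.
        emeasure \<nu> S = (SUP C\<in>{C. C \<in> sets \<nu> \<and> compact C \<and> C \<subseteq> S}. emeasure \<nu> C) \<and>
        emeasure \<nu> S = (INF G\<in>{G. open G \<and> S \<subseteq> G}. emeasure \<nu> G)"
      using regular unfolding regular_borel_def by (rule conjunct2)
    note reg = bspec[OF this S]
    have ne: "{C. C \<in> sets \<nu> \<and> compact C \<and> C \<subseteq> S} \<noteq> {}" using compact_empty by blast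
    have "\<exists>K\<in>{C. C \<in> sets \<nu> \<and> compact C \<and> C \<subseteq> S}. emeasure \<nu> S < emeasure \<nu> K + ennreal d"
      by (rule SUP_approx_ennreal[OF d ne conjunct1[OF reg] S_fin])
    then obtain K where K: "K \<in> sets \<nu>" "compact K" "K \<subseteq> S" "emeasure \<nu> S < emeasure \<nu> K + ennreal d" by auto
    have "\<exists>G\<in>{G. open G \<and> S \<subseteq> G}. emeasure \<nu> G < emeasure \<nu> S + ennreal d"
      by (rule INF_approx_ennreal[OF d conjunct2[OF reg] S_fin])
    then obtain G where G: "open G" "S \<subseteq> G" "emeasure \<nu> G < emeasure \<nu> S + ennreal d" by auto
    have Gs: "G \<in> sets \<nu>" using G(1) sets by simp
    have "measure \<nu> S < measure \<nu> K + d" "measure \<nu> G < measure \<nu> S + d"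
      using K(4) G(3) d by (simp_all add: emeasure_eq_measure ennreal_less_iff flip: ennreal_plus)
    then have GK: "measure \<nu> (G - K) < 2 * d"
      using finite_measure_Diff[OF Gs K(1)] K(3) G(2) by auto
    have "K \<subseteq> G" using K(3) G(2) by blast
    from Urysohn_compact[OF compact compact_imp_closed[OF K(2)] G(1) this]
    obtain h :: "'z \<Rightarrow> real" where h: "continuous_on UNIV h" "\<And>z. 0 \<le> h z \<and> h z \<le> 1"
      "\<And>z. z \<in> K \<Longrightarrow> h z = 1" "\<And>z. z \<notin> G \<Longrightarrow> h z = 0"
      by blast
    have hc: "continuous_on UNIV (\<lambda>z. h z *\<^sub>R c)" by (intro continuous_intros h(1))
    have "integrable (completion \<nu>) (\<lambda>z. indicator A z *\<^sub>R c)"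
      using base(1) by (intro integrable_scaleR_left) (auto simp: less_top[symmetric] emeasure_completion)
    then have int: "integrable (completion \<nu>) (\<lambda>z. norm (indicator A z *\<^sub>R c - h z *\<^sub>R c))"
      using cint[OF hc] by auto
    have int2: "integrable (completion \<nu>) (\<lambda>z. indicator (G - K) z * cmod c)"
      using Gs K(1) by (intro integrable_mult_left integrable_real_indicator) (auto simp: less_top[symmetric])
    have "(LINT z|completion \<nu>. norm (indicator A z *\<^sub>R c - h z *\<^sub>R c))
        \<le> (LINT z|completion \<nu>. indicator (G - K) z * cmod c)"
    proof (rule integral_mono_AE[OF int int2])
      show "AE z in completion \<nu>. norm (indicator A z *\<^sub>R c - h z *\<^sub>R c) \<le> indicator (G - K) z * cmod c"
        using AS
      proof eventually_elim
        case (elim z)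
        have "\<bar>indicator A z - h z\<bar> \<le> indicator (G - K) z"
          using elim h(2-4)[of z] K(3) G(2) by (auto simp: indicator_def)
        then show ?case by (simp add: mult_right_mono flip: scaleR_diff_left)
      qed
    qed
    also have "\<dots> = measure \<nu> (G - K) * cmod c" using Gs K(1) by simp
    also have "\<dots> \<le> 2 * d * cmod c" using GK by (intro mult_right_mono) auto
    also have "\<dots> < 2 * d * (cmod c + 1)" using d by simp
    also have "\<dots> = e"
    proof -
      have "cmod c + 1 \<noteq> 0" using norm_ge_zero[of c] by linarith
      then show ?thesis unfolding d_def by (simp add: field_split_simps)
    qed
    finally show ?case using hc by blast
  next
    case (add f g)
    have e2: "0 < e / 2" using add.prems by simp
    obtain h where h: "continuous_on UNIV h" "(LINT z|completion \<nu>. norm (f z - h z)) < e / 2"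
      using add.IH(1)[OF e2] by blast
    obtain k where k: "continuous_on UNIV k" "(LINT z|completion \<nu>. norm (g z - k z)) < e / 2"
      using add.IH(2)[OF e2] by blast
    have i: "integrable (completion \<nu>) (\<lambda>z. norm (f z - h z))" "integrable (completion \<nu>) (\<lambda>z. norm (g z - k z))"
      using add.hyps cint[OF h(1)] cint[OF k(1)] by auto
    have "integrable (completion \<nu>) (\<lambda>z. norm ((f z + g z) - (h z + k z)))"
      using add.hyps cint[OF h(1)] cint[OF k(1)] by auto
    then have "(LINT z|completion \<nu>. norm ((f z + g z) - (h z + k z)))
        \<le> (LINT z|completion \<nu>. norm (f z - h z) + norm (g z - k z))"
      by (intro integral_mono) (use i in \<open>auto intro: norm_diff_triangle_ineq\<close>)
    also have "\<dots> < e" using h(2) k(2) i by simp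
    finally show ?case using continuous_on_add[OF h(1) k(1)] by blast
  next
    case (lim f s)
    have "(\<lambda>i. LINT z|completion \<nu>. norm (s i z - f z)) \<longlonglongrightarrow> (LINT z|completion \<nu>. norm (f z - f z))"
    \<comment> \<open>The simple functions are bounded by 2 |f|, hence their distances to f by 3
      |f|.\<close>
    proof (rule integral_dominated_convergence[where w = "\<lambda>z. 3 * norm (f z)"])
      show "AE z in completion \<nu>. (\<lambda>i. norm (s i z - f z)) \<longlonglongrightarrow> norm (f z - f z)"
        using lim.hyps(2) by (intro AE_I2 tendsto_intros) auto
      show "AE z in completion \<nu>. norm (norm (s i z - f z)) \<le> 3 * norm (f z)" for i
      proof (rule AE_I2)
        fix z assume "z \<in> space (completion \<nu>)"
        from lim.hyps(3)[OF this, of i] norm_triangle_ineq4[of "s i z" "f z"]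
        show "norm (norm (s i z - f z)) \<le> 3 * norm (f z)" by simp
      qed
    qed (use lim.hyps(1,4) in auto)
    then have "(\<lambda>i. LINT z|completion \<nu>. norm (s i z - f z)) \<longlonglongrightarrow> 0" by simp
    then have "\<forall>\<^sub>F i in sequentially. (LINT z|completion \<nu>. norm (s i z - f z)) < e / 2"
      by (rule order_tendstoD(2)) (use lim.prems in simp)
    then obtain i where i: "(LINT z|completion \<nu>. norm (s i z - f z)) < e / 2"
      by (auto simp: eventually_sequentially)
    obtain h where h: "continuous_on UNIV h" "(LINT z|completion \<nu>. norm (s i z - h z)) < e / 2"
      using lim.IH[of "e/2" i] lim.prems by auto
    have n: "integrable (completion \<nu>) (\<lambda>z. norm (s i z - h z))" "integrable (completion \<nu>) (\<lambda>z. norm (s i z - f z))"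
      "integrable (completion \<nu>) (\<lambda>z. norm (f z - h z))"
      using lim.hyps(1,4) cint[OF h(1)] by auto
    have "norm (f z - h z) \<le> norm (s i z - f z) + norm (s i z - h z)" for z
      using norm_triangle_ineq4[of "s i z - h z" "s i z - f z"] by simp
    then have "(LINT z|completion \<nu>. norm (f z - h z))
        \<le> (LINT z|completion \<nu>. norm (s i z - f z) + norm (s i z - h z))"
      by (intro integral_mono) (use n in auto)
    also have "\<dots> < e" using i h(2) n by simp
    finally show ?case using h(1) by blast
  }
qed

text \<open>Approximation in mean becomes approximation in mean square once both functions take
  values in a ball of radius c: the squared distance is then at most 2 c times the distance.\<close>

lemma continuous_dense_Linf:
  fixes \<nu> :: "'z::t2_space measure"
  assumes compact: "compact (UNIV :: 'z set)" and fin: "finite_measure \<nu>" and regular: "regular_borel \<nu>"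
    and f: "f \<in> Linf \<nu>" and e: "0 < e"
  shows "\<exists>h. continuous_on UNIV h \<and> (\<exists>g. integrable (completion \<nu>) g \<and>
    (AE z in \<nu>. (cmod (f z - h z))\<^sup>2 \<le> g z) \<and> integral\<^sup>L (completion \<nu>) g \<le> e)"
proof -
  interpret finite_measure \<nu> by fact
  interpret compl: finite_measure "completion \<nu>"
    by (rule finite_measureI) (simp add: emeasure_completion)
  have sets: "sets \<nu> = sets borel" using regular by (simp add: regular_borel_def)
  obtain c0 where c0: "AE z in \<nu>. cmod (f z) \<le> c0" using f by (auto simp: Linf_def)
  define c where "c = max 1 c0"
  have c: "0 < c" "AE z in \<nu>. cmod (f z) \<le> c"
    unfolding c_def by simp (use c0 in eventually_elim, simp)
  \<comment> \<open>A representative of f that satisfies the bound everywhere.\<close>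
  define f' where "f' z = (if cmod (f z) \<le> c then f z else 0)" for z
  have [measurable]: "f \<in> borel_measurable (completion \<nu>)" using f by (simp add: Linf_def)
  have f'm: "f' \<in> borel_measurable (completion \<nu>)" unfolding f'_def by measurable
  have f'c: "cmod (f' z) \<le> c" for z using c(1) by (simp add: f'_def)
  have f'int: "integrable (completion \<nu>) f'"
    by (rule compl.integrable_const_bound[where B = c, OF _ f'm]) (simp add: f'c)
  have "0 < e / (2 * c)" using e c(1) by simp
  from continuous_dense_integrable[OF compact fin regular f'int this]
  obtain h where h: "continuous_on UNIV h" "(LINT z|completion \<nu>. norm (f' z - h z)) < e / (2 * c)" by blast
  \<comment> \<open>The nearest point projection is a contraction that fixes the values of f', so
    truncating h with it keeps continuity and does not increase the distance to f'.\<close>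
  define p where "p = closest_point (cball 0 c :: complex set)"
  have ball: "convex (cball 0 c :: complex set)" "closed (cball 0 c :: complex set)" "cball 0 c \<noteq> ({} :: complex set)"
    using c(1) by auto
  have p_in: "cmod (p x) \<le> c" for x
    using closest_point_in_set[OF ball(2,3), of x] by (simp add: p_def)
  have p_self: "p x = x" if "cmod x \<le> c" for x
    unfolding p_def by (rule closest_point_self) (use that in simp)
  have pf: "cmod (f' z - p (h z)) \<le> cmod (f' z - h z)" for z
    using closest_point_lipschitz[OF ball, of "f' z" "h z"] by (simp add: p_self[OF f'c] dist_norm flip: p_def)
  have sq: "(cmod (f' z - p (h z)))\<^sup>2 \<le> 2 * c * cmod (f' z - h z)" for z
  proof -
    have "cmod (f' z - p (h z)) \<le> 2 * c"
      using norm_triangle_ineq4[of "f' z" "p (h z)"] f'c[of z] p_in[of "h z"] by simp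
    then show ?thesis unfolding power2_eq_square by (intro mult_mono pf) (use c(1) in auto)
  qed
  have "continuous_on UNIV (\<lambda>z. p (h z))"
    unfolding p_def using continuous_on_compose2[OF continuous_on_closest_point[OF ball] h(1)] by auto
  moreover have "AE z in \<nu>. (cmod (f z - p (h z)))\<^sup>2 \<le> 2 * c * cmod (f' z - h z)"
    using c(2)
  proof eventually_elim
    case (elim z)
    then show ?case using sq[of z] by (simp add: f'_def)
  qed
  moreover have "integrable (completion \<nu>) (\<lambda>z. 2 * c * cmod (f' z - h z))"
    using f'int continuous_on_compact_integrable[OF fin sets compact h(1)] by auto
  moreover have "(LINT z|completion \<nu>. 2 * c * cmod (f' z - h z)) \<le> e"
    using h(2) c(1) by (simp add: field_simps)
  ultimately show ?thesis by (intro exI[of _ "\<lambda>z. p (h z)"]) blast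
qed

section \<open>The direct integral as a Hilbert space\<close>

context module_family begin

abbreviation "DI \<equiv> direct_integral \<nu> H \<Gamma>"
abbreviation "cls \<equiv> section_class \<nu> H \<Gamma>"

lemma section_dist_zero_iff:
  assumes "\<xi> \<in> Hull" "\<psi> \<in> Hull"
  shows "section_dist \<nu> H \<xi> \<psi> = 0 \<longleftrightarrow> (AE z in \<nu>. \<xi> z = \<psi> z)"
proof -
  have "section_dist \<nu> H \<xi> \<psi> = 0 \<longleftrightarrow> integral\<^sup>L (completion \<nu>) (sdist2 \<xi> \<psi>) = 0"
    by (simp add: section_dist_def section_norm_def)
  also have "\<dots> \<longleftrightarrow> (AE z in completion \<nu>. sdist2 \<xi> \<psi> z = 0)"
    by (rule integral_nonneg_eq_0_iff_AE[OF Hull_integrable_diff[OF assms]]) simp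
  also have "\<dots> \<longleftrightarrow> (AE z in \<nu>. sdist2 \<xi> \<psi> z = 0)" by (rule AE_completion_iff)
  also have "(\<lambda>z. sdist2 \<xi> \<psi> z = 0) = (\<lambda>z. \<xi> z = \<psi> z)"
  proof
    fix z
    have in_C: "\<xi> z \<in> hcarrier (H z)" "\<psi> z \<in> hcarrier (H z)"
      using sectionsD[OF Hull_sections[OF assms(1)]] sectionsD[OF Hull_sections[OF assms(2)]] by auto
    show "(sdist2 \<xi> \<psi> z = 0) = (\<xi> z = \<psi> z)"
      using in_C diff_eq_zeroD[OF in_C] by (auto simp: norm_zero_iff closed diff_self)
  qed
  finally show ?thesis .
qed

lemma cls_eq: "\<xi> \<in> Hull \<Longrightarrow> cls \<xi> = {\<psi> \<in> Hull. AE z in \<nu>. \<psi> z = \<xi> z}"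
  unfolding section_class_def section_hull_eq using section_dist_zero_iff by auto

lemma cls_eqI:
  assumes "\<xi> \<in> Hull" "\<psi> \<in> Hull" "AE z in \<nu>. \<xi> z = \<psi> z"
  shows "cls \<xi> = cls \<psi>"
proof -
  have "(AE z in \<nu>. \<phi> z = \<xi> z) \<longleftrightarrow> (AE z in \<nu>. \<phi> z = \<psi> z)" for \<phi> :: "'z \<Rightarrow> 'a"
    by (rule eventually_cong[OF assms(3)]) auto
  then show ?thesis using assms by (simp add: cls_eq)
qed

text \<open>\<open>direct_integral\<close> computes with chosen representatives. They agree with any
  given one off a null set, which is why its operations can be evaluated on arbitrary
  representatives.\<close>

lemma section_rep_cls:
  assumes "\<xi> \<in> Hull"
  shows "section_rep (cls \<xi>) \<in> Hull" "AE z in \<nu>. section_rep (cls \<xi>) z = \<xi> z"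
proof -
  have "section_rep (cls \<xi>) \<in> cls \<xi>"
    unfolding section_rep_def by (rule someI[of _ \<xi>]) (simp add: cls_eq assms)
  then show "section_rep (cls \<xi>) \<in> Hull" "AE z in \<nu>. section_rep (cls \<xi>) z = \<xi> z"
    using assms by (auto simp: cls_eq)
qed

lemma DI_carrier: "hcarrier DI = cls ` Hull"
  by (simp add: direct_integral_def section_hull_eq)

lemma DI_carrierE:
  assumes "X \<in> hcarrier DI"
  obtains \<xi> where "\<xi> \<in> Hull" "\<forall>z. \<xi> z \<in> hcarrier (H z)" "X = cls \<xi>"
proof -
  obtain \<xi> where \<xi>: "\<xi> \<in> Hull" "X = cls \<xi>" using assms by (auto simp: DI_carrier)
  show thesis by (rule that[OF \<xi>(1) allI[OF sectionsD[OF Hull_sections[OF \<xi>(1)]]] \<xi>(2)])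
qed

lemma cls_carrier: "\<xi> \<in> Hull \<Longrightarrow> cls \<xi> \<in> hcarrier DI"
  by (simp add: DI_carrier)

lemma DI_zero: "hzero DI = cls (\<lambda>z. hzero (H z))"
  by (simp add: direct_integral_def)

lemma DI_add:
  assumes "\<xi> \<in> Hull" "\<psi> \<in> Hull"
  shows "hadd DI (cls \<xi>) (cls \<psi>) = cls (\<lambda>z. hadd (H z) (\<xi> z) (\<psi> z))"
  unfolding direct_integral_def hspace.simps
proof (rule cls_eqI)
  show "AE z in \<nu>. hadd (H z) (section_rep (cls \<xi>) z) (section_rep (cls \<psi>) z) = hadd (H z) (\<xi> z) (\<psi> z)"
    using section_rep_cls(2)[OF assms(1)] section_rep_cls(2)[OF assms(2)] by eventually_elim simp
qed (intro Hull_closed section_rep_cls assms)+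

lemma DI_scale:
  assumes "\<xi> \<in> Hull"
  shows "hscale DI c (cls \<xi>) = cls (\<lambda>z. hscale (H z) c (\<xi> z))"
  unfolding direct_integral_def hspace.simps
proof (rule cls_eqI)
  show "AE z in \<nu>. hscale (H z) c (section_rep (cls \<xi>) z) = hscale (H z) c (\<xi> z)"
    using section_rep_cls(2)[OF assms] by eventually_elim simp
qed (intro Hull_closed const_Linf section_rep_cls assms)+

lemma DI_diff:
  assumes "\<xi> \<in> Hull" "\<psi> \<in> Hull"
  shows "hdiff DI (cls \<xi>) (cls \<psi>) = cls (\<lambda>z. hdiff (H z) (\<xi> z) (\<psi> z))"
  unfolding hdiff_def DI_scale[OF assms(2)]
  by (rule DI_add[OF assms(1) Hull_closed(3)[OF const_Linf assms(2)]])

lemma Hull_ip_measurable: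
  assumes "\<xi> \<in> Hull" "\<psi> \<in> Hull"
  shows "(\<lambda>z. hip (H z) (\<xi> z) (\<psi> z)) \<in> borel_measurable (completion \<nu>)"
proof -
  have i: "(\<lambda>z. hscale (H z) \<i> (\<psi> z)) \<in> Hull" by (rule Hull_closed(3)[OF const_Linf assms(2)])
  note m = Hull_norm_measurable[OF Hull_closed(2)[OF assms]] Hull_norm_measurable[OF Hull_diff[OF assms]]
    Hull_norm_measurable[OF Hull_closed(2)[OF assms(1) i]] Hull_norm_measurable[OF Hull_diff[OF assms(1) i]]
  have eq: "hip (H z) (\<xi> z) (\<psi> z) = (1/4) *
      (complex_of_real ((hnorm (H z) (hadd (H z) (\<xi> z) (\<psi> z)))\<^sup>2 - (hnorm (H z) (hdiff (H z) (\<xi> z) (\<psi> z)))\<^sup>2)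
      + \<i> * complex_of_real ((hnorm (H z) (hdiff (H z) (\<xi> z) (hscale (H z) \<i> (\<psi> z))))\<^sup>2
        - (hnorm (H z) (hadd (H z) (\<xi> z) (hscale (H z) \<i> (\<psi> z))))\<^sup>2))" for z
    unfolding polarization[OF sectionsD[OF Hull_sections[OF assms(1)]] sectionsD[OF Hull_sections[OF assms(2)]], symmetric]
    by simp
  have "(\<lambda>z. (1/4) * (complex_of_real ((a z)\<^sup>2 - (b z)\<^sup>2) + \<i> * complex_of_real ((c z)\<^sup>2 - (d z)\<^sup>2)))
      \<in> borel_measurable (completion \<nu>)"
    if [measurable]: "a \<in> borel_measurable (completion \<nu>)" "b \<in> borel_measurable (completion \<nu>)"
      "c \<in> borel_measurable (completion \<nu>)" "d \<in> borel_measurable (completion \<nu>)"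
    for a b c d :: "'z \<Rightarrow> real"
    by measurable
  from this[OF m(1,2,4,3)] show ?thesis unfolding eq .
qed

lemma Hull_ip_integrable:
  assumes "\<xi> \<in> Hull" "\<psi> \<in> Hull"
  shows "integrable (completion \<nu>) (\<lambda>z. hip (H z) (\<xi> z) (\<psi> z))"
proof (rule Bochner_Integration.integrable_bound[OF _ Hull_ip_measurable[OF assms]])
  show "integrable (completion \<nu>) (\<lambda>z. (hnorm (H z) (\<xi> z))\<^sup>2 + (hnorm (H z) (\<psi> z))\<^sup>2)"
    using Hull_integrable assms by simp
  show "AE z in completion \<nu>. norm (hip (H z) (\<xi> z) (\<psi> z))
      \<le> norm ((hnorm (H z) (\<xi> z))\<^sup>2 + (hnorm (H z) (\<psi> z))\<^sup>2)"
  proof (rule AE_I2)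
    fix z
    let ?a = "hnorm (H z) (\<xi> z)" and ?b = "hnorm (H z) (\<psi> z)"
    have "norm (hip (H z) (\<xi> z) (\<psi> z)) \<le> ?a * ?b"
      by (rule cauchy_schwarz) (rule sectionsD[OF Hull_sections], rule assms)+
    moreover have "2 * (?a * ?b) \<le> ?a\<^sup>2 + ?b\<^sup>2"
      using sum_squares_bound[of ?a ?b] by simp
    moreover have "0 \<le> ?a\<^sup>2 + ?b\<^sup>2" by simp
    ultimately show "norm (hip (H z) (\<xi> z) (\<psi> z)) \<le> norm (?a\<^sup>2 + ?b\<^sup>2)"
      unfolding real_norm_def by linarith
  qed
qed

lemma DI_ip:
  assumes "\<xi> \<in> Hull" "\<psi> \<in> Hull"
  shows "hip DI (cls \<xi>) (cls \<psi>) = (LINT z|completion \<nu>. hip (H z) (\<xi> z) (\<psi> z))"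
  unfolding direct_integral_def hspace.simps
proof (rule integral_cong_AE)
  show "AE z in completion \<nu>. hip (H z) (section_rep (cls \<xi>) z) (section_rep (cls \<psi>) z) = hip (H z) (\<xi> z) (\<psi> z)"
    using AE_completion[OF section_rep_cls(2)[OF assms(1)]] AE_completion[OF section_rep_cls(2)[OF assms(2)]]
    by eventually_elim simp
qed (intro Hull_ip_measurable section_rep_cls assms)+

lemma DI_ip_self:
  assumes "\<xi> \<in> Hull"
  shows "hip DI (cls \<xi>) (cls \<xi>) = complex_of_real ((section_norm \<nu> H \<xi>)\<^sup>2)"
proof -
  have "hip (H z) (\<xi> z) (\<xi> z) = complex_of_real ((hnorm (H z) (\<xi> z))\<^sup>2)" for z
    by (rule ip_self[OF sectionsD[OF Hull_sections[OF assms]]])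
  then have "hip DI (cls \<xi>) (cls \<xi>) = complex_of_real (LINT z|completion \<nu>. (hnorm (H z) (\<xi> z))\<^sup>2)"
    by (simp only: DI_ip[OF assms assms] integral_complex_of_real)
  then show ?thesis by (simp add: section_norm_def integral_nonneg_AE)
qed

lemma DI_norm: "\<xi> \<in> Hull \<Longrightarrow> hnorm DI (cls \<xi>) = section_norm \<nu> H \<xi>"
  unfolding hnorm_def[of DI] by (simp add: DI_ip_self) (simp add: section_norm_def)

lemma DI_dist: "\<xi> \<in> Hull \<Longrightarrow> \<psi> \<in> Hull \<Longrightarrow> hnorm DI (hdiff DI (cls \<xi>) (cls \<psi>)) = section_dist \<nu> H \<xi> \<psi>"
  by (simp add: DI_diff DI_norm Hull_diff section_dist_def)

lemma DI_hilbert_space: "hilbert_space DI"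
proof
  note hulls = Hull_closed(1,2) Hull_closed(3)[OF const_Linf] Hull_diff
  note simps = DI_zero DI_add DI_scale DI_diff hulls cls_carrier
  show "hzero DI \<in> hcarrier DI" by (simp add: simps)
  fix X Y Z and c d :: complex
  show "X \<in> hcarrier DI \<Longrightarrow> Y \<in> hcarrier DI \<Longrightarrow> hadd DI X Y \<in> hcarrier DI"
    by (elim DI_carrierE) (simp add: simps)
  show "X \<in> hcarrier DI \<Longrightarrow> hscale DI c X \<in> hcarrier DI"
    by (elim DI_carrierE) (simp add: simps)
  show "X \<in> hcarrier DI \<Longrightarrow> Y \<in> hcarrier DI \<Longrightarrow> Z \<in> hcarrier DI \<Longrightarrow>
      hadd DI (hadd DI X Y) Z = hadd DI X (hadd DI Y Z)"
    by (elim DI_carrierE) (simp add: simps add_assoc)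
  show "X \<in> hcarrier DI \<Longrightarrow> Y \<in> hcarrier DI \<Longrightarrow> hadd DI X Y = hadd DI Y X"
    by (elim DI_carrierE) (simp add: simps add_comm)
  show "X \<in> hcarrier DI \<Longrightarrow> hadd DI X (hzero DI) = X"
    by (elim DI_carrierE) (simp add: simps add_zero)
  show "X \<in> hcarrier DI \<Longrightarrow> hdiff DI X X = hzero DI"
    by (elim DI_carrierE) (simp add: simps diff_self)
  show "X \<in> hcarrier DI \<Longrightarrow> Y \<in> hcarrier DI \<Longrightarrow>
      hscale DI c (hadd DI X Y) = hadd DI (hscale DI c X) (hscale DI c Y)"
    by (elim DI_carrierE) (simp add: simps scale_add_right)
  show "X \<in> hcarrier DI \<Longrightarrow> hscale DI (c + d) X = hadd DI (hscale DI c X) (hscale DI d X)"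
    by (elim DI_carrierE) (simp add: simps scale_add_left)
  show "X \<in> hcarrier DI \<Longrightarrow> hscale DI c (hscale DI d X) = hscale DI (c * d) X"
    by (elim DI_carrierE) (simp add: simps scale_scale)
  show "X \<in> hcarrier DI \<Longrightarrow> hscale DI 1 X = X"
    by (elim DI_carrierE) (simp add: simps scale_one)
  show "hip DI X Y = cnj (hip DI Y X)" if XY: "X \<in> hcarrier DI" "Y \<in> hcarrier DI"
  proof -
    obtain \<xi> where 1: "\<xi> \<in> Hull" "\<forall>z. \<xi> z \<in> hcarrier (H z)" "X = cls \<xi>" by (rule DI_carrierE[OF XY(1)])
    obtain \<psi> where 2: "\<psi> \<in> Hull" "\<forall>z. \<psi> z \<in> hcarrier (H z)" "Y = cls \<psi>" by (rule DI_carrierE[OF XY(2)])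
    note * = 1 2
    have "hip (H z) (\<xi> z) (\<psi> z) = cnj (hip (H z) (\<psi> z) (\<xi> z))" for z
      by (rule ip_commute[OF spec[OF 1(2)] spec[OF 2(2)]])
    then have "hip DI X Y = (LINT z|completion \<nu>. cnj (hip (H z) (\<psi> z) (\<xi> z)))"
      using * by (simp add: DI_ip)
    then show ?thesis using * by (simp add: DI_ip)
  qed
  show "hip DI X (hadd DI Y Z) = hip DI X Y + hip DI X Z"
    if XYZ: "X \<in> hcarrier DI" "Y \<in> hcarrier DI" "Z \<in> hcarrier DI"
  proof -
    obtain \<xi> where 1: "\<xi> \<in> Hull" "\<forall>z. \<xi> z \<in> hcarrier (H z)" "X = cls \<xi>" by (rule DI_carrierE[OF XYZ(1)])
    obtain \<psi> where 2: "\<psi> \<in> Hull" "\<forall>z. \<psi> z \<in> hcarrier (H z)" "Y = cls \<psi>" by (rule DI_carrierE[OF XYZ(2)])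
    obtain \<phi> where 3: "\<phi> \<in> Hull" "\<forall>z. \<phi> z \<in> hcarrier (H z)" "Z = cls \<phi>" by (rule DI_carrierE[OF XYZ(3)])
    show ?thesis
      unfolding 1(3) 2(3) 3(3) DI_add[OF 2(1) 3(1)] DI_ip[OF 1(1) 2(1)] DI_ip[OF 1(1) 3(1)]
        DI_ip[OF 1(1) Hull_closed(2)[OF 2(1) 3(1)]] ip_add_right[OF spec[OF 1(2)] spec[OF 2(2)] spec[OF 3(2)]]
      by (rule Bochner_Integration.integral_add) (intro Hull_ip_integrable 1 2 3)+
  qed
  show "hip DI X (hscale DI c Y) = c * hip DI X Y" if XY: "X \<in> hcarrier DI" "Y \<in> hcarrier DI"
  proof -
    obtain \<xi> where 1: "\<xi> \<in> Hull" "\<forall>z. \<xi> z \<in> hcarrier (H z)" "X = cls \<xi>" by (rule DI_carrierE[OF XY(1)])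
    obtain \<psi> where 2: "\<psi> \<in> Hull" "\<forall>z. \<psi> z \<in> hcarrier (H z)" "Y = cls \<psi>" by (rule DI_carrierE[OF XY(2)])
    show ?thesis
      unfolding 1(3) 2(3) DI_scale[OF 2(1)] DI_ip[OF 1(1) 2(1)]
        DI_ip[OF 1(1) Hull_closed(3)[OF const_Linf 2(1)]] ip_scale_right[OF spec[OF 1(2)] spec[OF 2(2)]]
      by simp
  qed
  show "X \<in> hcarrier DI \<Longrightarrow> 0 \<le> Re (hip DI X X)"
    by (elim DI_carrierE) (simp add: DI_ip_self)
  show "X = hzero DI" if X: "X \<in> hcarrier DI" "hip DI X X = 0"
  proof -
    obtain \<xi> where \<xi>: "\<xi> \<in> Hull" "\<forall>z. \<xi> z \<in> hcarrier (H z)" "X = cls \<xi>" by (rule DI_carrierE[OF X(1)])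
    then have "section_dist \<nu> H \<xi> (\<lambda>z. hzero (H z)) = 0"
      using X(2) by (simp add: DI_ip_self section_dist_def diff_zero)
    then show ?thesis
      unfolding \<xi>(3) DI_zero section_dist_zero_iff[OF \<xi>(1) Hull_closed(1)]
      by (rule cls_eqI[OF \<xi>(1) Hull_closed(1)])
  qed
next
  fix X :: "nat \<Rightarrow> ('z \<Rightarrow> 'a) set"
  assume X: "\<And>n. X n \<in> hcarrier DI"
    and Cauchy: "\<And>e. e > 0 \<Longrightarrow> \<exists>N. \<forall>i\<ge>N. \<forall>j\<ge>N. hnorm DI (hdiff DI (X i) (X j)) < e"
  have "\<exists>\<xi>. \<forall>n. \<xi> n \<in> Hull \<and> X n = cls (\<xi> n)"
    by (intro choice allI) (use X in \<open>auto simp: DI_carrier\<close>)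
  then obtain \<xi> where \<xi>: "\<And>n. \<xi> n \<in> Hull" "\<And>n. X n = cls (\<xi> n)" by blast
  have "\<exists>\<psi>\<in>Hull. (\<lambda>n. section_dist \<nu> H (\<xi> n) \<psi>) \<longlonglongrightarrow> 0"
    by (rule Hull_complete[OF \<xi>(1)]) (use Cauchy in \<open>simp add: \<xi> DI_dist\<close>)
  then obtain \<psi> where \<psi>: "\<psi> \<in> Hull" "(\<lambda>n. section_dist \<nu> H (\<xi> n) \<psi>) \<longlonglongrightarrow> 0" by blast
  then show "\<exists>x\<in>hcarrier DI. (\<lambda>n. hnorm DI (hdiff DI (X n) x)) \<longlonglongrightarrow> 0"
    by (intro bexI[of _ "cls \<psi>"] cls_carrier) (simp_all add: \<xi> DI_dist)
qed

lemma \<Gamma>_dense_DI: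
  assumes "X \<in> hcarrier DI" "0 < e"
  shows "\<exists>\<gamma>\<in>\<Gamma>. hnorm DI (hdiff DI X (cls \<gamma>)) < e"
proof -
  obtain \<xi> where \<xi>: "\<xi> \<in> Hull" "\<forall>z. \<xi> z \<in> hcarrier (H z)" "X = cls \<xi>" by (rule DI_carrierE[OF assms(1)])
  have "0 < e\<^sup>2 / 2" using assms(2) by simp
  from HullD[OF \<xi>(1) this] obtain \<gamma> where \<gamma>: "\<gamma> \<in> \<Gamma>" "close_to (e\<^sup>2 / 2) \<xi> \<gamma>" .
  have "(section_dist \<nu> H \<xi> \<gamma>)\<^sup>2 \<le> e\<^sup>2 / 2"
    using \<gamma>(2) by (simp add: close_to_Hull_iff[OF \<xi>(1) \<Gamma>_Hull[OF \<gamma>(1)]])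
  also have "\<dots> < e\<^sup>2" using assms(2) by simp
  finally have "section_dist \<nu> H \<xi> \<gamma> < e" using assms(2) by (simp add: power2_less_imp_less)
  then show ?thesis using \<gamma>(1) \<xi> by (auto intro!: bexI[of _ \<gamma>] simp: DI_dist \<Gamma>_Hull)
qed

end

section \<open>Unitary extensions\<close>

text \<open>Two dense families with a common index set replace a map on a subspace: that x i
  determines y i follows from \<open>isometry\<close>, and the set-up is symmetric in K and
  L.\<close>

locale dense_isometry = K: hilbert_space K + L: hilbert_space L
  for K :: "'a hspace" and L :: "'b hspace" +
  fixes I :: "'i set" and x :: "'i \<Rightarrow> 'a" and y :: "'i \<Rightarrow> 'b"
  assumes x: "i \<in> I \<Longrightarrow> x i \<in> hcarrier K" and y: "i \<in> I \<Longrightarrow> y i \<in> hcarrier L"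
    and x_dense: "u \<in> hcarrier K \<Longrightarrow> 0 < e \<Longrightarrow> \<exists>i\<in>I. hnorm K (hdiff K u (x i)) < e"
    and y_dense: "v \<in> hcarrier L \<Longrightarrow> 0 < e \<Longrightarrow> \<exists>i\<in>I. hnorm L (hdiff L v (y i)) < e"
    and isometry: "i \<in> I \<Longrightarrow> j \<in> I \<Longrightarrow> hnorm L (hdiff L (y i) (y j)) = hnorm K (hdiff K (x i) (x j))"
    and add: "i \<in> I \<Longrightarrow> j \<in> I \<Longrightarrow> \<exists>k\<in>I. x k = hadd K (x i) (x j) \<and> y k = hadd L (y i) (y j)"
    and scale: "i \<in> I \<Longrightarrow> \<exists>k\<in>I. x k = hscale K c (x i) \<and> y k = hscale L c (y i)"
begin

text \<open>It makes surjectivity of the extension an instance of \<open>R_total\<close> in the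
  opposite direction.\<close>

lemma swap: "dense_isometry L K I y x"
proof (intro dense_isometry.intro dense_isometry_axioms.intro)
  show "hilbert_space L" "hilbert_space K" by unfold_locales
  fix i j c assume i: "i \<in> I" and j: "j \<in> I"
  from add[OF i j] show "\<exists>k\<in>I. y k = hadd L (y i) (y j) \<and> x k = hadd K (x i) (x j)" by blast
next
  fix i c assume i: "i \<in> I"
  from scale[OF i] show "\<exists>k\<in>I. y k = hscale L c (y i) \<and> x k = hscale K c (x i)" by blast
qed (simp_all add: x y x_dense y_dense isometry)

text \<open>The closure of the graph of x i \<mapsto> y i. Working with the relation postpones the
  choice of values until they are known to be unique.\<close>

definition R :: "'a \<Rightarrow> 'b \<Rightarrow> bool" where
  "R u v \<longleftrightarrow> u \<in> hcarrier K \<and> v \<in> hcarrier L \<and>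
    (\<forall>e>0. \<exists>i\<in>I. hnorm K (hdiff K u (x i)) \<le> e \<and> hnorm L (hdiff L v (y i)) \<le> e)"

lemma R_swap: "dense_isometry.R L K I y x v u \<longleftrightarrow> R u v"
  unfolding R_def dense_isometry.R_def[OF swap] by auto

lemma R_gen: "i \<in> I \<Longrightarrow> R (x i) (y i)"
  unfolding R_def by (auto intro!: bexI[of _ i] simp: x y K.diff_self L.diff_self K.norm_zero L.norm_zero)

lemma R_total:
  assumes u: "u \<in> hcarrier K"
  shows "\<exists>v. R u v"
proof -
  \<comment> \<open>The extra factor 1/2 brings consecutive distances below 2^-n, as
    \<open>geometric_Cauchy\<close> asks.\<close>
  have "\<exists>i. \<forall>n. i n \<in> I \<and> hnorm K (hdiff K u (x (i n))) < (1/2) ^ n / 2"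
  proof (intro choice allI)
    fix n :: nat
    have "(0::real) < (1/2) ^ n / 2" by simp
    from x_dense[OF u this] show "\<exists>i. i \<in> I \<and> hnorm K (hdiff K u (x i)) < (1/2) ^ n / 2" by blast
  qed
  then obtain i where i: "\<And>n. i n \<in> I" "\<And>n. hnorm K (hdiff K u (x (i n))) < (1/2) ^ n / 2" by blast
  have "hnorm L (hdiff L (y (i n)) (y (i (Suc n)))) \<le> (1/2) ^ n" for n
  proof -
    have "hnorm K (hdiff K (x (i n)) (x (i (Suc n))))
        \<le> hnorm K (hdiff K (x (i n)) u) + hnorm K (hdiff K u (x (i (Suc n))))"
      by (intro K.dist_triangle x i u)
    also have "\<dots> \<le> (1/2) ^ n / 2 + (1/2) ^ Suc n / 2"
      using i(2)[of n] i(2)[of "Suc n"] by (simp add: K.dist_commute[OF x[OF i(1)] u])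
    also have "\<dots> \<le> (1/2) ^ n" by simp
    finally show ?thesis by (simp add: isometry i(1))
  qed
  then have "\<forall>\<^sub>F n in sequentially. hnorm L (hdiff L (y (i n)) (y (i (Suc n)))) \<le> (1/2) ^ n"
    by (intro always_eventually allI)
  from L.geometric_Cauchy[of "\<lambda>n. y (i n)", OF y[OF i(1)] this]
  obtain v where v: "v \<in> hcarrier L" "(\<lambda>n. hnorm L (hdiff L (y (i n)) v)) \<longlonglongrightarrow> 0" by blast
  have "R u v"
    unfolding R_def
  proof (intro conjI u v(1) allI impI)
    fix e :: real assume e: "0 < e"
    have "\<forall>\<^sub>F n in sequentially. hnorm L (hdiff L (y (i n)) v) < e"
      by (rule order_tendstoD(2)[OF v(2) e])
    moreover have "\<forall>\<^sub>F n in sequentially. (1/2::real) ^ n < e"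
      by (rule order_tendstoD(2)[OF LIMSEQ_realpow_zero e]) auto
    ultimately have "\<forall>\<^sub>F n in sequentially. hnorm L (hdiff L (y (i n)) v) < e \<and> (1/2::real) ^ n < e"
      by (rule eventually_conj)
    then obtain n where n: "hnorm L (hdiff L (y (i n)) v) < e" "(1/2::real) ^ n < e"
      by (auto simp: eventually_sequentially)
    have "(0::real) < (1/2) ^ n" by simp
    then have "hnorm K (hdiff K u (x (i n))) \<le> e" using i(2)[of n] n(2) by linarith
    moreover have "hnorm L (hdiff L v (y (i n))) \<le> e"
      using n(1) by (simp add: L.dist_commute[OF v(1) y[OF i(1)]])
    ultimately show "\<exists>i\<in>I. hnorm K (hdiff K u (x i)) \<le> e \<and> hnorm L (hdiff L v (y i)) \<le> e"
      using i(1) by blast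
  qed
  then show ?thesis ..
qed

lemma R_dist:
  assumes uv: "R u v" and uv': "R u' v'"
  shows "hnorm K (hdiff K u u') = hnorm L (hdiff L v v')"
proof -
  have c: "u \<in> hcarrier K" "u' \<in> hcarrier K" "v \<in> hcarrier L" "v' \<in> hcarrier L"
    using assms by (auto simp: R_def)
  have "\<bar>hnorm K (hdiff K u u') - hnorm L (hdiff L v v')\<bar> \<le> 0 + e" if e: "0 < e" for e
  proof -
    have e4: "0 < e / 4" using e by simp
    obtain i where i: "i \<in> I" "hnorm K (hdiff K u (x i)) \<le> e/4" "hnorm L (hdiff L v (y i)) \<le> e/4"
      using uv e4 unfolding R_def by blast
    obtain j where j: "j \<in> I" "hnorm K (hdiff K u' (x j)) \<le> e/4" "hnorm L (hdiff L v' (y j)) \<le> e/4"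
      using uv' e4 unfolding R_def by blast
    note xi = x[OF i(1)] and xj = x[OF j(1)] and yi = y[OF i(1)] and yj = y[OF j(1)]
    \<comment> \<open>With r the common distance of the generators, passing from a to r and from r
      to b costs two errors of e/4 each.\<close>
    have arith: "\<bar>a - b\<bar> \<le> 0 + e"
      if "a \<le> p + q" "q \<le> r + s" "r \<le> p + t" "t \<le> a + s" "b \<le> p' + q'" "q' \<le> r + s'" "r \<le> p' + t'" "t' \<le> b + s'"
        "p \<le> e/4" "s \<le> e/4" "p' \<le> e/4" "s' \<le> e/4"
      for a b p q r s t p' q' s' t' :: real
      using that by linarith
    show ?thesis
    proof (rule arith)
      show "hnorm K (hdiff K u u') \<le> hnorm K (hdiff K u (x i)) + hnorm K (hdiff K (x i) u')"
        by (rule K.dist_triangle[OF c(1) xi c(2)])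
      show "hnorm K (hdiff K (x i) u') \<le> hnorm K (hdiff K (x i) (x j)) + hnorm K (hdiff K u' (x j))"
        unfolding K.dist_commute[OF c(2) xj] by (rule K.dist_triangle[OF xi xj c(2)])
      show "hnorm K (hdiff K (x i) (x j)) \<le> hnorm K (hdiff K u (x i)) + hnorm K (hdiff K u (x j))"
        unfolding K.dist_commute[OF c(1) xi] by (rule K.dist_triangle[OF xi c(1) xj])
      show "hnorm K (hdiff K u (x j)) \<le> hnorm K (hdiff K u u') + hnorm K (hdiff K u' (x j))"
        by (rule K.dist_triangle[OF c(1) c(2) xj])
      show "hnorm L (hdiff L v v') \<le> hnorm L (hdiff L v (y i)) + hnorm L (hdiff L (y i) v')"
        by (rule L.dist_triangle[OF c(3) yi c(4)])
      show "hnorm L (hdiff L (y i) v') \<le> hnorm K (hdiff K (x i) (x j)) + hnorm L (hdiff L v' (y j))"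
        unfolding L.dist_commute[OF c(4) yj] isometry[OF i(1) j(1), symmetric]
        by (rule L.dist_triangle[OF yi yj c(4)])
      show "hnorm K (hdiff K (x i) (x j)) \<le> hnorm L (hdiff L v (y i)) + hnorm L (hdiff L v (y j))"
        unfolding L.dist_commute[OF c(3) yi] isometry[OF i(1) j(1), symmetric]
        by (rule L.dist_triangle[OF yi c(3) yj])
      show "hnorm L (hdiff L v (y j)) \<le> hnorm L (hdiff L v v') + hnorm L (hdiff L v' (y j))"
        by (rule L.dist_triangle[OF c(3) c(4) yj])
    qed (intro i j)+
  qed
  then have "\<bar>hnorm K (hdiff K u u') - hnorm L (hdiff L v v')\<bar> \<le> 0"
    using field_le_epsilon[of "\<bar>hnorm K (hdiff K u u') - hnorm L (hdiff L v v')\<bar>" 0] by auto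
  then show ?thesis by linarith
qed

lemma R_unique: "R u v \<Longrightarrow> R u v' \<Longrightarrow> v = v'"
proof -
  assume *: "R u v" "R u v'"
  then have c: "u \<in> hcarrier K" "v \<in> hcarrier L" "v' \<in> hcarrier L" by (auto simp: R_def)
  have "hnorm L (hdiff L v v') = 0"
    using R_dist[OF *] by (simp add: K.diff_self K.norm_zero c)
  then show "v = v'" using c L.diff_eq_zeroD[OF c(2,3)] by (simp add: L.norm_zero_iff L.closed)
qed

lemma R_add:
  assumes uv: "R u v" and uv': "R u' v'"
  shows "R (hadd K u u') (hadd L v v')"
proof -
  have c: "u \<in> hcarrier K" "u' \<in> hcarrier K" "v \<in> hcarrier L" "v' \<in> hcarrier L"
    using assms by (auto simp: R_def)
  show ?thesis
    unfolding R_def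
  proof (intro conjI allI impI)
    fix e :: real assume "0 < e"
    then have e2: "0 < e / 2" by simp
    obtain i where i: "i \<in> I" "hnorm K (hdiff K u (x i)) \<le> e/2" "hnorm L (hdiff L v (y i)) \<le> e/2"
      using uv e2 unfolding R_def by blast
    obtain j where j: "j \<in> I" "hnorm K (hdiff K u' (x j)) \<le> e/2" "hnorm L (hdiff L v' (y j)) \<le> e/2"
      using uv' e2 unfolding R_def by blast
    obtain k where k: "k \<in> I" "x k = hadd K (x i) (x j)" "y k = hadd L (y i) (y j)"
      using add[OF i(1) j(1)] by blast
    note xi = x[OF i(1)] and xj = x[OF j(1)] and yi = y[OF i(1)] and yj = y[OF j(1)]
    have "hnorm K (hdiff K (hadd K u u') (x k)) \<le> e"
      using K.norm_triangle[OF K.diff_closed[OF c(1) xi] K.diff_closed[OF c(2) xj]] i j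
      by (simp add: k K.add_diff_add c xi xj)
    moreover have "hnorm L (hdiff L (hadd L v v') (y k)) \<le> e"
      using L.norm_triangle[OF L.diff_closed[OF c(3) yi] L.diff_closed[OF c(4) yj]] i j
      by (simp add: k L.add_diff_add c yi yj)
    ultimately show "\<exists>i\<in>I. hnorm K (hdiff K (hadd K u u') (x i)) \<le> e \<and> hnorm L (hdiff L (hadd L v v') (y i)) \<le> e"
      using k(1) by blast
  qed (intro K.closed L.closed c)+
qed

lemma R_scale:
  assumes uv: "R u v"
  shows "R (hscale K c u) (hscale L c v)"
proof -
  have m: "u \<in> hcarrier K" "v \<in> hcarrier L" using assms by (auto simp: R_def)
  show ?thesis
    unfolding R_def
  proof (intro conjI allI impI)
    fix e :: real assume e: "0 < e"
    define d where "d = e / (cmod c + 1)"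
    have pos: "0 < cmod c + 1" using norm_ge_zero[of c] by linarith
    have d: "0 < d" using e pos by (simp add: d_def)
    have ce: "cmod c * t \<le> e" if "t \<le> d" "0 \<le> t" for t
    proof -
      have "cmod c * t \<le> (cmod c + 1) * d" by (intro mult_mono) (use that pos in auto)
      also have "\<dots> = e" using pos by (simp add: d_def)
      finally show ?thesis .
    qed
    obtain i where i: "i \<in> I" "hnorm K (hdiff K u (x i)) \<le> d" "hnorm L (hdiff L v (y i)) \<le> d"
      using uv d unfolding R_def by blast
    obtain k where k: "k \<in> I" "x k = hscale K c (x i)" "y k = hscale L c (y i)"
      using scale[OF i(1)] by blast
    note xi = x[OF i(1)] and yi = y[OF i(1)]
    have "hnorm K (hdiff K (hscale K c u) (x k)) \<le> e" "hnorm L (hdiff L (hscale L c v) (y k)) \<le> e"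
      unfolding k K.scale_diff[OF m(1) xi, symmetric] L.scale_diff[OF m(2) yi, symmetric]
        K.norm_scale[OF K.diff_closed[OF m(1) xi]] L.norm_scale[OF L.diff_closed[OF m(2) yi]]
      by (intro ce i K.norm_nonneg L.norm_nonneg K.diff_closed L.diff_closed m xi yi)+
    then show "\<exists>i\<in>I. hnorm K (hdiff K (hscale K c u) (x i)) \<le> e \<and> hnorm L (hdiff L (hscale L c v) (y i)) \<le> e"
      using k(1) by blast
  qed (intro K.closed L.closed m)+
qed

text \<open>R is total, single valued, linear and distance preserving, so it is the graph of a
  linear isometry; polarization recovers the inner products.\<close>

theorem unitary_extension: "\<exists>V. hunitary K L V \<and> (\<forall>i\<in>I. V (x i) = y i)"
proof -
  have "\<exists>V. \<forall>u. u \<in> hcarrier K \<longrightarrow> R u (V u)"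
  proof (intro choice allI)
    fix u show "\<exists>v. u \<in> hcarrier K \<longrightarrow> R u v" using R_total[of u] by blast
  qed
  then obtain V where V: "\<And>u. u \<in> hcarrier K \<Longrightarrow> R u (V u)" by blast
  have VL: "V u \<in> hcarrier L" if "u \<in> hcarrier K" for u using V[OF that] by (simp add: R_def)
  have V_eq: "V u = v" if "R u v" for u v
    by (rule R_unique[OF V that]) (use that in \<open>simp add: R_def\<close>)
  have add: "V (hadd K u u') = hadd L (V u) (V u')" if "u \<in> hcarrier K" "u' \<in> hcarrier K" for u u'
    by (rule V_eq[OF R_add[OF V[OF that(1)] V[OF that(2)]]])
  have scale: "V (hscale K c u) = hscale L c (V u)" if "u \<in> hcarrier K" for c u
    by (rule V_eq[OF R_scale[OF V[OF that]]])
  have V0: "V (hzero K) = hzero L"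
    using scale[OF K.zero_closed, of 0] by (simp add: K.scale_zero_right L.scale_zero VL K.zero_closed)
  have dist: "hnorm L (hdiff L (V u) (V u')) = hnorm K (hdiff K u u')"
    if "u \<in> hcarrier K" "u' \<in> hcarrier K" for u u'
    using R_dist[OF V[OF that(1)] V[OF that(2)]] by simp
  have norm: "hnorm L (V u) = hnorm K u" if "u \<in> hcarrier K" for u
    using dist[OF that K.zero_closed] that by (simp add: V0 L.diff_zero K.diff_zero VL)
  have ip: "hip L (V u) (V u') = hip K u u'" if uu: "u \<in> hcarrier K" "u' \<in> hcarrier K" for u u'
  proof -
    have "4 * hip L (V u) (V u') = 4 * hip K u u'"
      using uu unfolding K.polarization[OF uu] L.polarization[OF VL[OF uu(1)] VL[OF uu(2)]]
      by (simp add: dist norm K.closed flip: add scale)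
    then show ?thesis by simp
  qed
  have inj: "inj_on V (hcarrier K)"
  proof (rule inj_onI)
    fix u u' assume *: "u \<in> hcarrier K" "u' \<in> hcarrier K" "V u = V u'"
    have "hnorm K (hdiff K u u') = 0"
      using dist[OF *(1,2)] *(3) by (simp add: L.diff_self L.norm_zero VL *(2))
    then show "u = u'" using K.diff_eq_zeroD[OF *(1,2)] * by (simp add: K.norm_zero_iff K.closed)
  qed
  have surj: "V ` hcarrier K = hcarrier L"
  proof
    show "V ` hcarrier K \<subseteq> hcarrier L" using VL by blast
    show "hcarrier L \<subseteq> V ` hcarrier K"
    proof
      fix v assume "v \<in> hcarrier L"
      from dense_isometry.R_total[OF swap this] obtain u where u: "R u v" unfolding R_swap by blast
      then have "u \<in> hcarrier K" by (simp add: R_def)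
      with V_eq[OF u] show "v \<in> V ` hcarrier K" by blast
    qed
  qed
  have "hunitary K L V"
    using inj surj add scale ip by (simp add: hunitary_def bij_betw_def)
  then show ?thesis using V_eq[OF R_gen] by (intro exI[of _ V]) simp
qed

end

section \<open>Transport of operators along a unitary\<close>

lemma transport_apply:
  "hunitary K L V \<Longrightarrow> x \<in> hcarrier K \<Longrightarrow> transport K V T (V x) = V (T x)"
  by (simp add: transport_def hunitary_def bij_betw_def inv_into_f_f)

lemma hunitary_norm:
  assumes "hunitary K L V" "x \<in> hcarrier K"
  shows "hnorm L (V x) = hnorm K x"
  using assms by (simp add: hunitary_def hnorm_def)

lemma hunitary_surj:
  assumes "hunitary K L V" "y \<in> hcarrier L"
  obtains x where "x \<in> hcarrier K" "y = V x"
proof -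
  have "y \<in> V ` hcarrier K" using assms by (simp add: hunitary_def bij_betw_def)
  then show ?thesis using that by blast
qed

lemma transport_hops:
  assumes V: "hunitary K L V" and T: "T \<in> hops K" and K: "hilbert_space K"
  shows "transport K V T \<in> hops L"
proof -
  interpret hilbert_space K by (rule K)
  let ?T = "transport K V T"
  have Vc: "V x \<in> hcarrier L" if "x \<in> hcarrier K" for x
    using V that by (auto simp: hunitary_def bij_betw_def)
  have Va: "hadd L (V x) (V y) = V (hadd K x y)" if "x \<in> hcarrier K" "y \<in> hcarrier K" for x y
    using V that by (simp add: hunitary_def)
  have Vs: "hscale L c (V x) = V (hscale K c x)" if "x \<in> hcarrier K" for c x
    using V that by (simp add: hunitary_def)
  have Tc: "T x \<in> hcarrier K" if "x \<in> hcarrier K" for x using T that by (simp add: hops_def)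
  have Ta: "T (hadd K x y) = hadd K (T x) (T y)" if "x \<in> hcarrier K" "y \<in> hcarrier K" for x y
    using T that by (simp add: hops_def)
  have Ts: "T (hscale K c x) = hscale K c (T x)" if "x \<in> hcarrier K" for c x
    using T that by (simp add: hops_def)
  obtain c where "\<forall>x\<in>hcarrier K. hnorm K (T x) \<le> c * hnorm K x"
    using T unfolding hops_def by blast
  then have c: "hnorm K (T x) \<le> c * hnorm K x" if "x \<in> hcarrier K" for x
    using that by blast
  note simps = transport_apply[OF V] Vc Va Vs Tc Ta Ts closed
  have "?T u \<in> hcarrier L" if u: "u \<in> hcarrier L" for u
  proof -
    obtain x where x: "x \<in> hcarrier K" "u = V x" by (rule hunitary_surj[OF V u])
    show ?thesis using x by (simp add: simps)
  qed
  moreover have "?T (hadd L u v) = hadd L (?T u) (?T v)" if uv: "u \<in> hcarrier L" "v \<in> hcarrier L" for u v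
  proof -
    obtain x where x: "x \<in> hcarrier K" "u = V x" by (rule hunitary_surj[OF V uv(1)])
    obtain y where y: "y \<in> hcarrier K" "v = V y" by (rule hunitary_surj[OF V uv(2)])
    show ?thesis using x y by (simp add: simps)
  qed
  moreover have "?T (hscale L a u) = hscale L a (?T u)" if u: "u \<in> hcarrier L" for a u
  proof -
    obtain x where x: "x \<in> hcarrier K" "u = V x" by (rule hunitary_surj[OF V u])
    show ?thesis using x by (simp add: simps)
  qed
  moreover have "hnorm L (?T u) \<le> c * hnorm L u" if u: "u \<in> hcarrier L" for u
  proof -
    obtain x where x: "x \<in> hcarrier K" "u = V x" by (rule hunitary_surj[OF V u])
    show ?thesis using x by (simp add: simps hunitary_norm[OF V] c)
  qed
  ultimately show ?thesis unfolding hops_def by blast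
qed

section \<open>GNS representations of the scaling algebra\<close>

text \<open>Stated for an abstract algebra M, so that one set of facts covers the space of the given
  limit state as well as all fibres.\<close>

locale gns = hilbert_space K
  for K :: "'a hspace" +
  fixes M :: "'h::complex_hilbert scaling_fun set" and \<phi> :: "'h scaling_fun \<Rightarrow> complex"
    and \<pi> :: "'h scaling_fun \<Rightarrow> 'a \<Rightarrow> 'a" and w :: 'a
  assumes bounded: "A \<in> M \<Longrightarrow> A l \<in> bounded_operators"
    and M_add: "A \<in> M \<Longrightarrow> B \<in> M \<Longrightarrow> (\<lambda>l. A l + B l) \<in> M"
    and M_comp: "A \<in> M \<Longrightarrow> B \<in> M \<Longrightarrow> (\<lambda>l. A l o\<^sub>L B l) \<in> M"
    and M_scale: "A \<in> M \<Longrightarrow> (\<lambda>l. scalar_op c o\<^sub>L A l) \<in> M"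
    and M_op_adj: "A \<in> M \<Longrightarrow> (\<lambda>l. op_adj (A l)) \<in> M"
    and M_id: "(\<lambda>l. id_blinfun) \<in> M"
    and gns_triple: "gns_triple M \<phi> K \<pi> w"
begin

lemma rep: "representation M K \<pi>" and w: "w \<in> hcarrier K"
  and cyclic: "x \<in> hcarrier K \<Longrightarrow> 0 < e \<Longrightarrow> \<exists>A\<in>M. nrm (x \<^bold>- \<pi> A w) < e"
  and state: "A \<in> M \<Longrightarrow> \<phi> A = hip K w (\<pi> A w)"
  using gns_triple by (simp_all add: gns_triple_def)

lemma hops: "A \<in> M \<Longrightarrow> \<pi> A \<in> hops K"
  using rep by (simp add: representation_def)

lemma \<pi>_closed: "A \<in> M \<Longrightarrow> x \<in> hcarrier K \<Longrightarrow> \<pi> A x \<in> hcarrier K"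
  using hops by (simp add: hops_def)

lemma \<pi>_add: "A \<in> M \<Longrightarrow> B \<in> M \<Longrightarrow> x \<in> hcarrier K \<Longrightarrow> \<pi> (\<lambda>l. A l + B l) x = \<pi> A x \<^bold>+ \<pi> B x"
  and \<pi>_scale: "A \<in> M \<Longrightarrow> x \<in> hcarrier K \<Longrightarrow> \<pi> (\<lambda>l. scalar_op c o\<^sub>L A l) x = c \<^bold>\<cdot> \<pi> A x"
  and \<pi>_comp: "A \<in> M \<Longrightarrow> B \<in> M \<Longrightarrow> x \<in> hcarrier K \<Longrightarrow> \<pi> (\<lambda>l. A l o\<^sub>L B l) x = \<pi> A (\<pi> B x)"
  and \<pi>_op_adj: "A \<in> M \<Longrightarrow> x \<in> hcarrier K \<Longrightarrow> y \<in> hcarrier K \<Longrightarrow>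
    hip K (\<pi> (\<lambda>l. op_adj (A l)) x) y = hip K x (\<pi> A y)"
  using rep by (simp_all add: representation_def)

lemma \<pi>_scale_arg: "A \<in> M \<Longrightarrow> x \<in> hcarrier K \<Longrightarrow> \<pi> A (c \<^bold>\<cdot> x) = c \<^bold>\<cdot> \<pi> A x"
  using hops by (simp add: hops_def)

lemma \<pi>_op_adj':
  assumes "A \<in> M" "x \<in> hcarrier K" "y \<in> hcarrier K"
  shows "hip K (\<pi> A x) y = hip K x (\<pi> (\<lambda>l. op_adj (A l)) y)"
proof -
  have "(\<lambda>l. op_adj (op_adj (A l))) = A" by (rule ext) (rule op_adj_op_adj[OF bounded[OF assms(1)]])
  with \<pi>_op_adj[OF M_op_adj[OF assms(1)] assms(2,3)] show ?thesis by simp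
qed

lemma norm_square: "A \<in> M \<Longrightarrow> complex_of_real ((nrm (\<pi> A w))\<^sup>2) = \<phi> (\<lambda>l. op_adj (A l) o\<^sub>L A l)"
proof -
  assume A: "A \<in> M"
  have "hip K (\<pi> A w) (\<pi> A w) = hip K w (\<pi> (\<lambda>l. op_adj (A l)) (\<pi> A w))"
    by (rule \<pi>_op_adj'[OF A w \<pi>_closed[OF A w]])
  also have "\<dots> = \<phi> (\<lambda>l. op_adj (A l) o\<^sub>L A l)"
    by (simp add: state M_comp M_op_adj A \<pi>_comp w)
  finally show ?thesis by (simp add: ip_self \<pi>_closed A w)
qed

lemma state_op_adj: "A \<in> M \<Longrightarrow> \<phi> (\<lambda>l. op_adj (A l)) = cnj (\<phi> A)"
proof -
  assume A: "A \<in> M"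
  have "\<phi> (\<lambda>l. op_adj (A l)) = hip K (\<pi> A w) w"
    by (simp add: state M_op_adj A \<pi>_op_adj' w)
  also have "\<dots> = cnj (hip K w (\<pi> A w))" by (rule ip_commute[OF \<pi>_closed[OF A w] w])
  finally show ?thesis by (simp add: state A)
qed

text \<open>The vector \<open>w - \<pi>(1)w\<close> is orthogonal to the dense subspace \<open>\<pi>(M)w\<close>.\<close>

lemma \<pi>_id: "\<pi> (\<lambda>l. id_blinfun) w = w"
proof -
  let ?p = "\<pi> (\<lambda>l. id_blinfun) w"
  have p: "?p \<in> hcarrier K" by (rule \<pi>_closed[OF M_id w])
  let ?x = "w \<^bold>- ?p"
  have x: "?x \<in> hcarrier K" by (rule diff_closed[OF w p])
  have orth: "hip K (\<pi> A w) ?x = 0" if A: "A \<in> M" for A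
  proof -
    note A' = M_op_adj[OF A]
    have "\<pi> (\<lambda>l. op_adj (A l)) ?p = \<pi> (\<lambda>l. op_adj (A l)) w"
    proof -
      have "op_adj (A l) o\<^sub>L id_blinfun = op_adj (A l)" for l by (rule blinfun_eqI) simp
      with \<pi>_comp[OF A' M_id w] show ?thesis by simp
    qed
    then have "\<pi> (\<lambda>l. op_adj (A l)) ?x = hzero K"
      by (simp add: hops_diff[OF hops[OF A'] w p] diff_self \<pi>_closed[OF A' w])
    then have "hip K (\<pi> A w) ?x = hip K w (hzero K)" by (simp add: \<pi>_op_adj'[OF A w x])
    also have "\<dots> = 0" using ip_scale_right[OF w zero_closed, of 0] by (simp add: scale_zero_right)
    finally show ?thesis .
  qed
  have "nrm (w \<^bold>- ?p) \<le> e" if e: "0 < e" for e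
  proof -
    obtain A where A: "A \<in> M" "nrm (?x \<^bold>- \<pi> A w) < e" using cyclic[OF x e] by blast
    note Aw = \<pi>_closed[OF A(1) w]
    have "hip K ?x (\<pi> A w) = 0" using ip_commute[OF x Aw] orth[OF A(1)] by simp
    then have "(nrm (?x \<^bold>- \<pi> A w))\<^sup>2 = (nrm ?x)\<^sup>2 + (nrm (\<pi> A w))\<^sup>2"
      using orth[OF A(1)]
      by (simp add: norm_sq diff_closed[OF x Aw] x Aw ip_diff_left[OF x Aw diff_closed[OF x Aw]]
          ip_diff_right[OF x x Aw] ip_diff_right[OF Aw x Aw])
    then have "(nrm ?x)\<^sup>2 \<le> (nrm (?x \<^bold>- \<pi> A w))\<^sup>2" by simp
    then have "nrm ?x \<le> nrm (?x \<^bold>- \<pi> A w)"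
      by (rule power2_le_imp_le) (rule norm_nonneg[OF diff_closed[OF x Aw]])
    with A(2) show ?thesis by linarith
  qed
  from approx_eq[OF w p this] show ?thesis by simp
qed

lemma norm_w: "\<phi> (\<lambda>l. id_blinfun) = 1 \<Longrightarrow> nrm w = 1"
  using state[OF M_id] ip_self[OF w] norm_nonneg[OF w]
  by (simp add: \<pi>_id flip: of_real_power) (smt (verit) power2_eq_1_iff)

lemma dense_eq:
  assumes S: "S \<in> hops K" and T: "T \<in> hops K" and eq: "\<And>A. A \<in> M \<Longrightarrow> S (\<pi> A w) = T (\<pi> A w)"
    and x: "x \<in> hcarrier K"
  shows "S x = T x"
proof -
  obtain c where "\<forall>x\<in>hcarrier K. nrm (S x) \<le> c * nrm x" using S unfolding hops_def by blast
  moreover obtain d where "\<forall>x\<in>hcarrier K. nrm (T x) \<le> d * nrm x" using T unfolding hops_def by blast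
  ultimately have c: "nrm (S y) \<le> c * nrm y" and d: "nrm (T y) \<le> d * nrm y" if "y \<in> hcarrier K" for y
    using that by auto
  have cl: "S y \<in> hcarrier K" "T y \<in> hcarrier K" if "y \<in> hcarrier K" for y
    using S T that by (simp_all add: hops_def)
  show ?thesis
  proof (rule approx_eq[OF cl[OF x]])
    fix e :: real assume e: "0 < e"
    define t where "t = e / (\<bar>c\<bar> + \<bar>d\<bar> + 1)"
    have pos: "0 < \<bar>c\<bar> + \<bar>d\<bar> + 1" by linarith
    have t: "0 < t" using e pos by (simp add: t_def)
    obtain A where A: "A \<in> M" "nrm (x \<^bold>- \<pi> A w) < t" using cyclic[OF x t] by blast
    note Aw = \<pi>_closed[OF A(1) w]
    note xA = diff_closed[OF x Aw]
    have "nrm (S x \<^bold>- T x) \<le> nrm (S x \<^bold>- S (\<pi> A w)) + nrm (S (\<pi> A w) \<^bold>- T x)"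
      by (rule dist_triangle) (use cl x Aw in auto)
    also have "\<dots> = nrm (S (x \<^bold>- \<pi> A w)) + nrm (T (x \<^bold>- \<pi> A w))"
      by (simp add: hops_diff[OF S x Aw] hops_diff[OF T x Aw] eq[OF A(1)] dist_commute[OF cl(2)[OF Aw] cl(2)[OF x]])
    also have "\<dots> \<le> c * nrm (x \<^bold>- \<pi> A w) + d * nrm (x \<^bold>- \<pi> A w)"
      by (intro add_mono c d xA)
    also have "\<dots> \<le> (\<bar>c\<bar> + \<bar>d\<bar> + 1) * nrm (x \<^bold>- \<pi> A w)"
      unfolding distrib_right[symmetric] by (rule mult_right_mono[OF _ norm_nonneg[OF xA]]) linarith
    also have "\<dots> \<le> (\<bar>c\<bar> + \<bar>d\<bar> + 1) * t" using A(2) pos by (intro mult_left_mono) auto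
    also have "\<dots> = e" using pos by (simp add: t_def)
    finally show "nrm (S x \<^bold>- T x) \<le> e" .
  qed
qed

text \<open>S has some bound c, which controls the error of approximating x by \<pi>(A) w. This
  error can be made arbitrarily small, so the constant k valid on the dense subspace takes
  over.\<close>

lemma dense_bound:
  assumes S: "S \<in> hops K" and k: "0 \<le> k" and le: "\<And>A. A \<in> M \<Longrightarrow> nrm (S (\<pi> A w)) \<le> k * nrm (\<pi> A w)"
    and x: "x \<in> hcarrier K"
  shows "nrm (S x) \<le> k * nrm x"
proof (rule field_le_epsilon)
  fix e :: real assume e: "0 < e"
  obtain c where "\<forall>x\<in>hcarrier K. nrm (S x) \<le> c * nrm x" using S unfolding hops_def by blast
  then have c: "nrm (S y) \<le> c * nrm y" if "y \<in> hcarrier K" for y using that by blast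
  have cl: "S y \<in> hcarrier K" if "y \<in> hcarrier K" for y using S that by (simp add: hops_def)
  define t where "t = e / (\<bar>c\<bar> + k + 1)"
  have pos: "0 < \<bar>c\<bar> + k + 1" using k by linarith
  have t: "0 < t" using e pos by (simp add: t_def)
  obtain A where A: "A \<in> M" "nrm (x \<^bold>- \<pi> A w) < t" using cyclic[OF x t] by blast
  note Aw = \<pi>_closed[OF A(1) w]
  note xA = diff_closed[OF x Aw]
  let ?d = "nrm (x \<^bold>- \<pi> A w)"
  have "S x = S (x \<^bold>- \<pi> A w) \<^bold>+ S (\<pi> A w)"
    using hops_diff[OF S x Aw] diff_add_cancel[OF cl[OF x] cl[OF Aw]] by simp
  then have "nrm (S x) \<le> nrm (S (x \<^bold>- \<pi> A w)) + nrm (S (\<pi> A w))"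
    using norm_triangle[OF cl[OF xA] cl[OF Aw]] by simp
  also have "\<dots> \<le> \<bar>c\<bar> * ?d + k * nrm (\<pi> A w)"
  proof (rule add_mono[OF _ le[OF A(1)]])
    have "c * ?d \<le> \<bar>c\<bar> * ?d" by (rule mult_right_mono[OF _ norm_nonneg[OF xA]]) simp
    with c[OF xA] show "nrm (S (x \<^bold>- \<pi> A w)) \<le> \<bar>c\<bar> * ?d" by linarith
  qed
  also have "\<dots> \<le> \<bar>c\<bar> * ?d + k * (nrm x + ?d)"
    using norm_diff_norm[OF x Aw] k by (intro add_left_mono mult_left_mono) auto
  also have "\<dots> \<le> k * nrm x + (\<bar>c\<bar> + k + 1) * ?d"
    using norm_nonneg[OF xA] by (simp add: algebra_simps)
  also have "(\<bar>c\<bar> + k + 1) * ?d \<le> (\<bar>c\<bar> + k + 1) * t" using A(2) pos by (intro mult_left_mono) auto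
  also have "(\<bar>c\<bar> + k + 1) * t = e" using pos by (simp add: t_def)
  finally show "nrm (S x) \<le> k * nrm x + e" by simp
qed

lemma scale_hops: "hscale K c \<in> hops K"
  by (auto simp: hops_def closed scale_add_right scale_scale mult.commute norm_scale intro!: exI[of _ "cmod c"])

text \<open>Here \<open>\<parallel>\<pi>(Z)w - \<phi>(Z)w\<parallel>\<^sup>2 = \<phi>(Z\<^sup>*Z) - |\<phi>(Z)|\<^sup>2 = 0\<close>.\<close>

lemma central_scalar:
  assumes Z: "Z \<in> center M" and one: "\<phi> (\<lambda>l. id_blinfun) = 1"
    and mult: "\<phi> (\<lambda>l. op_adj (Z l) o\<^sub>L Z l) = \<phi> (\<lambda>l. op_adj (Z l)) * \<phi> Z"
    and x: "x \<in> hcarrier K"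
  shows "\<pi> Z x = \<phi> Z \<^bold>\<cdot> x"
proof -
  have ZM: "Z \<in> M" using Z by (simp add: center_def)
  note Zw = \<pi>_closed[OF ZM w]
  let ?c = "\<phi> Z"
  note cw = scale_closed[OF w, of ?c]
  have "hip K (\<pi> Z w \<^bold>- ?c \<^bold>\<cdot> w) (\<pi> Z w \<^bold>- ?c \<^bold>\<cdot> w)
      = hip K (\<pi> Z w) (\<pi> Z w) - ?c * hip K (\<pi> Z w) w - cnj ?c * hip K w (\<pi> Z w) + cnj ?c * ?c * hip K w w"
    using Zw cw w by (simp add: ip_diff_left ip_diff_right diff_closed ip_scale_left ip_scale_right algebra_simps)
  also have "hip K (\<pi> Z w) (\<pi> Z w) = cnj ?c * ?c"
    using norm_square[OF ZM] ip_self[OF Zw] by (simp add: mult state_op_adj[OF ZM])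
  also have "hip K w (\<pi> Z w) = ?c" by (simp add: state ZM)
  also have "hip K (\<pi> Z w) w = cnj ?c" using ip_commute[OF Zw w] by (simp add: state ZM)
  also have "hip K w w = 1" using ip_self[OF w] by (simp add: norm_w[OF one])
  finally have "hip K (\<pi> Z w \<^bold>- ?c \<^bold>\<cdot> w) (\<pi> Z w \<^bold>- ?c \<^bold>\<cdot> w) = 0" by (simp add: algebra_simps)
  then have Zw_eq: "\<pi> Z w = ?c \<^bold>\<cdot> w"
    using ip_eq_zero[OF diff_closed[OF Zw cw]] diff_eq_zeroD[OF Zw cw] by simp
  show ?thesis
  proof (rule dense_eq[OF hops[OF ZM] scale_hops _ x])
    \<comment> \<open>Centrality moves the scalar action from w to the dense subspace of vectors
      \<pi>(A) w.\<close>
    fix A assume A: "A \<in> M"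
    have "(\<lambda>l. Z l o\<^sub>L A l) = (\<lambda>l. A l o\<^sub>L Z l)" using Z A by (simp add: center_def)
    then have "\<pi> Z (\<pi> A w) = \<pi> A (\<pi> Z w)" using \<pi>_comp[OF ZM A w] \<pi>_comp[OF A ZM w] by simp
    then show "\<pi> Z (\<pi> A w) = ?c \<^bold>\<cdot> \<pi> A w" by (simp add: Zw_eq \<pi>_scale_arg[OF A w])
  qed
qed

end

context vacuum_net begin

lemma gns_scaling_algebra:
  assumes "gns_triple (scaling_algebra \<AA> U) \<phi> K \<pi> w"
  shows "gns K (scaling_algebra \<AA> U) \<phi> \<pi> w"
proof (intro gns.intro gns_axioms.intro)
  show "hilbert_space K" using assms by (simp add: gns_triple_def)
qed (intro assms scaling_algebraD scaling_algebra_add scaling_algebra_comp scaling_algebra_scale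
  scaling_algebra_op_adj scaling_algebra_id; assumption)+

lemma multiplicative_limit_state_one:
  assumes "multiplicative_limit_state (scaling_algebra \<AA> U) \<Omega> \<phi>"
  shows "\<phi> (\<lambda>l. id_blinfun) = 1"
proof -
  obtain m where m: "asymptotic_mean (scaling_algebra \<AA> U) m"
    and \<phi>: "\<And>A. A \<in> scaling_algebra \<AA> U \<Longrightarrow> \<phi> A = m (vacuum_expectation \<Omega> A)"
    using assms unfolding multiplicative_limit_state_def by blast
  have "\<phi> (\<lambda>l. id_blinfun) = m (vacuum_expectation \<Omega> (\<lambda>l. id_blinfun))"
    by (rule \<phi>[OF scaling_algebra_id])
  also have "vacuum_expectation \<Omega> (\<lambda>l. id_blinfun) = (\<lambda>l. id_blinfun)"
    by (simp add: vacuum_expectation_def cinner_Omega_Omega scalar_op_algebra)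
  finally show ?thesis using m by (simp add: asymptotic_mean_def state_on_def)
qed

end

theorem corollary3p3:
  fixes \<AA> :: "'s::finite mink set \<Rightarrow> ('h::complex_hilbert \<Rightarrow>\<^sub>L 'h) set"
    and U :: "'s mink \<times> 's mink_mat \<Rightarrow> 'h \<Rightarrow>\<^sub>L 'h"
    and \<Omega> :: 'h
    and M :: "'h scaling_fun set"
    and \<omega>0 :: "'h scaling_fun \<Rightarrow> complex"
    and H0 :: "'a hspace"
    and \<pi>0 :: "'h scaling_fun \<Rightarrow> 'a \<Rightarrow> 'a"
    and \<Omega>0 :: 'a
    and \<nu> :: "'z::t2_space measure"
    and \<omega>z :: "'z \<Rightarrow> 'h scaling_fun \<Rightarrow> complex"
    and Hz :: "'z \<Rightarrow> 'b hspace"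
    and \<pi>z :: "'z \<Rightarrow> 'h scaling_fun \<Rightarrow> 'b \<Rightarrow> 'b"
    and \<Omega>z :: "'z \<Rightarrow> 'b"
    and \<Gamma> :: "('z \<Rightarrow> 'b) set"
  defines "M \<equiv> scaling_algebra \<AA> U"
    and "\<Gamma> \<equiv> gns_sections M \<pi>z \<Omega>z"
  assumes "vacuum_net \<AA> U \<Omega>"
    and "limit_state M \<Omega> \<omega>0"
    and "gns_triple M \<omega>0 H0 \<pi>0 \<Omega>0"
    and "compact (UNIV :: 'z set)"
    and "prob_space \<nu>" and "regular_borel \<nu>"
    and "\<And>z. multiplicative_limit_state M \<Omega> (\<omega>z z)"
    and "\<And>z. gns_triple M (\<omega>z z) (Hz z) (\<pi>z z) (\<Omega>z z)"
    and "\<And>A. A \<in> M \<Longrightarrow> has_bochner_integral \<nu> (\<lambda>z. \<omega>z z A) (\<omega>0 A)"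
    and "(\<lambda>C z. \<omega>z z C) ` center M = {f. continuous_on UNIV f}"
  shows "fundamental_family \<nu> Hz \<Gamma> \<and>
    (\<exists>V. hunitary H0 (direct_integral \<nu> Hz \<Gamma>) V \<and>
      (\<forall>A\<in>M. V (\<pi>0 A \<Omega>0) = section_class \<nu> Hz \<Gamma> (\<lambda>z. \<pi>z z A (\<Omega>z z))) \<and>
      (\<forall>A\<in>M. decomposable \<nu> Hz \<Gamma> (transport H0 V (\<pi>0 A))) \<and>
      (\<forall>A\<in>M. decomposes_as \<nu> Hz \<Gamma> (transport H0 V (\<pi>0 A)) (\<lambda>z. \<pi>z z A)) \<and>
      (\<forall>A\<in>center M. diagonal \<nu> Hz \<Gamma> (transport H0 V (\<pi>0 A)) \<and>
         decomposes_as \<nu> Hz \<Gamma> (transport H0 V (\<pi>0 A)) (\<lambda>z. hscale (Hz z) (\<omega>z z A))))"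
proof -
  interpret N: vacuum_net \<AA> U \<Omega> by fact
  interpret G0: gns H0 M \<omega>0 \<pi>0 \<Omega>0
    unfolding M_def using assms(5)[unfolded M_def] by (rule N.gns_scaling_algebra)
  have Gz: "gns (Hz z) M (\<omega>z z) (\<pi>z z) (\<Omega>z z)" for z
    unfolding M_def using assms(10)[unfolded M_def] by (rule N.gns_scaling_algebra)
  interpret Gz: gns "Hz z" M "\<omega>z z" "\<pi>z z" "\<Omega>z z" for z by (rule Gz)
  interpret \<nu>: prob_space \<nu> by fact
  interpret F: hilbert_family \<nu> Hz
    by (intro hilbert_family.intro hilbert_family_axioms.intro \<nu>.prob_space_axioms Gz.hilbert_space_axioms)
  define sec where "sec A z = \<pi>z z A (\<Omega>z z)" for A z
  have \<Gamma>: "\<Gamma> = sec ` M" by (auto simp: \<Gamma>_def gns_sections_def sec_def[abs_def])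
  have one: "\<omega>z z (\<lambda>l. id_blinfun) = 1" for z
    using N.multiplicative_limit_state_one assms(9) by (simp add: M_def)
  \<comment> \<open>Replaces the fibre dependent bound contained in \<open>representation\<close> by
    one that is the same for all z.\<close>
  have bound: "hnorm (Hz z) (\<pi>z z A x) \<le> sup_norm A * hnorm (Hz z) x"
    if A: "A \<in> M" and x: "x \<in> hcarrier (Hz z)" for A z x
  proof (rule Gz.dense_bound[OF Gz.hops[OF A] _ _ x])
    show "0 \<le> sup_norm A" using N.scaling_algebraD(3) A by (simp add: M_def)
    fix B assume B: "B \<in> M"
    note AB = Gz.M_comp[OF A B]
    obtain m where m: "asymptotic_mean M m" "\<And>A. A \<in> M \<Longrightarrow> \<omega>z z A = m (vacuum_expectation \<Omega> A)"
      using assms(9)[of z] unfolding multiplicative_limit_state_def by blast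
    have sq: "(hnorm (Hz z) (\<pi>z z D (\<Omega>z z)))\<^sup>2 = Re (\<omega>z z (\<lambda>l. op_adj (D l) o\<^sub>L D l))" if "D \<in> M" for D
      using Gz.norm_square[OF that, of z] by (metis Re_complex_of_real)
    have "(hnorm (Hz z) (\<pi>z z A (\<pi>z z B (\<Omega>z z))))\<^sup>2 \<le> (sup_norm A)\<^sup>2 * (hnorm (Hz z) (\<pi>z z B (\<Omega>z z)))\<^sup>2"
      unfolding Gz.\<pi>_comp[OF A B Gz.w, symmetric] sq[OF AB] sq[OF B]
      by (rule N.limit_functional_bound[OF m(1)[unfolded M_def] m(2)[unfolded M_def] A[unfolded M_def] B[unfolded M_def]])
    then have "(hnorm (Hz z) (\<pi>z z A (\<pi>z z B (\<Omega>z z))))\<^sup>2 \<le> (sup_norm A * hnorm (Hz z) (\<pi>z z B (\<Omega>z z)))\<^sup>2"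
      by (simp add: power_mult_distrib)
    then show "hnorm (Hz z) (\<pi>z z A (\<pi>z z B (\<Omega>z z))) \<le> sup_norm A * hnorm (Hz z) (\<pi>z z B (\<Omega>z z))"
      by (rule power2_le_imp_le)
        (intro mult_nonneg_nonneg \<open>0 \<le> sup_norm A\<close> Gz.norm_nonneg Gz.\<pi>_closed B Gz.w)
  qed
  have sup0: "0 \<le> sup_norm A" if "A \<in> M" for A using N.scaling_algebraD(3) that by (simp add: M_def)
  have sec_norm: "hnorm (Hz z) (sec A z) \<le> sup_norm A" if "A \<in> M" for A z
    using bound[OF that Gz.w] by (simp add: sec_def Gz.norm_w[OF one])
  have sec_closed: "sec A z \<in> hcarrier (Hz z)" if "A \<in> M" for A z
    unfolding sec_def by (rule Gz.\<pi>_closed[OF that Gz.w])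
  have sec_sections: "sec A \<in> sections Hz" if "A \<in> M" for A
    using sec_closed[OF that] by (simp add: sections_def)
  have central: "\<pi>z z C x = hscale (Hz z) (\<omega>z z C) x" if C: "C \<in> center M" and x: "x \<in> hcarrier (Hz z)" for C x z
  proof (rule Gz.central_scalar[OF C one _ x])
    show "\<omega>z z (\<lambda>l. op_adj (C l) o\<^sub>L C l) = \<omega>z z (\<lambda>l. op_adj (C l)) * \<omega>z z C"
      by (rule N.multiplicative_limit_state_center) (use assms(9)[of z] C in \<open>simp_all add: M_def\<close>)
  qed
  have square: "A \<in> M \<Longrightarrow> (\<lambda>l. op_adj (A l) o\<^sub>L A l) \<in> M" for A
    using N.scaling_algebra_square by (simp add: M_def)
  have sec_sq: "complex_of_real ((hnorm (Hz z) (sec A z))\<^sup>2) = \<omega>z z (\<lambda>l. op_adj (A l) o\<^sub>L A l)" if "A \<in> M" for A z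
    unfolding sec_def by (rule Gz.norm_square[OF that])
  \<comment> \<open>The squared norm is the value of the fibre state at A^* A. The disintegration
    hypothesis at this element gives measurability, integrability and the isometry property
    together.\<close>
  have sec_int: "integrable (completion \<nu>) (\<lambda>z. (hnorm (Hz z) (sec A z))\<^sup>2)"
    and sec_integral: "(LINT z|completion \<nu>. (hnorm (Hz z) (sec A z))\<^sup>2) = (hnorm H0 (\<pi>0 A \<Omega>0))\<^sup>2"
    if A: "A \<in> M" for A
  proof -
    have h: "has_bochner_integral \<nu> (\<lambda>z. complex_of_real ((hnorm (Hz z) (sec A z))\<^sup>2))
        (complex_of_real ((hnorm H0 (\<pi>0 A \<Omega>0))\<^sup>2))"
      unfolding sec_sq[OF A] G0.norm_square[OF A] by (rule assms(11)[OF square[OF A]])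
    then have "has_bochner_integral \<nu> (\<lambda>z. Re (complex_of_real ((hnorm (Hz z) (sec A z))\<^sup>2)))
        (Re (complex_of_real ((hnorm H0 (\<pi>0 A \<Omega>0))\<^sup>2)))"
      by (rule has_bochner_integral_bounded_linear[OF bounded_linear_Re])
    then have r: "has_bochner_integral \<nu> (\<lambda>z. (hnorm (Hz z) (sec A z))\<^sup>2) ((hnorm H0 (\<pi>0 A \<Omega>0))\<^sup>2)"
      by (simp only: Re_complex_of_real)
    then have i: "integrable \<nu> (\<lambda>z. (hnorm (Hz z) (sec A z))\<^sup>2)" by (rule integrable.intros)
    note m = borel_measurable_integrable[OF i]
    show "integrable (completion \<nu>) (\<lambda>z. (hnorm (Hz z) (sec A z))\<^sup>2)"
      using i by (simp only: integrable_completion[OF m])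
    show "(LINT z|completion \<nu>. (hnorm (Hz z) (sec A z))\<^sup>2) = (hnorm H0 (\<pi>0 A \<Omega>0))\<^sup>2"
      unfolding integral_completion[OF m] by (rule has_bochner_integral_integral_eq[OF r])
  qed
  have sec_add: "(\<lambda>z. hadd (Hz z) (sec A z) (sec B z)) = sec (\<lambda>l. A l + B l)" if "A \<in> M" "B \<in> M" for A B
    by (rule ext) (simp add: sec_def Gz.\<pi>_add[OF that Gz.w])
  have sec_scale: "(\<lambda>z. hscale (Hz z) c (sec A z)) = sec (\<lambda>l. scalar_op c o\<^sub>L A l)" if "A \<in> M" for A c
    by (rule ext) (simp add: sec_def Gz.\<pi>_scale[OF that Gz.w])
  have sec_zero: "(\<lambda>z. hzero (Hz z)) \<in> \<Gamma>"
  proof -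
    have "(\<lambda>z. hzero (Hz z)) = (\<lambda>z. hscale (Hz z) 0 (sec (\<lambda>l. id_blinfun) z))"
      by (rule ext) (simp add: Gz.scale_zero[OF sec_closed[OF G0.M_id]])
    then show ?thesis unfolding \<Gamma> sec_scale[OF G0.M_id] using G0.M_scale[OF G0.M_id, of 0] by simp
  qed
  have fam: "fundamental_family \<nu> Hz \<Gamma>"
    unfolding fundamental_family_def section_subspace_def
  proof (intro conjI sec_zero ballI allI)
    show "\<Gamma> \<subseteq> sections Hz" using sec_sections by (auto simp: \<Gamma>)
    show "(\<lambda>z. hadd (Hz z) (\<xi> z) (\<psi> z)) \<in> \<Gamma>" if "\<xi> \<in> \<Gamma>" "\<psi> \<in> \<Gamma>" for \<xi> \<psi>
    proof -
      obtain A B where "A \<in> M" "B \<in> M" "\<xi> = sec A" "\<psi> = sec B" using \<open>\<xi> \<in> \<Gamma>\<close> \<open>\<psi> \<in> \<Gamma>\<close> by (auto simp: \<Gamma>)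
      then show ?thesis using G0.M_add by (simp add: sec_add \<Gamma>)
    qed
    show "(\<lambda>z. hscale (Hz z) c (\<xi> z)) \<in> \<Gamma>" if "\<xi> \<in> \<Gamma>" for c \<xi>
    proof -
      obtain A where "A \<in> M" "\<xi> = sec A" using \<open>\<xi> \<in> \<Gamma>\<close> by (auto simp: \<Gamma>)
      then show ?thesis using G0.M_scale by (simp add: sec_scale \<Gamma>)
    qed
    show "integrable (completion \<nu>) (\<lambda>z. (hnorm (Hz z) (\<xi> z))\<^sup>2)" if "\<xi> \<in> \<Gamma>" for \<xi>
      using that sec_int by (auto simp: \<Gamma>)
  qed
  \<comment> \<open>By surjectivity, \<open>\<Gamma>\<close> is a module over the continuous functions, which are dense in \<open>L\<^sup>\<infinity>\<close> for the \<open>L\<^sup>2\<close> distance.\<close>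
  have approx: "\<exists>\<delta>\<in>\<Gamma>. F.close_to e (\<lambda>z. hscale (Hz z) (f z) (\<gamma> z)) \<delta>"
    if f: "f \<in> Linf \<nu>" and \<gamma>: "\<gamma> \<in> \<Gamma>" and e: "0 < e" for f \<gamma> e
  proof -
    obtain A where A: "A \<in> M" "\<gamma> = sec A" using \<gamma> by (auto simp: \<Gamma>)
    \<comment> \<open>A bound for the squared norm of \<gamma> in every fibre. Approximating f up to
      e / (a + 1) therefore leaves an error of at most e.\<close>
    define a where "a = (sup_norm A)\<^sup>2"
    have a: "0 < a + 1" by (simp add: a_def add_nonneg_pos)
    have "0 < e / (a + 1)" using e a by simp
    from continuous_dense_Linf[OF assms(6) \<nu>.finite_measure_axioms assms(8) f this]
    obtain h g where h: "continuous_on UNIV h" and g: "integrable (completion \<nu>) g"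
      "AE z in \<nu>. (cmod (f z - h z))\<^sup>2 \<le> g z" "integral\<^sup>L (completion \<nu>) g \<le> e / (a + 1)" by blast
    from h have "h \<in> (\<lambda>C z. \<omega>z z C) ` center M" unfolding assms(12) by simp
    then obtain C where C: "C \<in> center M" "\<And>z. h z = \<omega>z z C" by auto
    then have CM: "C \<in> M" by (simp add: center_def)
    note CA = G0.M_comp[OF CM A(1)]
    have "F.close_to e (\<lambda>z. hscale (Hz z) (f z) (\<gamma> z)) (sec (\<lambda>l. C l o\<^sub>L A l))"
      unfolding F.close_to_def
    proof (intro exI conjI)
      show "integrable (completion \<nu>) (\<lambda>z. a * g z)" using g(1) by simp
      show "AE z in \<nu>. (hnorm (Hz z) (hdiff (Hz z) (hscale (Hz z) (f z) (\<gamma> z)) (sec (\<lambda>l. C l o\<^sub>L A l) z)))\<^sup>2 \<le> a * g z"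
        using g(2)
      proof eventually_elim
        case (elim z)
        have "sec (\<lambda>l. C l o\<^sub>L A l) z = hscale (Hz z) (h z) (sec A z)"
          unfolding sec_def Gz.\<pi>_comp[OF CM A(1) Gz.w] C(2) by (rule central[OF C(1) Gz.\<pi>_closed[OF A(1) Gz.w]])
        then have "hdiff (Hz z) (hscale (Hz z) (f z) (\<gamma> z)) (sec (\<lambda>l. C l o\<^sub>L A l) z) = hscale (Hz z) (f z - h z) (sec A z)"
          by (simp add: A(2) Gz.diff_scale[OF sec_closed[OF A(1)]])
        then have "(hnorm (Hz z) (hdiff (Hz z) (hscale (Hz z) (f z) (\<gamma> z)) (sec (\<lambda>l. C l o\<^sub>L A l) z)))\<^sup>2
            = (cmod (f z - h z))\<^sup>2 * (hnorm (Hz z) (sec A z))\<^sup>2"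
          by (simp add: Gz.norm_scale[OF sec_closed[OF A(1)]] power_mult_distrib)
        also have "\<dots> \<le> g z * a"
          unfolding a_def
          by (rule mult_mono[OF elim power_mono[OF sec_norm[OF A(1)] Gz.norm_nonneg[OF sec_closed[OF A(1)]]]])
            (use order_trans[OF zero_le_power2 elim] in auto)
        finally show ?case by (simp add: mult.commute)
      qed
      have "(LINT z|completion \<nu>. a * g z) \<le> a * (e / (a + 1))"
        using g(3) by (simp add: a_def mult_left_mono del: times_divide_eq_right)
      also have "\<dots> \<le> (a + 1) * (e / (a + 1))" by (rule mult_right_mono) (use e a in auto)
      also have "\<dots> = e" using a by simp
      finally show "(LINT z|completion \<nu>. a * g z) \<le> e" .
    qed
    then show ?thesis using CA by (auto simp: \<Gamma>)
  qed
  interpret F: module_family \<nu> Hz \<Gamma>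
    by (intro module_family.intro module_family_axioms.intro F.hilbert_family_axioms fam approx)
  interpret DI: hilbert_space F.DI by (rule F.DI_hilbert_space)
  have sec_Hull: "sec A \<in> F.Hull" if "A \<in> M" for A
    by (rule F.\<Gamma>_Hull) (use that \<Gamma> in auto)
  have norm_eq: "hnorm F.DI (F.cls (sec A)) = hnorm H0 (\<pi>0 A \<Omega>0)" if "A \<in> M" for A
    using sec_integral[OF that] G0.norm_nonneg[OF G0.\<pi>_closed[OF that G0.w]]
    by (simp add: F.DI_norm sec_Hull that section_norm_def)
  \<comment> \<open>Differences of generators are again generators, so preservation of distances
    reduces to \<open>norm_eq\<close>.\<close>
  have diff: "(\<lambda>l. A l + (scalar_op (-1) o\<^sub>L B l)) \<in> M"
    "F.cls (sec (\<lambda>l. A l + (scalar_op (-1) o\<^sub>L B l))) = hdiff F.DI (F.cls (sec A)) (F.cls (sec B))"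
    "\<pi>0 (\<lambda>l. A l + (scalar_op (-1) o\<^sub>L B l)) \<Omega>0 = hdiff H0 (\<pi>0 A \<Omega>0) (\<pi>0 B \<Omega>0)"
    if AB: "A \<in> M" "B \<in> M" for A B
  proof -
    note B' = G0.M_scale[OF AB(2), of "-1"]
    show "(\<lambda>l. A l + (scalar_op (-1) o\<^sub>L B l)) \<in> M" by (rule G0.M_add[OF AB(1) B'])
    show "F.cls (sec (\<lambda>l. A l + (scalar_op (-1) o\<^sub>L B l))) = hdiff F.DI (F.cls (sec A)) (F.cls (sec B))"
    proof -
      have "sec (\<lambda>l. A l + (scalar_op (-1) o\<^sub>L B l)) = (\<lambda>z. hdiff (Hz z) (sec A z) (sec B z))"
        unfolding hdiff_def sec_add[OF AB(1) B', symmetric] sec_scale[OF AB(2), symmetric] ..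
      then show ?thesis by (simp only: F.DI_diff[OF sec_Hull[OF AB(1)] sec_Hull[OF AB(2)]])
    qed
    show "\<pi>0 (\<lambda>l. A l + (scalar_op (-1) o\<^sub>L B l)) \<Omega>0 = hdiff H0 (\<pi>0 A \<Omega>0) (\<pi>0 B \<Omega>0)"
      unfolding G0.\<pi>_add[OF AB(1) B' G0.w] G0.\<pi>_scale[OF AB(2) G0.w] hdiff_def ..
  qed
  interpret I: dense_isometry H0 F.DI M "\<lambda>A. \<pi>0 A \<Omega>0" "\<lambda>A. F.cls (sec A)"
  proof (intro dense_isometry.intro dense_isometry_axioms.intro)
    show "hilbert_space H0" "hilbert_space F.DI" by unfold_locales
    fix A assume A: "A \<in> M"
    show "\<pi>0 A \<Omega>0 \<in> hcarrier H0" by (rule G0.\<pi>_closed[OF A G0.w])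
    show "F.cls (sec A) \<in> hcarrier F.DI" by (rule F.cls_carrier[OF sec_Hull[OF A]])
    show "\<exists>k\<in>M. \<pi>0 k \<Omega>0 = hscale H0 c (\<pi>0 A \<Omega>0) \<and> F.cls (sec k) = hscale F.DI c (F.cls (sec A))" for c
      by (rule bexI[OF _ G0.M_scale[OF A, of c]])
        (simp add: G0.\<pi>_scale[OF A G0.w] F.DI_scale[OF sec_Hull[OF A]] sec_scale[OF A])
    fix B assume B: "B \<in> M"
    show "hnorm F.DI (hdiff F.DI (F.cls (sec A)) (F.cls (sec B))) = hnorm H0 (hdiff H0 (\<pi>0 A \<Omega>0) (\<pi>0 B \<Omega>0))"
      unfolding diff(2,3)[OF A B, symmetric] by (rule norm_eq[OF diff(1)[OF A B]])
    show "\<exists>k\<in>M. \<pi>0 k \<Omega>0 = hadd H0 (\<pi>0 A \<Omega>0) (\<pi>0 B \<Omega>0) \<and> F.cls (sec k) = hadd F.DI (F.cls (sec A)) (F.cls (sec B))"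
      by (rule bexI[OF _ G0.M_add[OF A B]])
        (simp add: G0.\<pi>_add[OF A B G0.w] F.DI_add[OF sec_Hull[OF A] sec_Hull[OF B]] sec_add[OF A B])
  next
    fix u and e :: real assume "u \<in> hcarrier H0" "0 < e"
    then show "\<exists>A\<in>M. hnorm H0 (hdiff H0 u (\<pi>0 A \<Omega>0)) < e" by (rule G0.cyclic)
  next
    fix X and e :: real assume "X \<in> hcarrier F.DI" "0 < e"
    from F.\<Gamma>_dense_DI[OF this] show "\<exists>A\<in>M. hnorm F.DI (hdiff F.DI X (F.cls (sec A))) < e"
      by (simp add: \<Gamma>)
  qed
  obtain V where V: "hunitary H0 F.DI V" and V_sec: "\<And>A. A \<in> M \<Longrightarrow> V (\<pi>0 A \<Omega>0) = F.cls (sec A)"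
    using I.unitary_extension by blast
  have Vc: "V x \<in> hcarrier F.DI" if "x \<in> hcarrier H0" for x
    using V that by (auto simp: hunitary_def bij_betw_def)
  have V_diff: "V (hdiff H0 x y) = hdiff F.DI (V x) (V y)" if "x \<in> hcarrier H0" "y \<in> hcarrier H0" for x y
    using V that by (simp add: hunitary_def hdiff_def G0.scale_closed)
  let ?T = "\<lambda>A. transport H0 V (\<pi>0 A)"
  have T_hops: "?T A \<in> hops F.DI" if "A \<in> M" for A
    by (rule transport_hops[OF V G0.hops[OF that] G0.hilbert_space_axioms])
  \<comment> \<open>Being uniform in z, the operator bound can be taken out of the upper
    integral.\<close>
  have lipschitz: "F.close_to ((sup_norm A)\<^sup>2 * e) (\<lambda>z. \<pi>z z A (\<xi> z)) (\<lambda>z. \<pi>z z A (\<psi> z))"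
    if A: "A \<in> M" and sec: "\<xi> \<in> sections Hz" "\<psi> \<in> sections Hz" and close: "F.close_to e \<xi> \<psi>" for A e \<xi> \<psi>
  proof (rule F.close_to_lipschitz[OF sup0[OF A] close])
    note c = F.sectionsD[OF sec(1)] F.sectionsD[OF sec(2)]
    show "AE z in \<nu>. hnorm (Hz z) (hdiff (Hz z) (\<pi>z z A (\<xi> z)) (\<pi>z z A (\<psi> z)))
        \<le> sup_norm A * hnorm (Hz z) (hdiff (Hz z) (\<xi> z) (\<psi> z))"
      using bound[OF A Gz.diff_closed[OF c]] by (simp add: Gz.hops_diff[OF Gz.hops[OF A] c])
    show "(\<lambda>z. \<pi>z z A (\<xi> z)) \<in> sections Hz" "(\<lambda>z. \<pi>z z A (\<psi> z)) \<in> sections Hz"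
      using Gz.\<pi>_closed[OF A] c by (auto simp: sections_def)
  qed
  have \<pi>_sec: "(\<lambda>z. \<pi>z z A (sec B z)) = sec (\<lambda>l. A l o\<^sub>L B l)" if "A \<in> M" "B \<in> M" for A B
    by (rule ext) (simp add: sec_def Gz.\<pi>_comp[OF that Gz.w])
  have \<pi>_Hull: "(\<lambda>z. \<pi>z z A (\<xi> z)) \<in> F.Hull" if A: "A \<in> M" and \<xi>: "\<xi> \<in> F.Hull" for A \<xi>
    unfolding F.Hull_def
  proof (intro CollectI conjI allI impI)
    note sec = F.Hull_sections[OF \<xi>]
    show "(\<lambda>z. \<pi>z z A (\<xi> z)) \<in> sections Hz"
      using Gz.\<pi>_closed[OF A] F.sectionsD[OF sec] by (auto simp: sections_def)
    fix e :: real assume e: "0 < e"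
    define d where "d = e / ((sup_norm A)\<^sup>2 + 1)"
    have pos: "0 < (sup_norm A)\<^sup>2 + 1" by (simp add: add_nonneg_pos)
    have d: "0 < d" using e pos by (simp add: d_def)
    from F.HullD[OF \<xi> d] obtain \<gamma> where \<gamma>: "\<gamma> \<in> \<Gamma>" "F.close_to d \<xi> \<gamma>" .
    obtain B where B: "B \<in> M" "\<gamma> = sec B" using \<gamma>(1) by (auto simp: \<Gamma>)
    have "F.close_to ((sup_norm A)\<^sup>2 * d) (\<lambda>z. \<pi>z z A (\<xi> z)) (sec (\<lambda>l. A l o\<^sub>L B l))"
      using lipschitz[OF A sec sec_sections[OF B(1)] \<gamma>(2)[unfolded B(2)]] by (simp only: \<pi>_sec[OF A B(1)])
    moreover have "(sup_norm A)\<^sup>2 * d \<le> e"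
    proof -
      have "(sup_norm A)\<^sup>2 * d \<le> ((sup_norm A)\<^sup>2 + 1) * d" using d by (intro mult_right_mono) auto
      also have "\<dots> = e" using pos by (simp add: d_def)
      finally show ?thesis .
    qed
    ultimately have "F.close_to e (\<lambda>z. \<pi>z z A (\<xi> z)) (sec (\<lambda>l. A l o\<^sub>L B l))"
      by (rule F.close_to_mono)
    then show "\<exists>\<gamma>\<in>\<Gamma>. F.close_to e (\<lambda>z. \<pi>z z A (\<xi> z)) \<gamma>"
      unfolding \<Gamma> using G0.M_comp[OF A B(1)] by blast
  qed
  \<comment> \<open>For \<xi> = \<open>sec B\<close> both sides are the class of \<open>sec\<close>
    at the product of A and B. Both are continuous in \<xi>, with constants c on the left and
    \<open>sup_norm A\<close> on the right, and such \<xi> are dense.\<close>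
  have T_cls: "?T A (F.cls \<xi>) = F.cls (\<lambda>z. \<pi>z z A (\<xi> z))" if A: "A \<in> M" and \<xi>: "\<xi> \<in> F.Hull" for A \<xi>
  proof -
    note A\<xi> = \<pi>_Hull[OF A \<xi>]
    obtain x where x: "x \<in> hcarrier H0" "F.cls \<xi> = V x" by (rule hunitary_surj[OF V F.cls_carrier[OF \<xi>]])
    obtain c where "\<forall>x\<in>hcarrier H0. hnorm H0 (\<pi>0 A x) \<le> c * hnorm H0 x"
      using G0.hops[OF A] unfolding hops_def by blast
    then have c: "hnorm H0 (\<pi>0 A y) \<le> c * hnorm H0 y" if "y \<in> hcarrier H0" for y using that by blast
    note Ax = G0.\<pi>_closed[OF A x(1)]
    have "V (\<pi>0 A x) = F.cls (\<lambda>z. \<pi>z z A (\<xi> z))"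
    proof (rule DI.approx_eq[OF Vc[OF Ax] F.cls_carrier[OF A\<xi>]])
      fix e :: real assume e: "0 < e"
      define t where "t = e / (\<bar>c\<bar> + sup_norm A + 1)"
      have pos: "0 < \<bar>c\<bar> + sup_norm A + 1" using sup0[OF A] by linarith
      have t: "0 < t" using e pos by (simp add: t_def)
      obtain B where B: "B \<in> M" "hnorm H0 (hdiff H0 x (\<pi>0 B \<Omega>0)) < t" using G0.cyclic[OF x(1) t] by blast
      note Bw = G0.\<pi>_closed[OF B(1) G0.w] and AB = G0.M_comp[OF A B(1)]
      let ?d = "hnorm H0 (hdiff H0 x (\<pi>0 B \<Omega>0))"
      have d0: "0 \<le> ?d" by (rule G0.norm_nonneg[OF G0.diff_closed[OF x(1) Bw]])
      have dist: "section_dist \<nu> Hz \<xi> (sec B) = ?d"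
        using F.DI_dist[OF \<xi> sec_Hull[OF B(1)]] hunitary_norm[OF V G0.diff_closed[OF x(1) Bw]]
        by (simp add: V_diff[OF x(1) Bw] V_sec[OF B(1)] x(2))
      have "F.close_to (?d\<^sup>2) \<xi> (sec B)"
        by (simp add: F.close_to_Hull_iff[OF \<xi> sec_Hull[OF B(1)]] dist)
      from lipschitz[OF A F.Hull_sections[OF \<xi>] sec_sections[OF B(1)] this]
      have "(section_dist \<nu> Hz (\<lambda>z. \<pi>z z A (\<xi> z)) (sec (\<lambda>l. A l o\<^sub>L B l)))\<^sup>2 \<le> (sup_norm A * ?d)\<^sup>2"
        by (simp only: \<pi>_sec[OF A B(1)] F.close_to_Hull_iff[OF A\<xi> sec_Hull[OF AB]] power_mult_distrib)
      then have 1: "section_dist \<nu> Hz (\<lambda>z. \<pi>z z A (\<xi> z)) (sec (\<lambda>l. A l o\<^sub>L B l)) \<le> sup_norm A * ?d"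
        by (rule power2_le_imp_le) (intro mult_nonneg_nonneg sup0 A d0)
      have "hdiff F.DI (V (\<pi>0 A x)) (F.cls (sec (\<lambda>l. A l o\<^sub>L B l))) = V (\<pi>0 A (hdiff H0 x (\<pi>0 B \<Omega>0)))"
        by (simp add: V_sec[OF AB, symmetric] G0.\<pi>_comp[OF A B(1) G0.w] G0.hops_diff[OF G0.hops[OF A] x(1) Bw]
            V_diff[OF Ax G0.\<pi>_closed[OF A Bw]])
      then have 2: "hnorm F.DI (hdiff F.DI (V (\<pi>0 A x)) (F.cls (sec (\<lambda>l. A l o\<^sub>L B l)))) \<le> c * ?d"
        using c[OF G0.diff_closed[OF x(1) Bw]]
        by (simp add: hunitary_norm[OF V G0.\<pi>_closed[OF A G0.diff_closed[OF x(1) Bw]]])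
      have "hnorm F.DI (hdiff F.DI (V (\<pi>0 A x)) (F.cls (\<lambda>z. \<pi>z z A (\<xi> z))))
        \<le> hnorm F.DI (hdiff F.DI (V (\<pi>0 A x)) (F.cls (sec (\<lambda>l. A l o\<^sub>L B l))))
          + hnorm F.DI (hdiff F.DI (F.cls (sec (\<lambda>l. A l o\<^sub>L B l))) (F.cls (\<lambda>z. \<pi>z z A (\<xi> z))))"
        by (rule DI.dist_triangle[OF Vc[OF Ax] F.cls_carrier[OF sec_Hull[OF AB]] F.cls_carrier[OF A\<xi>]])
      also have "hnorm F.DI (hdiff F.DI (F.cls (sec (\<lambda>l. A l o\<^sub>L B l))) (F.cls (\<lambda>z. \<pi>z z A (\<xi> z))))
          = section_dist \<nu> Hz (\<lambda>z. \<pi>z z A (\<xi> z)) (sec (\<lambda>l. A l o\<^sub>L B l))"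
        unfolding DI.dist_commute[OF F.cls_carrier[OF sec_Hull[OF AB]] F.cls_carrier[OF A\<xi>]]
        by (rule F.DI_dist[OF A\<xi> sec_Hull[OF AB]])
      also have "hnorm F.DI (hdiff F.DI (V (\<pi>0 A x)) (F.cls (sec (\<lambda>l. A l o\<^sub>L B l))))
          + section_dist \<nu> Hz (\<lambda>z. \<pi>z z A (\<xi> z)) (sec (\<lambda>l. A l o\<^sub>L B l)) \<le> c * ?d + sup_norm A * ?d"
        by (rule add_mono[OF 2 1])
      also have "\<dots> \<le> (\<bar>c\<bar> + sup_norm A + 1) * ?d"
        unfolding distrib_right[symmetric] by (rule mult_right_mono[OF _ d0]) linarith
      also have "\<dots> \<le> (\<bar>c\<bar> + sup_norm A + 1) * t" using B(2) pos by (intro mult_left_mono) auto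
      also have "\<dots> = e" using pos by (simp add: t_def)
      finally show "hnorm F.DI (hdiff F.DI (V (\<pi>0 A x)) (F.cls (\<lambda>z. \<pi>z z A (\<xi> z)))) \<le> e" .
    qed
    then show ?thesis by (simp add: x(2) transport_apply[OF V x(1)])
  qed
  have dec: "decomposes_as \<nu> Hz \<Gamma> (?T A) (\<lambda>z. \<pi>z z A)" if A: "A \<in> M" for A
    unfolding decomposes_as_def F.section_hull_eq
  proof (intro conjI T_hops[OF A] allI Gz.hops[OF A] ballI \<pi>_Hull[OF A] T_cls[OF A])
    show "\<exists>c. AE z in \<nu>. \<forall>x\<in>hcarrier (Hz z). hnorm (Hz z) (\<pi>z z A x) \<le> c * hnorm (Hz z) x"
      using bound[OF A] by (intro exI[of _ "sup_norm A"] AE_I2) blast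
  qed
  have diag: "(\<lambda>z. \<omega>z z C) \<in> Linf \<nu>" "decomposes_as \<nu> Hz \<Gamma> (?T C) (\<lambda>z. hscale (Hz z) (\<omega>z z C))"
    if C: "C \<in> center M" for C
  proof -
    have CM: "C \<in> M" using C by (simp add: center_def)
    \<comment> \<open>As \<pi>(C) acts by the scalar in question, its modulus is the norm of
      \<pi>(C) at the unit cyclic vector.\<close>
    have le: "cmod (\<omega>z z C) \<le> sup_norm C" for z
    proof -
      have "hnorm (Hz z) (\<pi>z z C (\<Omega>z z)) = cmod (\<omega>z z C)"
        by (simp add: central[OF C Gz.w] Gz.norm_scale[OF Gz.w] Gz.norm_w[OF one])
      with bound[OF CM Gz.w, of z] show ?thesis by (simp add: Gz.norm_w[OF one])
    qed
    have "integrable \<nu> (\<lambda>z. \<omega>z z C)" using assms(11)[OF CM] by (rule integrable.intros)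
    then have "(\<lambda>z. \<omega>z z C) \<in> borel_measurable (completion \<nu>)"
      by (intro measurable_completion borel_measurable_integrable)
    then show "(\<lambda>z. \<omega>z z C) \<in> Linf \<nu>" using le by (auto simp: Linf_def)
    \<comment> \<open>On sections the multiplication operator and the fibre operators of C coincide,
      so the diagonal decomposition is read off from the general one.\<close>
    have eq: "(\<lambda>z. hscale (Hz z) (\<omega>z z C) (\<xi> z)) = (\<lambda>z. \<pi>z z C (\<xi> z))" if "\<xi> \<in> F.Hull" for \<xi>
      by (rule ext) (simp add: central[OF C F.sectionsD[OF F.Hull_sections[OF that]]])
    show "decomposes_as \<nu> Hz \<Gamma> (?T C) (\<lambda>z. hscale (Hz z) (\<omega>z z C))"
      unfolding decomposes_as_def F.section_hull_eq
    proof (intro conjI T_hops[OF CM] allI Gz.scale_hops ballI)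
      show "\<exists>c. AE z in \<nu>. \<forall>x\<in>hcarrier (Hz z). hnorm (Hz z) (hscale (Hz z) (\<omega>z z C) x) \<le> c * hnorm (Hz z) x"
        by (intro exI[of _ "sup_norm C"] AE_I2 ballI) (simp add: Gz.norm_scale mult_right_mono le Gz.norm_nonneg)
      show "(\<lambda>z. hscale (Hz z) (\<omega>z z C) (\<xi> z)) \<in> F.Hull" if "\<xi> \<in> F.Hull" for \<xi>
        unfolding eq[OF that] by (rule \<pi>_Hull[OF CM that])
      show "?T C (F.cls \<xi>) = F.cls (\<lambda>z. hscale (Hz z) (\<omega>z z C) (\<xi> z))" if "\<xi> \<in> F.Hull" for \<xi>
        unfolding eq[OF that] by (rule T_cls[OF CM that])
    qed
  qed
  show ?thesis
  proof (intro conjI fam exI[of _ V] V ballI)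
    show "V (\<pi>0 A \<Omega>0) = F.cls (\<lambda>z. \<pi>z z A (\<Omega>z z))" if "A \<in> M" for A
      using V_sec[OF that] by (simp add: sec_def[abs_def])
    show "decomposable \<nu> Hz \<Gamma> (?T A)" if "A \<in> M" for A
      unfolding decomposable_def using dec[OF that] by blast
    show "decomposes_as \<nu> Hz \<Gamma> (?T A) (\<lambda>z. \<pi>z z A)" if "A \<in> M" for A by (rule dec[OF that])
    show "diagonal \<nu> Hz \<Gamma> (?T A)" if "A \<in> center M" for A
      unfolding diagonal_def by (rule bexI[where x = "\<lambda>z. \<omega>z z A"]) (rule diag[OF that])+
    show "decomposes_as \<nu> Hz \<Gamma> (?T A) (\<lambda>z. hscale (Hz z) (\<omega>z z A))" if "A \<in> center M" for A
      by (rule diag(2)[OF that])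
  qed
qed

end
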